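(* Let $\mathfrak{A}$ be a C*-algebra with a non-decreasing sequence of C*-subalgebras $\mathcal{U}=(\mathfrak{A}_n)_{n\in\mathbb{N}}$ such that $\mathfrak{A}=\overline{\bigcup_{n\in\mathbb{N}}\mathfrak{A}_n}^{\|\cdot\|_{\mathfrak{A}}}$. If the function $J\in\mathrm{algIdeal}(\bigcup_{n\in\mathbb{N}}\mathfrak{A}_n)_{prod}\mapsto\overline{J}^{\|\cdot\|_{\mathfrak{A}}}\in\mathrm{Ideal}(\mathfrak{A})$ is injective (and thus a bijection onto $\mathrm{Ideal}(\mathfrak{A})$), then the topology $Fell_{i(\mathcal{U})}$ agrees with the Fell topology $Fell$ on $\mathrm{Ideal}(\mathfrak{A})$. In particular, if $\mathfrak{A}$ is AF and $\mathcal{U}$ is chosen to be a family of finite-dimensional C*-algebras, then the topology $Fell_{i(\mathcal{U})}$ agrees with the topology $Fell$ on $\mathrm{Ideal}(\mathfrak{A})$.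
   Context: $\mathbb{N}=\{0,1,2,\dots\}$. For a C*-algebra $\mathfrak{B}$, $\mathrm{Ideal}(\mathfrak{B})$ is the set of norm-closed two-sided ideals of $\mathfrak{B}$, including $\{0\}$ and $\mathfrak{B}$; $\mathrm{Prim}(\mathfrak{B})$ is the set of kernels of non-zero irreducible *-representations of $\mathfrak{B}$. The Jacobson topology on $\mathrm{Prim}(\mathfrak{B})$ is the topology whose closed sets are the sets $\{J\in\mathrm{Prim}(\mathfrak{B}): J\supseteq I\}$, $I\in\mathrm{Ideal}(\mathfrak{B})$. For a topological space $X$, let $\mathcal{C}l(X)$ be the set of its closed subsets; the Fell topology on $\mathcal{C}l(X)$ has as basis the sets $U(K,F)=\{Y\in\mathcal{C}l(X): Y\cap K=\emptyset \text{ and } Y\cap A\neq\emptyset \text{ for all } A\in F\}$, where $K\subseteq X$ is compact and $F$ is a finite family of non-empty open subsets of $X$. The Fell topology, $Fell$, on $\mathrm{Ideal}(\mathfrak{B})$ is the initial topology induced by the bijection $I\in\mathrm{Ideal}(\mathfrak{B})\mapsto\{J\in\mathrm{Prim}(\mathfrak{B}):J\supseteq I\}\in\mathcal{C}l(\mathrm{Prim}(\mathfrak{B}))$, where $\mathrm{Prim}(\mathfrak{B})$ carries the Jacobson topology and $\mathcal{C}l(\mathrm{Prim}(\mathfrak{B}))$ its Fell topology. Given $\mathfrak{A}$ and $\mathcal{U}=(\mathfrak{A}_n)_{n\in\mathbb{N}}$ as in the claim, let $\mathrm{Ideal}(\mathfrak{A})_\infty=\{(J_n)_{n}\in\prod_{n\in\mathbb{N}}\mathrm{Ideal}(\mathfrak{A}_n):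 J_{n+1}\cap\mathfrak{A}_n=J_n\text{ for all }n\in\mathbb{N}\}$, equipped with the topology $Fell_\infty$, the relative topology from the product of the Fell topologies on the $\mathrm{Ideal}(\mathfrak{A}_n)$. Let $i(\cdot,\mathcal{U}):I\in\mathrm{Ideal}(\mathfrak{A})\mapsto(I\cap\mathfrak{A}_n)_{n\in\mathbb{N}}\in\mathrm{Ideal}(\mathfrak{A})_\infty$. The topology $Fell_{i(\mathcal{U})}$ on $\mathrm{Ideal}(\mathfrak{A})$ is the initial topology induced by $i(\cdot,\mathcal{U})$ and $(\mathrm{Ideal}(\mathfrak{A})_\infty,Fell_\infty)$. $\mathrm{algIdeal}(\bigcup_n\mathfrak{A}_n)$ is the set of two-sided ideals of the algebra $\bigcup_n\mathfrak{A}_n$ (not necessarily closed in $\mathfrak{A}$), and $\mathrm{algIdeal}(\bigcup_n\mathfrak{A}_n)_{prod}=\{J\in\mathrm{algIdeal}(\bigcup_n\mathfrak{A}_n): J\cap\mathfrak{A}_n\in\mathrm{Ideal}(\mathfrak{A}_n)\text{ for all }n\in\mathbb{N}\}$. *)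

theory Defs
  imports "HOL-Analysis.Analysis"
begin

section \<open>C*-algebras\<close>

class scaleC = scaleR +
  fixes scaleC :: "complex \<Rightarrow> 'a \<Rightarrow> 'a" (infixr \<open>*\<^sub>C\<close> 75)
  assumes scaleR_scaleC: "r *\<^sub>R x = complex_of_real r *\<^sub>C x"

class complex_vector = scaleC + ab_group_add +
  assumes scaleC_add_right: "a *\<^sub>C (x + y) = a *\<^sub>C x + a *\<^sub>C y"
    and scaleC_add_left: "(a + b) *\<^sub>C x = a *\<^sub>C x + b *\<^sub>C x"
    and scaleC_scaleC: "a *\<^sub>C b *\<^sub>C x = (a * b) *\<^sub>C x"
    and scaleC_one: "1 *\<^sub>C x = x"

global_interpretation complex_vector: vector_space "scaleC :: complex \<Rightarrow> 'a \<Rightarrow> 'a::complex_vector"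
  by unfold_locales (simp_all add: scaleC_add_right scaleC_add_left scaleC_scaleC scaleC_one)

text \<open>
  No unit is assumed. Submultiplicativity of the norm is part of \<open>real_normed_algebra\<close>,
  completeness is part of \<open>banach\<close>.
\<close>

class cstar_algebra = complex_vector + real_normed_algebra + banach +
  fixes star :: "'a \<Rightarrow> 'a"
  assumes mult_scaleC_left: "a *\<^sub>C x * y = a *\<^sub>C (x * y)"
    and mult_scaleC_right: "x * a *\<^sub>C y = a *\<^sub>C (x * y)"
    and norm_scaleC: "norm (a *\<^sub>C x) = cmod a * norm x"
    and star_star: "star (star x) = x"
    and star_add: "star (x + y) = star x + star y"
    and star_scaleC: "star (a *\<^sub>C x) = cnj a *\<^sub>C star x"
    and star_mult: "star (x * y) = star y * star x"
    and cstar_identity: "norm (star x * x) = (norm x)\<^sup>2"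

definition cstar_subalgebra :: "'a::cstar_algebra set \<Rightarrow> bool" where
  "cstar_subalgebra B \<longleftrightarrow>
     complex_vector.subspace B \<and> (\<forall>x\<in>B. \<forall>y\<in>B. x * y \<in> B) \<and> (\<forall>x\<in>B. star x \<in> B) \<and> closed B"

definition finite_dimensional :: "'a::complex_vector set \<Rightarrow> bool" where
  "finite_dimensional S \<longleftrightarrow> (\<exists>T. finite T \<and> complex_vector.span T = S)"

definition AF_algebra :: "'a::cstar_algebra set \<Rightarrow> bool" where
  "AF_algebra A \<longleftrightarrow>
     (\<exists>V :: nat \<Rightarrow> 'a set. (\<forall>n. cstar_subalgebra (V n) \<and> finite_dimensional (V n)) \<and>
        incseq V \<and> closure (\<Union>n. V n) = A)"


section \<open>Ideals\<close>

definition two_sided_ideal :: "'a::cstar_algebra set \<Rightarrow> 'a set \<Rightarrow> bool" where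
  "two_sided_ideal R J \<longleftrightarrow>
     J \<subseteq> R \<and> complex_vector.subspace J \<and> (\<forall>a\<in>R. \<forall>x\<in>J. a * x \<in> J \<and> x * a \<in> J)"

definition closed_ideals :: "'a::cstar_algebra set \<Rightarrow> 'a set set" where
  "closed_ideals B = {J. two_sided_ideal B J \<and> closed J}"

definition alg_ideals_prod :: "(nat \<Rightarrow> 'a::cstar_algebra set) \<Rightarrow> 'a set set" where
  "alg_ideals_prod U =
     {J. two_sided_ideal (\<Union>n. U n) J \<and> (\<forall>n. J \<inter> U n \<in> closed_ideals (U n))}"


section \<open>Hilbert spaces and representations\<close>

text \<open>
  Hilbert spaces are given by explicit carriers, so that one can quantify over all of them
  inside a formula. The inner product is linear in the first argument.
\<close>

record 'h hspace =
  hcarrier :: "'h set"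
  hzero :: 'h (\<open>\<zero>\<index>\<close>)
  hadd :: "'h \<Rightarrow> 'h \<Rightarrow> 'h" (infixl \<open>\<oplus>\<index>\<close> 65)
  hscale :: "complex \<Rightarrow> 'h \<Rightarrow> 'h" (infixr \<open>\<odot>\<index>\<close> 75)
  hinner :: "'h \<Rightarrow> 'h \<Rightarrow> complex" (\<open>\<langle>_,/ _\<rangle>\<index>\<close>)

definition hnorm :: "'h hspace \<Rightarrow> 'h \<Rightarrow> real" where
  "hnorm H x = sqrt (Re (hinner H x x))"

definition hdist :: "'h hspace \<Rightarrow> 'h \<Rightarrow> 'h \<Rightarrow> real" where
  "hdist H x y = hnorm H (hadd H x (hscale H (-1) y))"

locale hilbert_space =
  fixes H :: "'h hspace" (structure)
  assumes zero_closed: "\<zero> \<in> hcarrier H"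
    and add_closed: "\<lbrakk>x \<in> hcarrier H; y \<in> hcarrier H\<rbrakk> \<Longrightarrow> x \<oplus> y \<in> hcarrier H"
    and scale_closed: "x \<in> hcarrier H \<Longrightarrow> c \<odot> x \<in> hcarrier H"
    and add_assoc: "\<lbrakk>x \<in> hcarrier H; y \<in> hcarrier H; z \<in> hcarrier H\<rbrakk> \<Longrightarrow> x \<oplus> y \<oplus> z = x \<oplus> (y \<oplus> z)"
    and add_commute: "\<lbrakk>x \<in> hcarrier H; y \<in> hcarrier H\<rbrakk> \<Longrightarrow> x \<oplus> y = y \<oplus> x"
    and add_zero: "x \<in> hcarrier H \<Longrightarrow> x \<oplus> \<zero> = x"
    and add_neg: "x \<in> hcarrier H \<Longrightarrow> x \<oplus> (-1) \<odot> x = \<zero>"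
    and scale_add_right: "\<lbrakk>x \<in> hcarrier H; y \<in> hcarrier H\<rbrakk> \<Longrightarrow> c \<odot> (x \<oplus> y) = c \<odot> x \<oplus> c \<odot> y"
    and scale_add_left: "x \<in> hcarrier H \<Longrightarrow> (c + d) \<odot> x = c \<odot> x \<oplus> d \<odot> x"
    and scale_scale: "x \<in> hcarrier H \<Longrightarrow> c \<odot> d \<odot> x = (c * d) \<odot> x"
    and scale_one: "x \<in> hcarrier H \<Longrightarrow> 1 \<odot> x = x"
    and inner_add_left:
      "\<lbrakk>x \<in> hcarrier H; y \<in> hcarrier H; z \<in> hcarrier H\<rbrakk> \<Longrightarrow> \<langle>x \<oplus> y, z\<rangle> = \<langle>x, z\<rangle> + \<langle>y, z\<rangle>"
    and inner_scale_left: "\<lbrakk>x \<in> hcarrier H; y \<in> hcarrier H\<rbrakk> \<Longrightarrow> \<langle>c \<odot> x, y\<rangle> = c * \<langle>x, y\<rangle>"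
    and inner_commute: "\<lbrakk>x \<in> hcarrier H; y \<in> hcarrier H\<rbrakk> \<Longrightarrow> \<langle>y, x\<rangle> = cnj \<langle>x, y\<rangle>"
    and inner_nonneg: "x \<in> hcarrier H \<Longrightarrow> 0 \<le> Re \<langle>x, x\<rangle>"
    and inner_definite: "\<lbrakk>x \<in> hcarrier H; \<langle>x, x\<rangle> = 0\<rbrakk> \<Longrightarrow> x = \<zero>"
    and complete:
      "\<lbrakk>\<And>n. X n \<in> hcarrier H;
        \<And>e. 0 < e \<Longrightarrow> \<exists>N. \<forall>m\<ge>N. \<forall>n\<ge>N. hdist H (X m) (X n) < e\<rbrakk>
       \<Longrightarrow> \<exists>l\<in>hcarrier H. (\<lambda>n. hdist H (X n) l) \<longlonglongrightarrow> 0"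

definition closed_hsubspace :: "'h hspace \<Rightarrow> 'h set \<Rightarrow> bool" where
  "closed_hsubspace H M \<longleftrightarrow>
     M \<subseteq> hcarrier H \<and> hzero H \<in> M \<and> (\<forall>x\<in>M. \<forall>y\<in>M. hadd H x y \<in> M) \<and>
     (\<forall>c. \<forall>x\<in>M. hscale H c x \<in> M) \<and>
     (\<forall>X l. (\<forall>n. X n \<in> M) \<and> l \<in> hcarrier H \<and> (\<lambda>n. hdist H (X n) l) \<longlonglongrightarrow> 0 \<longrightarrow> l \<in> M)"

definition bounded_operator :: "'h hspace \<Rightarrow> ('h \<Rightarrow> 'h) \<Rightarrow> bool" where
  "bounded_operator H T \<longleftrightarrow>
     (\<forall>x\<in>hcarrier H. T x \<in> hcarrier H) \<and>
     (\<forall>x\<in>hcarrier H. \<forall>y\<in>hcarrier H. T (hadd H x y) = hadd H (T x) (T y)) \<and>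
     (\<forall>c. \<forall>x\<in>hcarrier H. T (hscale H c x) = hscale H c (T x)) \<and>
     (\<exists>K. \<forall>x\<in>hcarrier H. hnorm H (T x) \<le> K * hnorm H x)"

locale star_representation = hilbert_space H
  for B :: "'a::cstar_algebra set" and H :: "'h hspace" (structure) and \<pi> :: "'a \<Rightarrow> 'h \<Rightarrow> 'h" +
  assumes rep_bounded: "a \<in> B \<Longrightarrow> bounded_operator H (\<pi> a)"
    and rep_add: "\<lbrakk>a \<in> B; b \<in> B; x \<in> hcarrier H\<rbrakk> \<Longrightarrow> \<pi> (a + b) x = \<pi> a x \<oplus> \<pi> b x"
    and rep_scale: "\<lbrakk>a \<in> B; x \<in> hcarrier H\<rbrakk> \<Longrightarrow> \<pi> (c *\<^sub>C a) x = c \<odot> \<pi> a x"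
    and rep_mult: "\<lbrakk>a \<in> B; b \<in> B; x \<in> hcarrier H\<rbrakk> \<Longrightarrow> \<pi> (a * b) x = \<pi> a (\<pi> b x)"
    and rep_star:
      "\<lbrakk>a \<in> B; x \<in> hcarrier H; y \<in> hcarrier H\<rbrakk> \<Longrightarrow> \<langle>\<pi> a x, y\<rangle> = \<langle>x, \<pi> (star a) y\<rangle>"

definition rep_kernel :: "'a set \<Rightarrow> 'h hspace \<Rightarrow> ('a \<Rightarrow> 'h \<Rightarrow> 'h) \<Rightarrow> 'a set" where
  "rep_kernel B H \<pi> = {a\<in>B. \<forall>x\<in>hcarrier H. \<pi> a x = hzero H}"

locale irreducible_representation = star_representation B H \<pi>
  for B :: "'a::cstar_algebra set" and H :: "'h hspace" (structure) and \<pi> :: "'a \<Rightarrow> 'h \<Rightarrow> 'h" +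
  assumes nonzero: "\<exists>a\<in>B. \<exists>x\<in>hcarrier H. \<pi> a x \<noteq> \<zero>"
    and irreducible:
      "\<lbrakk>closed_hsubspace H M; \<And>a x. \<lbrakk>a \<in> B; x \<in> M\<rbrakk> \<Longrightarrow> \<pi> a x \<in> M\<rbrakk>
       \<Longrightarrow> M = {\<zero>} \<or> M = hcarrier H"

text \<open>
  A formula cannot quantify over types, so the vectors of the representation spaces are taken
  from the fixed type \<open>'a \<Rightarrow> complex\<close>. This is no restriction: if \<open>x \<noteq> 0\<close> is a vector of
  an irreducible representation \<open>\<pi>\<close>, then sending \<open>y\<close> to the function mapping \<open>b\<close> to
  \<open>\<langle>y, \<pi> b x\<rangle>\<close> embeds the representation space into that type. The lemma
  \<open>rep_kernel_primitive\<close> below makes this precise.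
\<close>

definition primitive_ideals :: "'a::cstar_algebra set \<Rightarrow> 'a set set" where
  "primitive_ideals B =
     {rep_kernel B H \<pi> | (H :: ('a \<Rightarrow> complex) hspace) \<pi>. irreducible_representation B H \<pi>}"

lemma (in hilbert_space) inner_zero_limit:
  assumes z: "z \<in> hcarrier H" and l: "l \<in> hcarrier H"
    and X: "\<And>n. X n \<in> hcarrier H" "\<And>n. \<langle>X n, z\<rangle> = 0"
    and lim: "(\<lambda>n. hdist H (X n) l) \<longlonglongrightarrow> 0"
  shows "\<langle>l, z\<rangle> = 0"
proof (rule ccontr)
  define w where "w = \<langle>l, z\<rangle>"
  define r where "r = Re \<langle>z, z\<rangle>"
  define t where "t = 1 / (r + 1)"
  assume "\<langle>l, z\<rangle> \<noteq> 0"
  then have w: "(cmod w)\<^sup>2 > 0" by (simp add: w_def)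
  have r: "r \<ge> 0" using inner_nonneg z by (simp add: r_def)
  have zz: "\<langle>z, z\<rangle> = complex_of_real r"
    using inner_commute[OF z z] by (simp add: r_def complex_eq_iff)
  define s where "s = complex_of_real t * w"
  have key: "0 \<le> (hdist H (X n) l)\<^sup>2 - 2 * t * (cmod w)\<^sup>2 + t\<^sup>2 * (cmod w)\<^sup>2 * r" for n
  proof -
    define d where "d = X n \<oplus> (-1) \<odot> l"
    have d: "d \<in> hcarrier H" using X l add_closed scale_closed by (simp add: d_def)
    have sz: "s \<odot> z \<in> hcarrier H" using z scale_closed by simp
    have dz: "\<langle>d, z\<rangle> = - w"
      using X l z scale_closed by (simp add: d_def w_def inner_add_left inner_scale_left)
    have zd: "\<langle>z, d\<rangle> = - cnj w" using inner_commute[OF d z] dz by simp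
    have 1: "\<langle>d \<oplus> s \<odot> z, y\<rangle> = \<langle>d, y\<rangle> + s * \<langle>z, y\<rangle>" if "y \<in> hcarrier H" for y
      using that d sz z by (simp add: inner_add_left inner_scale_left)
    have ds: "d \<oplus> s \<odot> z \<in> hcarrier H" using d sz add_closed by simp
    have "\<langle>d \<oplus> s \<odot> z, d \<oplus> s \<odot> z\<rangle> = cnj (\<langle>d, d\<rangle> + s * \<langle>z, d\<rangle>) + s * cnj (\<langle>d, z\<rangle> + s * \<langle>z, z\<rangle>)"
      using 1[OF ds] inner_commute[OF ds d] inner_commute[OF ds z] 1[OF d] 1[OF z] by simp
    then have "Re \<langle>d \<oplus> s \<odot> z, d \<oplus> s \<odot> z\<rangle> =
        Re (cnj (\<langle>d, d\<rangle> + s * \<langle>z, d\<rangle>) + s * cnj (\<langle>d, z\<rangle> + s * \<langle>z, z\<rangle>))"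
      by (rule arg_cong)
    also have "\<dots> = Re \<langle>d, d\<rangle> - 2 * t * (cmod w)\<^sup>2 + t\<^sup>2 * (cmod w)\<^sup>2 * r"
      unfolding dz zd zz s_def cmod_power2 by (simp add: power2_eq_square algebra_simps)
    finally have "Re \<langle>d \<oplus> s \<odot> z, d \<oplus> s \<odot> z\<rangle> =
        Re \<langle>d, d\<rangle> - 2 * t * (cmod w)\<^sup>2 + t\<^sup>2 * (cmod w)\<^sup>2 * r" .
    moreover have "Re \<langle>d, d\<rangle> = (hdist H (X n) l)\<^sup>2"
      using inner_nonneg[OF d] by (simp add: hdist_def hnorm_def d_def)
    ultimately show ?thesis using inner_nonneg[OF ds] by simp
  qed
  have "(\<lambda>n. (hdist H (X n) l)\<^sup>2 - 2 * t * (cmod w)\<^sup>2 + t\<^sup>2 * (cmod w)\<^sup>2 * r)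
          \<longlonglongrightarrow> 0\<^sup>2 - 2 * t * (cmod w)\<^sup>2 + t\<^sup>2 * (cmod w)\<^sup>2 * r"
    by (intro tendsto_intros lim)
  then have "0 \<le> 0\<^sup>2 - 2 * t * (cmod w)\<^sup>2 + t\<^sup>2 * (cmod w)\<^sup>2 * r"
    by (rule LIMSEQ_le_const) (use key in blast)
  then have "0 \<le> (cmod w)\<^sup>2 * (t * (t * r - 2))"
    by (simp add: power2_eq_square algebra_simps)
  moreover have "t > 0" "t * r < 2"
    using r by (auto simp: t_def field_simps)
  then have "t * (t * r - 2) < 0" by (simp add: mult_pos_neg)
  ultimately show False using mult_pos_neg[OF w] by (meson not_le)
qed

lemma (in hilbert_space) inner_add_right:
  "\<lbrakk>x \<in> hcarrier H; y \<in> hcarrier H; z \<in> hcarrier H\<rbrakk> \<Longrightarrow> \<langle>z, x \<oplus> y\<rangle> = \<langle>z, x\<rangle> + \<langle>z, y\<rangle>"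
  by (metis add_closed complex_cnj_add inner_add_left inner_commute)

lemma (in hilbert_space) scale_minus_cancel:
  assumes x: "x \<in> hcarrier H" and y: "y \<in> hcarrier H" and 0: "x \<oplus> (-1) \<odot> y = \<zero>"
  shows "x = y"
proof -
  have my: "(-1) \<odot> y \<in> hcarrier H" using y scale_closed by simp
  have "x = x \<oplus> ((-1) \<odot> y \<oplus> y)"
    using x y my add_zero add_neg add_commute by metis
  also have "\<dots> = \<zero> \<oplus> y" using add_assoc[OF x my y] 0 by simp
  also have "\<dots> = y" using add_commute[OF zero_closed y] add_zero[OF y] by simp
  finally show ?thesis .
qed

lemma (in hilbert_space) inner_zero_left [simp]: "y \<in> hcarrier H \<Longrightarrow> \<langle>\<zero>, y\<rangle> = 0"
  using inner_scale_left[of y y "-1"] inner_add_left[of y "(-1) \<odot> y" y] add_neg[of y] scale_closed[of y "-1"]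
  by simp

lemma (in hilbert_space) closed_hsubspace_orthogonal:
  assumes "S \<subseteq> hcarrier H"
  shows "closed_hsubspace H {y\<in>hcarrier H. \<forall>z\<in>S. \<langle>y, z\<rangle> = 0}"
  unfolding closed_hsubspace_def
proof (intro conjI allI impI)
  fix X l
  assume "(\<forall>n. X n \<in> {y\<in>hcarrier H. \<forall>z\<in>S. \<langle>y, z\<rangle> = 0}) \<and> l \<in> hcarrier H \<and>
    (\<lambda>n. hdist H (X n) l) \<longlonglongrightarrow> 0"
  then show "l \<in> {y\<in>hcarrier H. \<forall>z\<in>S. \<langle>y, z\<rangle> = 0}"
    using inner_zero_limit[of _ l X] assms by blast
qed (use assms in \<open>auto simp: zero_closed add_closed scale_closed inner_add_left inner_scale_left
      subset_iff\<close>)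

text \<open>\<open>y\<close> is determined by the function \<open>b \<mapsto> \<langle>y, \<pi> b x\<rangle>\<close>.\<close>

lemma (in irreducible_representation) coefficients_inj:
  assumes B: "cstar_subalgebra B"
  shows "\<exists>f :: 'h \<Rightarrow> 'a \<Rightarrow> complex. inj_on f (hcarrier H)"
proof -
  have rc: "\<pi> a x \<in> hcarrier H" if "a \<in> B" "x \<in> hcarrier H" for a x
    using rep_bounded[OF that(1)] that(2) by (simp add: bounded_operator_def)
  have st: "star a \<in> B" "b \<in> B \<Longrightarrow> a * b \<in> B" if "a \<in> B" for a b
    using B that by (auto simp: cstar_subalgebra_def)
  obtain a x where ax: "a \<in> B" "x \<in> hcarrier H" "\<pi> a x \<noteq> \<zero>"
    using nonzero by blast
  define S where "S = (\<lambda>b. \<pi> b x) ` B"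
  define M where "M = {y\<in>hcarrier H. \<forall>z\<in>S. \<langle>y, z\<rangle> = 0}"
  have S: "S \<subseteq> hcarrier H" using rc ax(2) by (auto simp: S_def)
  have inv: "\<pi> c y \<in> M" if c: "c \<in> B" and y: "y \<in> M" for c y
  proof -
    have yc: "y \<in> hcarrier H" and y0: "\<And>b. b \<in> B \<Longrightarrow> \<langle>y, \<pi> b x\<rangle> = 0"
      using y by (auto simp: M_def S_def)
    have "\<langle>\<pi> c y, \<pi> b x\<rangle> = 0" if b: "b \<in> B" for b
      using rep_star[OF c yc rc[OF b ax(2)]] rep_mult[OF st(1)[OF c] b ax(2)]
        y0[OF st(2)[OF st(1)[OF c] b]] by simp
    then show ?thesis using rc[OF c yc] by (auto simp: M_def S_def)
  qed
  have "closed_hsubspace H M"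
    unfolding M_def by (rule closed_hsubspace_orthogonal[OF S])
  then consider "M = {\<zero>}" | "M = hcarrier H" using irreducible inv by blast
  then have M0: "M = {\<zero>}"
  proof cases
    case 2
    have "\<pi> a x \<in> M" using 2 rc[OF ax(1,2)] by simp
    then have "\<langle>\<pi> a x, \<pi> a x\<rangle> = 0" using ax(1) by (auto simp: M_def S_def)
    then show ?thesis using inner_definite[OF rc[OF ax(1,2)]] ax(3) by simp
  qed
  define f where "f y b = (if b \<in> B then \<langle>y, \<pi> b x\<rangle> else 0)" for y b
  have "inj_on f (hcarrier H)"
  proof (rule inj_onI)
    fix y z assume y: "y \<in> hcarrier H" and z: "z \<in> hcarrier H" and eq: "f y = f z"
    have yz: "\<langle>y, \<pi> b x\<rangle> = \<langle>z, \<pi> b x\<rangle>" if "b \<in> B" for b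
      using fun_cong[OF eq, of b] that by (simp add: f_def)
    have mz: "(-1) \<odot> z \<in> hcarrier H" using z by (rule scale_closed)
    have "y \<oplus> (-1) \<odot> z \<in> M"
      using y z mz rc ax(2) yz
      by (auto simp: M_def S_def add_closed inner_add_left inner_scale_left)
    then show "y = z" using M0 scale_minus_cancel[OF y z] by simp
  qed
  then show ?thesis by blast
qed

definition transport_hspace :: "('h \<Rightarrow> 'k) \<Rightarrow> 'h hspace \<Rightarrow> 'k hspace" where
  "transport_hspace f H =
     (let g = inv_into (hcarrier H) f in
      \<lparr>hcarrier = f ` hcarrier H, hzero = f (hzero H),
       hadd = (\<lambda>x y. f (hadd H (g x) (g y))), hscale = (\<lambda>c x. f (hscale H c (g x))),
       hinner = (\<lambda>x y. hinner H (g x) (g y))\<rparr>)"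

lemma (in irreducible_representation) transport:
  fixes f :: "'h \<Rightarrow> 'k"
  assumes B: "cstar_subalgebra B" and f: "inj_on f (hcarrier H)"
  defines "\<rho> \<equiv> \<lambda>a x. f (\<pi> a (inv_into (hcarrier H) f x))"
  shows "irreducible_representation B (transport_hspace f H) \<rho>"
    and "rep_kernel B (transport_hspace f H) \<rho> = rep_kernel B H \<pi>"
proof -
  define g where "g = inv_into (hcarrier H) f"
  define K where "K = transport_hspace f H"
  have gf [simp]: "g (f x) = x" if "x \<in> hcarrier H" for x
    using f that by (simp add: g_def)
  have gc [simp]: "g y \<in> hcarrier H" if "y \<in> f ` hcarrier H" for y
    using that by (auto simp: g_def inv_into_into)
  have fg: "f (g y) = y" if "y \<in> f ` hcarrier H" for y
    using that by (simp add: g_def f_inv_into_f)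
  have K [simp]: "hcarrier K = f ` hcarrier H" "hzero K = f \<zero>"
    "hadd K = (\<lambda>x y. f (g x \<oplus> g y))" "hscale K = (\<lambda>c x. f (c \<odot> g x))"
    "hinner K = (\<lambda>x y. \<langle>g x, g y\<rangle>)"
    by (simp_all add: K_def transport_hspace_def g_def Let_def)
  have \<rho>: "\<rho> a x = f (\<pi> a (g x))" for a x by (simp add: \<rho>_def g_def)
  have rc [simp]: "\<pi> a x \<in> hcarrier H" if "a \<in> B" "x \<in> hcarrier H" for a x
    using rep_bounded[OF that(1)] that(2) by (simp add: bounded_operator_def)
  have [simp]: "star a \<in> B" if "a \<in> B" for a
    using B that by (simp add: cstar_subalgebra_def)
  note [simp] = zero_closed add_closed scale_closed
  have feq: "f x = f y \<longleftrightarrow> x = y" if "x \<in> hcarrier H" "y \<in> hcarrier H" for x y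
    using f that by (auto dest: inj_onD)
  have nK: "hnorm K x = hnorm H (g x)" for x by (simp add: hnorm_def)
  have dK: "hdist K x y = hdist H (g x) (g y)" if "x \<in> hcarrier K" "y \<in> hcarrier K" for x y
    using that by (simp add: hdist_def hnorm_def)
  have hs: "hilbert_space K"
  proof
    fix X :: "nat \<Rightarrow> 'k" assume X: "\<And>n. X n \<in> hcarrier K"
      and C: "\<And>e. 0 < e \<Longrightarrow> \<exists>N. \<forall>m\<ge>N. \<forall>n\<ge>N. hdist K (X m) (X n) < e"
    have "\<exists>l\<in>hcarrier H. (\<lambda>n. hdist H (g (X n)) l) \<longlonglongrightarrow> 0"
      by (rule complete) (use X C dK[OF X X] in auto)
    then obtain l where l: "l \<in> hcarrier H" "(\<lambda>n. hdist H (g (X n)) l) \<longlonglongrightarrow> 0" by blast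
    have "hdist K (X n) (f l) = hdist H (g (X n)) l" for n
      using dK[OF X, of "f l" n] l(1) by simp
    then show "\<exists>l\<in>hcarrier K. (\<lambda>n. hdist K (X n) l) \<longlonglongrightarrow> 0"
      using l by (intro bexI[of _ "f l"]) auto
  qed (auto simp: feq add_assoc add_zero add_neg scale_add_right scale_add_left
      scale_scale scale_one inner_add_left inner_scale_left inner_nonneg
      intro: add_commute inner_commute inner_definite)
  have sr: "star_representation B K \<rho>"
  proof (intro star_representation.intro star_representation_axioms.intro hs)
    fix a assume a: "a \<in> B"
    show "bounded_operator K (\<rho> a)"
      using rep_bounded[OF a] a by (auto simp: bounded_operator_def \<rho> nK)
  qed (auto simp: \<rho> rep_add rep_scale rep_mult rep_star)
  show "irreducible_representation B (transport_hspace f H) \<rho>"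
    unfolding K_def[symmetric]
  proof (intro irreducible_representation.intro irreducible_representation_axioms.intro sr)
    obtain a x where ax: "a \<in> B" "x \<in> hcarrier H" "\<pi> a x \<noteq> \<zero>"
      using nonzero by blast
    then show "\<exists>a\<in>B. \<exists>x\<in>hcarrier K. \<rho> a x \<noteq> hzero K"
      by (intro bexI[of _ a] bexI[of _ "f x"]) (auto simp: \<rho> feq)
  next
    fix M assume M: "closed_hsubspace K M"
      and inv: "\<And>a x. \<lbrakk>a \<in> B; x \<in> M\<rbrakk> \<Longrightarrow> \<rho> a x \<in> M"
    have Mc: "M \<subseteq> f ` hcarrier H" using M by (simp add: closed_hsubspace_def)
    have MM: "M = f ` (g ` M)"
      using Mc by (auto simp: image_image fg subset_iff intro!: rev_image_eqI)
    have fM: "x \<in> g ` M \<longleftrightarrow> x \<in> hcarrier H \<and> f x \<in> M" for x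
      using Mc fg by (auto intro!: rev_image_eqI)
    have "closed_hsubspace H (g ` M)"
      unfolding closed_hsubspace_def
    proof (intro conjI allI impI)
      show "g ` M \<subseteq> hcarrier H" using fM by blast
      have "hzero K \<in> M" using M unfolding closed_hsubspace_def by blast
      then show "\<zero> \<in> g ` M" by (simp add: fM)
      show "\<forall>x\<in>g ` M. \<forall>y\<in>g ` M. x \<oplus> y \<in> g ` M"
      proof (intro ballI)
        fix x y assume "x \<in> g ` M" "y \<in> g ` M"
        then have xy: "x \<in> hcarrier H" "y \<in> hcarrier H" "f x \<in> M" "f y \<in> M"
          using fM by auto
        then have "hadd K (f x) (f y) \<in> M" using M unfolding closed_hsubspace_def by blast
        then show "x \<oplus> y \<in> g ` M" using xy by (simp add: fM)
      qed
      show "\<forall>x\<in>g ` M. c \<odot> x \<in> g ` M" for c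
      proof (intro ballI)
        fix x assume "x \<in> g ` M"
        then have x: "x \<in> hcarrier H" "f x \<in> M" using fM by auto
        then have "hscale K c (f x) \<in> M" using M unfolding closed_hsubspace_def by blast
        then show "c \<odot> x \<in> g ` M" using x by (simp add: fM)
      qed
    next
      fix X l
      assume A: "(\<forall>n. X n \<in> g ` M) \<and> l \<in> hcarrier H \<and> (\<lambda>n. hdist H (X n) l) \<longlonglongrightarrow> 0"
      have "hdist K (f (X n)) (f l) = hdist H (X n) l" for n
        using A dK[of "f (X n)" "f l"] by (simp add: fM)
      then have "(\<forall>n. f (X n) \<in> M) \<and> f l \<in> hcarrier K \<and> (\<lambda>n. hdist K (f (X n)) (f l)) \<longlonglongrightarrow> 0"
        using A by (simp add: fM)
      moreover have "(\<forall>n. Y n \<in> M) \<and> y \<in> hcarrier K \<and> (\<lambda>n. hdist K (Y n) y) \<longlonglongrightarrow> 0 \<longrightarrow> y \<in> M" for Y y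
        using M[unfolded closed_hsubspace_def, THEN conjunct2, THEN conjunct2, THEN conjunct2,
            THEN conjunct2] by (elim allE)
      ultimately have "f l \<in> M" by (rule rev_mp)
      then show "l \<in> g ` M" using A by (simp add: fM)
    qed
    moreover have "\<pi> a x \<in> g ` M" if "a \<in> B" "x \<in> g ` M" for a x
      using inv[OF that(1), of "f x"] that by (simp add: fM \<rho>)
    ultimately have "g ` M = {\<zero>} \<or> g ` M = hcarrier H" using irreducible by blast
    then show "M = {hzero K} \<or> M = hcarrier K" using MM by auto
  qed
  show "rep_kernel B (transport_hspace f H) \<rho> = rep_kernel B H \<pi>"
    unfolding K_def[symmetric] by (auto simp: rep_kernel_def \<rho> feq)
qed

lemma rep_kernel_primitive:
  assumes "cstar_subalgebra B" and "irreducible_representation B H \<pi>"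
  shows "rep_kernel B H \<pi> \<in> primitive_ideals B"
proof -
  interpret irreducible_representation B H \<pi> by fact
  obtain f :: "'b \<Rightarrow> 'a \<Rightarrow> complex" where "inj_on f (hcarrier H)"
    using coefficients_inj[OF assms(1)] by blast
  from transport[OF assms(1) this] show ?thesis
    unfolding primitive_ideals_def by blast
qed

section \<open>Topologies\<close>

definition ideal_hull :: "'a::cstar_algebra set \<Rightarrow> 'a set \<Rightarrow> 'a set set" where
  "ideal_hull B I = {J \<in> primitive_ideals B. I \<subseteq> J}"

definition jacobson_topology :: "'a::cstar_algebra set \<Rightarrow> 'a set topology" where
  "jacobson_topology B =
     topology (\<lambda>S. S \<subseteq> primitive_ideals B \<and>
       (\<exists>I\<in>closed_ideals B. primitive_ideals B - S = ideal_hull B I))"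

text \<open>Sets that are compact in the sense of \<open>compactin\<close> need not be Hausdorff.\<close>

definition fell_basic :: "'x topology \<Rightarrow> 'x set \<Rightarrow> 'x set set \<Rightarrow> 'x set set" where
  "fell_basic X K F = {Y. closedin X Y \<and> Y \<inter> K = {} \<and> (\<forall>A\<in>F. Y \<inter> A \<noteq> {})}"

definition fell_topology :: "'x topology \<Rightarrow> 'x set topology" where
  "fell_topology X = topology_generated_by
     {fell_basic X K F | K F. compactin X K \<and> finite F \<and> (\<forall>A\<in>F. openin X A \<and> A \<noteq> {})}"

definition fell_ideal_topology :: "'a::cstar_algebra set \<Rightarrow> 'a set topology" where
  "fell_ideal_topology B =
     pullback_topology (closed_ideals B) (ideal_hull B) (fell_topology (jacobson_topology B))"

definition ideals_infty :: "(nat \<Rightarrow> 'a::cstar_algebra set) \<Rightarrow> (nat \<Rightarrow> 'a set) set" where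
  "ideals_infty U = {J. (\<forall>n. J n \<in> closed_ideals (U n)) \<and> (\<forall>n. J (Suc n) \<inter> U n = J n)}"

definition fell_infty_topology ::
    "(nat \<Rightarrow> 'a::cstar_algebra set) \<Rightarrow> (nat \<Rightarrow> 'a set) topology" where
  "fell_infty_topology U =
     subtopology (product_topology (\<lambda>n. fell_ideal_topology (U n)) UNIV) (ideals_infty U)"

definition ideal_trace :: "(nat \<Rightarrow> 'a set) \<Rightarrow> 'a set \<Rightarrow> nat \<Rightarrow> 'a set" where
  "ideal_trace U I = (\<lambda>n. I \<inter> U n)"

text \<open>The ambient algebra is the whole type, so its ideals are \<open>closed_ideals UNIV\<close>.\<close>

definition fell_trace_topology :: "(nat \<Rightarrow> 'a::cstar_algebra set) \<Rightarrow> 'a set topology" where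
  "fell_trace_topology U =
     pullback_topology (closed_ideals UNIV) (ideal_trace U) (fell_infty_topology U)"

end

theory Submission
  imports Defs
begin

text \<open>
  Both topologies are shown to be the coarsest topology for which the distance functions
  \<open>I \<mapsto> infdist x I\<close> are continuous, where \<open>x = y\<^sup>2\<close> with \<open>y\<close> self-adjoint; these distances are the
  norms of \<open>x\<close> in the quotients by \<open>I\<close>. For the Fell topology of a single algebra this is the content
  of \<open>continuous_map_infdist\<close> and \<open>continuous_map_into_fell_ideal\<close>. For the topology defined by the
  traces it follows from two facts. The distance of \<open>x \<in> U n\<close> to \<open>I\<close> equals its distance to the
  trace \<open>I \<inter> U n\<close> (\<open>infdist_trace\<close>; this is the statement that injective homomorphisms of C*-algebras
  are isometric), and the distance is a Lipschitz function of \<open>x\<close>, so that the elements of the dense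
  union of the \<open>U n\<close> suffice. The equality of distances also shows that a closed ideal is the closure
  of its trace on the union (\<open>closure_trace_union\<close>), and so the closure map hits every closed ideal.

  Two ingredients carry the link between the Fell topology and distances. One is a continuous
  functional calculus \<open>cfc\<close> for self-adjoint elements. It respects closed ideals: if \<open>x - x'\<close> lies in a
  closed ideal, then so does \<open>f(x) - f(x')\<close> (\<open>cfc_diff_mem_ideal\<close>). Hence, if the distance of \<open>x\<close> to
  \<open>I\<close> is less than \<open>r\<close>, then the element obtained from \<open>x\<close> by shrinking its spectrum by \<open>r\<close> lies in
  \<open>I\<close>. Conversely, if that element lies in \<open>I\<close>, then the distance is at most \<open>r\<close>. Conditions on
  distances thus become membership conditions, and quotient algebras are avoided. The calculus rests
  on the estimate of \<open>norm (p(a))\<close> by the supremum of a real polynomial \<open>p\<close> over \<open>[- norm a, norm a]\<close>.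
  It is proved without spectra: \<open>a\<close> is the real part of a unitary, which gives the estimate up to a
  factor linear in the degree, and the C*-identity applied to high powers of \<open>p(a)\<close> removes the factor.

  The other ingredient is that the distance of \<open>x = y\<^sup>2\<close> to a closed ideal \<open>I\<close> is attained at a
  primitive ideal containing \<open>I\<close> (\<open>exists_primitive_ideal_attaining_infdist\<close>). It yields that closed
  ideals are determined by their hulls (\<open>hull_subset_iff\<close>) and that the sets of primitive ideals at
  distance at least \<open>r > 0\<close> from \<open>x\<close> are compact (\<open>compactin_infdist_ge\<close>). To prove it, an extreme
  linear functional below the distance to \<open>I\<close> is found by Zorn's lemma among sublinear functionals
  (\<open>extreme_dominated_functional\<close>). In the unitization it can be chosen to be a state, and its GNS
  representation is irreducible because it is extreme (\<open>gns_irreducible\<close>).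
\<close>

section \<open>Elementary facts about C*-algebras\<close>

lemma star_scaleR: "star (r *\<^sub>R x) = r *\<^sub>R star (x::'a::cstar_algebra)"
  by (simp add: scaleR_scaleC star_scaleC)

lemma star_0 [simp]: "star (0::'a::cstar_algebra) = 0"
  using star_scaleR[of 0 "0::'a"] by simp

lemma star_minus: "star (- x) = - star (x::'a::cstar_algebra)"
  using star_scaleR[of "-1" x] by simp

lemma star_diff: "star (x - y) = star x - star (y::'a::cstar_algebra)"
  using star_add[of x "-y"] by (simp add: star_minus)

lemma star_1 [simp]: "star (1::'a::{cstar_algebra,real_normed_algebra_1}) = 1"
  by (metis mult.left_neutral mult.right_neutral star_mult star_star)

lemma scaleC_minus_left: "(- a) *\<^sub>C (x::'a::complex_vector) = - (a *\<^sub>C x)"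
  by (rule complex_vector.scale_minus_left)

lemma scaleC_minus_right: "a *\<^sub>C (- (x::'a::complex_vector)) = - (a *\<^sub>C x)"
  by (rule complex_vector.scale_minus_right)

lemma scaleC_diff_right: "a *\<^sub>C (x - (y::'a::complex_vector)) = a *\<^sub>C x - a *\<^sub>C y"
  by (rule complex_vector.scale_right_diff_distrib)

lemma norm_star [simp]: "norm (star x) = norm (x::'a::cstar_algebra)"
proof -
  have le: "norm y \<le> norm (star y)" for y :: 'a
  proof (cases "y = 0")
    case False
    have "norm y * norm y \<le> norm (star y) * norm y"
      using cstar_identity[of y] norm_mult_ineq[of "star y" y] by (simp add: power2_eq_square)
    then show ?thesis using False by simp
  qed simp
  show ?thesis using le[of x] le[of "star x"] by (simp add: star_star)
qed

lemma norm_power2_selfadjoint: "star x = x \<Longrightarrow> norm (x * x) = (norm (x::'a::cstar_algebra))\<^sup>2"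
  using cstar_identity[of x] by simp

lemma bounded_linear_star: "bounded_linear (star :: 'a \<Rightarrow> 'a::cstar_algebra)"
  by (rule bounded_linear_intro[where K=1]) (simp_all add: star_add star_scaleR)

lemmas tendsto_star = bounded_linear.tendsto[OF bounded_linear_star]

lemma norm_le_onorm_mult:
  fixes x :: "'a::cstar_algebra"
  shows "norm x \<le> onorm (\<lambda>b. x * b)"
proof (cases "x = 0")
  case False
  have "norm (x * star x) \<le> onorm (\<lambda>b. x * b) * norm (star x)"
    by (rule onorm[OF bounded_linear_mult_right])
  moreover have "norm (x * star x) = norm x * norm x"
    using cstar_identity[of "star x"] by (simp add: star_star power2_eq_square)
  ultimately show ?thesis using False by simp
qed (simp add: onorm_pos_le bounded_linear_mult_right)

section \<open>The unitization of a C*-algebra\<close>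

datatype 'a unitization = Unitize (base: 'a) (scal: complex)

instantiation unitization :: (cstar_algebra) ring_1
begin
definition "0 = Unitize 0 0"
definition "1 = Unitize 0 1"
definition "x + y = Unitize (base x + base y) (scal x + scal y)"
definition "- x = Unitize (- base x) (- scal x)"
definition "x - y = Unitize (base x - base y) (scal x - scal y)"
definition "x * y = Unitize (base x * base y + scal x *\<^sub>C base y + scal y *\<^sub>C base x) (scal x * scal y)"

lemma unitization_sel [simp]:
  "base 0 = 0" "scal 0 = 0" "base 1 = 0" "scal 1 = 1"
  "base (x + y) = base x + base y" "scal (x + y) = scal x + scal y"
  "base (- x) = - base x" "scal (- x) = - scal x"
  "base (x - y) = base x - base y" "scal (x - y) = scal x - scal y"
  "base (x * y) = base x * base y + scal x *\<^sub>C base y + scal y *\<^sub>C base x"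
  "scal (x * y) = scal x * scal y"
  by (simp_all add: zero_unitization_def one_unitization_def plus_unitization_def
      uminus_unitization_def minus_unitization_def times_unitization_def)

instance
proof
  fix x y z :: "'a unitization"
  show "x * y * z = x * (y * z)"
    by (rule unitization.expand) (simp add: algebra_simps mult_scaleC_left mult_scaleC_right
        scaleC_add_right scaleC_scaleC)
qed (auto intro!: unitization.expand
      simp: algebra_simps scaleC_add_left scaleC_add_right scaleC_one dest: arg_cong[of _ _ scal])
end

instantiation unitization :: (cstar_algebra) "{complex_vector, real_algebra_1}"
begin
definition "r *\<^sub>R x = Unitize (r *\<^sub>R base x) (r *\<^sub>R scal x)"
definition "c *\<^sub>C x = Unitize (c *\<^sub>C base x) (c * scal x)"

lemma unitization_scale_sel [simp]:
  "base (r *\<^sub>R x) = r *\<^sub>R base x" "scal (r *\<^sub>R x) = r *\<^sub>R scal x"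
  "base (c *\<^sub>C x) = c *\<^sub>C base x" "scal (c *\<^sub>C x) = c * scal x"
  by (simp_all add: scaleR_unitization_def scaleC_unitization_def)

instance
  by standard (auto intro!: unitization.expand simp: scaleR_scaleC[where 'a='a]
      scaleR_conv_of_real scaleC_add_right scaleC_add_left scaleC_scaleC scaleC_one
      mult_scaleC_left mult_scaleC_right algebra_simps)
end

text \<open>
  The operator norm of left multiplication is a C*-norm on the unitization only if the algebra has
  no unit. Taking the maximum with the modulus of the scalar part covers both cases.
\<close>

definition left_mult :: "'a::cstar_algebra unitization \<Rightarrow> 'a \<Rightarrow> 'a" where
  "left_mult x b = base x * b + scal x *\<^sub>C b"

lemma bounded_linear_left_mult: "bounded_linear (left_mult x)"
proof (rule bounded_linear_intro[where K="norm (base x) + cmod (scal x)"])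
  fix b
  show "norm (left_mult x b) \<le> norm b * (norm (base x) + cmod (scal x))"
    using norm_triangle_ineq[of "base x * b" "scal x *\<^sub>C b"] norm_mult_ineq[of "base x" b]
    by (simp add: left_mult_def norm_scaleC algebra_simps)
qed (simp_all add: left_mult_def scaleC_add_right algebra_simps scaleR_scaleC
      mult_scaleC_right scaleC_scaleC)

lemma left_mult_simps:
  "left_mult (x + y) = (\<lambda>b. left_mult x b + left_mult y b)"
  "left_mult (x * y) = left_mult x \<circ> left_mult y"
  "left_mult (r *\<^sub>R x) = (\<lambda>b. r *\<^sub>R left_mult x b)"
  by (auto simp: fun_eq_iff left_mult_def algebra_simps scaleC_add_left scaleC_add_right
      mult_scaleC_left mult_scaleC_right scaleC_scaleC scaleR_scaleC)

instantiation unitization :: (cstar_algebra) real_normed_algebra_1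
begin
definition "norm x = max (onorm (left_mult x)) (cmod (scal x))"
definition "dist x y = norm (x - (y::'a unitization))"
definition "sgn x = inverse (norm x) *\<^sub>R (x::'a unitization)"
definition "uniformity = (INF e\<in>{0 <..}. principal {(x, y). dist x (y::'a unitization) < e})"
definition "open U = (\<forall>x\<in>U. eventually (\<lambda>(x', y). x' = x \<longrightarrow> y \<in> U) (uniformity :: ('a unitization \<times> 'a unitization) filter))"

lemma norm_scal_le: "cmod (scal x) \<le> norm (x :: 'a unitization)"
  by (simp add: norm_unitization_def)

lemma norm_left_mult_le: "norm (left_mult x b) \<le> norm x * norm (b::'a)"
proof -
  have "norm (left_mult x b) \<le> onorm (left_mult x) * norm b"
    by (rule onorm[OF bounded_linear_left_mult])
  also have "\<dots> \<le> norm x * norm b"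
    by (intro mult_right_mono) (auto simp: norm_unitization_def)
  finally show ?thesis .
qed

lemma norm_Unitize_0 [simp]: "norm (Unitize a 0) = norm (a::'a)"
proof -
  have l: "left_mult (Unitize a 0) = (\<lambda>b. a * b)" by (simp add: fun_eq_iff left_mult_def)
  have "onorm (\<lambda>b. a * b) = norm a"
    by (intro antisym norm_le_onorm_mult onorm_bound norm_mult_ineq) simp
  then show ?thesis by (simp add: norm_unitization_def l)
qed

instance
proof
  fix x y :: "'a unitization" and r :: real
  show "norm (x + y) \<le> norm x + norm y"
    using onorm_triangle[OF bounded_linear_left_mult bounded_linear_left_mult, of x y]
      norm_triangle_ineq[of "scal x" "scal y"]
    by (auto simp: norm_unitization_def left_mult_simps)
  show "norm (r *\<^sub>R x) = \<bar>r\<bar> * norm x"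
    by (simp add: norm_unitization_def left_mult_simps onorm_scaleR[OF bounded_linear_left_mult]
        max_mult_distrib_left)
  show "norm (x * y) \<le> norm x * norm y"
  proof -
    have "onorm (left_mult (x * y)) \<le> onorm (left_mult x) * onorm (left_mult y)"
      by (simp add: left_mult_simps onorm_compose[OF bounded_linear_left_mult bounded_linear_left_mult])
    also have "\<dots> \<le> norm x * norm y"
      by (intro mult_mono onorm_pos_le[OF bounded_linear_left_mult]) (auto simp: norm_unitization_def le_max_iff_disj)
    finally have 1: "onorm (left_mult (x * y)) \<le> norm x * norm y" .
    have "cmod (scal (x * y)) \<le> norm x * norm y"
      using mult_mono[OF norm_scal_le[of x] norm_scal_le[of y]] by (simp add: norm_mult order_trans[OF norm_ge_zero norm_scal_le])
    with 1 show ?thesis by (simp add: norm_unitization_def[of "x * y"])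
  qed
  show "norm x = 0 \<longleftrightarrow> x = 0"
  proof
    assume 0: "norm x = 0"
    then have "scal x = 0" using norm_scal_le[of x] by simp
    then have "norm (base x) = 0" using 0 norm_Unitize_0[of "base x"] by (metis unitization.collapse)
    with \<open>scal x = 0\<close> show "x = 0" by (auto intro: unitization.expand)
  next
    assume "x = 0"
    then show "norm x = 0" using norm_Unitize_0[of 0] by (simp add: zero_unitization_def del: norm_Unitize_0)
  qed
  have "onorm (left_mult (1::'a unitization)) \<le> 1"
    by (rule onorm_bound) (simp_all add: left_mult_def scaleC_one)
  then show "norm (1::'a unitization) = 1" by (simp add: norm_unitization_def)
qed (simp_all add: dist_unitization_def sgn_unitization_def uniformity_unitization_def open_unitization_def)
end

lemma norm_base_le: "norm (base x) \<le> 2 * norm (x::'a::cstar_algebra unitization)"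
proof -
  have s: "cmod c \<le> norm (Unitize 0 c :: 'a unitization)" "norm (Unitize 0 c :: 'a unitization) \<le> cmod c" for c
  proof -
    have "norm (left_mult (Unitize 0 c :: 'a unitization) b) \<le> cmod c * norm b" for b
      by (simp add: left_mult_def norm_scaleC)
    then have "onorm (left_mult (Unitize 0 c :: 'a unitization)) \<le> cmod c"
      by (intro onorm_bound) auto
    then show "cmod c \<le> norm (Unitize 0 c :: 'a unitization)" "norm (Unitize 0 c :: 'a unitization) \<le> cmod c"
      by (simp_all add: norm_unitization_def)
  qed
  have "Unitize (base x) 0 = x - Unitize 0 (scal x)" by (rule unitization.expand) simp
  then have "norm (base x) = norm (x - Unitize 0 (scal x))" by (metis norm_Unitize_0)
  also have "\<dots> \<le> norm x + norm (Unitize 0 (scal x) :: 'a unitization)" by (rule norm_triangle_ineq4)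
  also have "\<dots> \<le> 2 * norm x" using s(2)[of "scal x"] norm_scal_le[of x] by linarith
  finally show ?thesis .
qed

lemma norm_Unitize_le: "norm (Unitize a c) \<le> norm (a::'a::cstar_algebra) + cmod c"
proof -
  have "norm (left_mult (Unitize a c) b) \<le> (norm a + cmod c) * norm b" for b
    using norm_triangle_ineq[of "a * b" "c *\<^sub>C b"] norm_mult_ineq[of a b]
    by (simp add: left_mult_def norm_scaleC algebra_simps)
  then have "onorm (left_mult (Unitize a c)) \<le> norm a + cmod c" by (intro onorm_bound) auto
  then show ?thesis by (simp add: norm_unitization_def)
qed

lemma bounded_linear_base: "bounded_linear (base :: 'a::cstar_algebra unitization \<Rightarrow> 'a)"
  by (rule bounded_linear_intro[where K=2]) (use norm_base_le in \<open>auto simp: mult.commute\<close>)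

lemma bounded_linear_scal: "bounded_linear (scal :: 'a::cstar_algebra unitization \<Rightarrow> complex)"
  by (rule bounded_linear_intro[where K=1]) (use norm_scal_le in auto)

instance unitization :: (cstar_algebra) banach
proof
  fix X :: "nat \<Rightarrow> 'a unitization" assume X: "Cauchy X"
  have "Cauchy (\<lambda>n. base (X n))" "Cauchy (\<lambda>n. scal (X n))"
    using bounded_linear.Cauchy[OF bounded_linear_base X] bounded_linear.Cauchy[OF bounded_linear_scal X] .
  then obtain a c where a: "(\<lambda>n. base (X n)) \<longlonglongrightarrow> a" and c: "(\<lambda>n. scal (X n)) \<longlonglongrightarrow> c"
    by (meson Cauchy_convergent convergent_def)
  have "(\<lambda>n. norm (base (X n) - a) + cmod (scal (X n) - c)) \<longlonglongrightarrow> 0 + 0"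
    using a c by (intro tendsto_add) (simp_all add: LIM_zero tendsto_norm_zero)
  then have lim: "(\<lambda>n. norm (base (X n) - a) + cmod (scal (X n) - c)) \<longlonglongrightarrow> 0" by simp
  have le: "norm (X n - Unitize a c) \<le> norm (base (X n) - a) + cmod (scal (X n) - c)" for n
    using norm_Unitize_le[of "base (X n) - a" "scal (X n) - c"] by (simp add: minus_unitization_def)
  have "(\<lambda>n. X n - Unitize a c) \<longlonglongrightarrow> 0"
    by (rule Lim_null_comparison[OF _ lim]) (simp add: le)
  then show "convergent X" unfolding convergent_def by (blast intro: LIM_zero_cancel)
qed

instantiation unitization :: (cstar_algebra) cstar_algebra
begin
definition "star x = Unitize (star (base x)) (cnj (scal x))"

lemma unitization_star_sel [simp]: "base (star x) = star (base x)" "scal (star x) = cnj (scal x)"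
  by (simp_all add: star_unitization_def)

instance
proof
  fix a :: complex and x y :: "'a unitization"
  show "a *\<^sub>C x * y = a *\<^sub>C (x * y)" "x * a *\<^sub>C y = a *\<^sub>C (x * y)"
    by (auto intro!: unitization.expand simp: mult_scaleC_left mult_scaleC_right
        scaleC_add_right scaleC_scaleC mult.commute)
  show "star (star x) = x" "star (x + y) = star x + star y" "star (a *\<^sub>C x) = cnj a *\<^sub>C star x"
    by (auto intro!: unitization.expand simp: star_star star_add star_scaleC)
  show sm: "star (x * y) = star y * star x" for x y :: "'a unitization"
    by (auto intro!: unitization.expand simp: star_mult star_add star_scaleC algebra_simps)
  have "norm (a *\<^sub>C x) \<le> cmod a * norm x" for a and x :: "'a unitization"
  proof -
    have "norm (left_mult (a *\<^sub>C x) b) = cmod a * norm (left_mult x b)" for b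
      by (simp add: left_mult_def norm_scaleC[symmetric] mult_scaleC_left scaleC_add_right scaleC_scaleC)
    then have "onorm (left_mult (a *\<^sub>C x)) \<le> cmod a * norm x"
      by (intro onorm_bound) (auto simp: mult.assoc intro!: mult_left_mono norm_left_mult_le)
    then show ?thesis
      using mult_left_mono[OF norm_scal_le[of x], of "cmod a"]
      by (simp add: norm_unitization_def[of "a *\<^sub>C x"] norm_mult)
  qed note le = this
  show "norm (a *\<^sub>C x) = cmod a * norm x"
  proof (cases "a = 0")
    case False
    have "norm x \<le> cmod (1 / a) * norm (a *\<^sub>C x)"
      using le[of "1 / a" "a *\<^sub>C x"] False by (simp add: scaleC_scaleC scaleC_one)
    then have "cmod a * norm x \<le> norm (a *\<^sub>C x)" using False by (simp add: norm_divide field_simps)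
    with le[of a x] show ?thesis by simp
  qed (use le[of 0 x] in simp)
  \<comment> \<open>For every \<open>b\<close> in the algebra, \<open>norm (x b)\<^sup>2\<close> is the norm of \<open>b\<^sup>* (x\<^sup>* x b)\<close>.\<close>
  have key: "(norm x)\<^sup>2 \<le> norm (star x * x)" for x :: "'a unitization"
  proof -
    have "norm (left_mult x b) \<le> sqrt (norm (star x * x)) * norm b" for b
    proof (rule power2_le_imp_le)
      have "(norm (left_mult x b))\<^sup>2 = norm (star (left_mult x b) * left_mult x b)"
        by (simp add: cstar_identity)
      also have "star (left_mult x b) * left_mult x b = star b * left_mult (star x * x) b"
        by (simp add: left_mult_def star_add star_mult star_scaleC algebra_simps scaleC_add_left
            mult_scaleC_left mult_scaleC_right scaleC_add_right scaleC_scaleC)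
      also have "norm \<dots> \<le> norm b * (norm (star x * x) * norm b)"
        using norm_mult_ineq[of "star b" "left_mult (star x * x) b"]
          mult_left_mono[OF norm_left_mult_le[of "star x * x" b], of "norm b"] by simp
      finally show "(norm (left_mult x b))\<^sup>2 \<le> (sqrt (norm (star x * x)) * norm b)\<^sup>2"
        by (simp add: power_mult_distrib power2_eq_square algebra_simps)
    qed simp
    then have 1: "onorm (left_mult x) \<le> sqrt (norm (star x * x))" by (intro onorm_bound) auto
    have "(cmod (scal x))\<^sup>2 \<le> norm (star x * x)"
      using norm_scal_le[of "star x * x"] by (simp add: norm_mult power2_eq_square)
    then have "cmod (scal x) \<le> sqrt (norm (star x * x))" by (rule real_le_rsqrt)
    with 1 have "norm x \<le> sqrt (norm (star x * x))" by (simp add: norm_unitization_def[of x])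
    then have "(norm x)\<^sup>2 \<le> (sqrt (norm (star x * x)))\<^sup>2" by (rule power_mono) simp
    then show ?thesis by simp
  qed
  have le: "norm x \<le> norm (star x)" for x :: "'a unitization"
  proof (cases "x = 0")
    case False
    have "norm x * norm x \<le> norm (star x) * norm x"
      using key[of x] norm_mult_ineq[of "star x" x] by (simp add: power2_eq_square)
    then show ?thesis using False by simp
  qed simp
  have ss: "star (star x) = x"
    by (auto intro!: unitization.expand simp: star_star)
  have "norm (star x) = norm x" using le[of x] le[of "star x"] ss by simp
  then show "norm (star x * x) = (norm x)\<^sup>2"
    using key[of x] norm_mult_ineq[of "star x" x] by (simp add: power2_eq_square)
qed
end

section \<open>Polynomials of a self-adjoint element\<close>

lemma selfadjoint_power:
  "star (a::'a::{cstar_algebra,real_normed_algebra_1}) = a \<Longrightarrow> star (a ^ n) = a ^ n"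
  by (induction n) (simp_all add: star_mult power_commutes)

lemma abs_gbinomial_half_le: "\<bar>(1/2::real) gchoose n\<bar> \<le> 1"
proof (induction n)
  case (Suc n)
  have "((1/2::real) gchoose Suc n) = ((1/2) gchoose n) * ((1/2 - real n) / (real n + 1))"
    using gbinomial_mult_1[of "1/2::real" n] by (simp add: field_simps)
  moreover have "\<bar>(1/2 - real n) / (real n + 1)\<bar> \<le> 1" by (simp add: abs_le_iff field_simps)
  ultimately show ?case using Suc mult_mono[OF Suc, of "\<bar>(1/2 - real n) / (real n + 1)\<bar>" 1]
    by (simp add: abs_mult)
qed simp

text \<open>The binomial series for the square root of \<open>1 - t\<close> at \<open>t = a\<^sup>2\<close>; its square is computed by
  Vandermonde's identity.\<close>

lemma exists_sqrt_one_minus_square: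
  fixes a :: "'a::{cstar_algebra,real_normed_algebra_1}"
  assumes sa: "star a = a" and a: "norm a < 1"
  obtains s where "star s = s" "a * s = s * a" "s * s = 1 - a * a"
proof -
  define c where "c n = (-1) ^ n * ((1/2::real) gchoose n)" for n
  define t where "t n = c n *\<^sub>R (a * a) ^ n" for n
  have aa: "norm (a * a) < 1"
    using norm_mult_ineq[of a a] mult_strict_mono[OF a a] by simp
  have "norm (t n) \<le> norm (a * a) ^ n" for n
    using mult_mono[OF abs_gbinomial_half_le[of n] norm_power_ineq[of "a * a" n]]
    by (simp add: t_def c_def abs_mult)
  then have sn: "summable (\<lambda>n. norm (t n))"
    by (intro summable_comparison_test[OF _ summable_geometric[of "norm (a * a)"]]) (auto simp: aa)
  then have st: "summable t" by (rule summable_norm_cancel)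
  define s where "s = suminf t"
  have "star (t n) = t n" for n
    using selfadjoint_power[of "a * a" n] sa by (simp add: t_def star_scaleR star_mult)
  then have 1: "star s = s"
    using bounded_linear.suminf[OF bounded_linear_star st] by (simp add: s_def)
  have "a * t n = t n * a" for n
    by (simp add: t_def power_commuting_commutes mult.assoc)
  then have 2: "a * s = s * a"
    using st by (simp add: s_def suminf_mult[symmetric] suminf_mult2)
  have cc: "(\<Sum>i\<le>k. c i * c (k - i)) = (-1) ^ k * (1 gchoose k)" for k
  proof -
    have "c i * c (k - i) = (-1) ^ k * (((1/2::real) gchoose i) * ((1/2) gchoose (k - i)))" if "i \<le> k" for i
    proof -
      have "(-1) ^ i * (-1) ^ (k - i) = (-1::real) ^ k" using that by (simp flip: power_add)
      then show ?thesis by (simp add: c_def mult.assoc mult.left_commute)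
    qed
    then have "(\<Sum>i\<le>k. c i * c (k - i)) = (-1) ^ k * (\<Sum>i\<le>k. ((1/2::real) gchoose i) * ((1/2) gchoose (k - i)))"
      by (simp add: sum_distrib_left)
    then show ?thesis using gbinomial_Vandermonde[of "1/2::real" "1/2" k] by (simp add: atLeast0AtMost)
  qed
  have tt: "(\<Sum>i\<le>k. t i * t (k - i)) = ((-1) ^ k * (1 gchoose k)) *\<^sub>R (a * a) ^ k" for k
  proof -
    have "t i * t (k - i) = (c i * c (k - i)) *\<^sub>R (a * a) ^ k" if "i \<le> k" for i
      using that by (simp add: t_def flip: power_add)
    then show ?thesis by (simp add: cc[symmetric] scaleR_sum_left)
  qed
  have z: "(1::real) gchoose k = 0" if "k \<notin> {0,1}" for k
  proof -
    have "1 choose k = 0" by (rule binomial_eq_0) (use that in auto)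
    then show ?thesis by (metis binomial_gbinomial of_nat_0 of_nat_1)
  qed
  have "(\<lambda>k. \<Sum>i\<le>k. t i * t (k - i)) sums (\<Sum>k\<in>{0,1}. \<Sum>i\<le>k. t i * t (k - i))"
    by (rule sums_finite) (auto simp: tt z)
  moreover have "(\<lambda>k. \<Sum>i\<le>k. t i * t (k - i)) sums (s * s)"
    using Cauchy_product_sums[OF sn sn] by (simp add: s_def)
  ultimately have "s * s = (\<Sum>k\<in>{0,1}. \<Sum>i\<le>k. t i * t (k - i))" using sums_unique2 by blast
  also have "\<dots> = 1 - a * a" by (simp add: tt)
  finally show ?thesis using 1 2 that by blast
qed

definition poly_eval :: "'a::real_algebra_1 \<Rightarrow> real poly \<Rightarrow> 'a" where
  "poly_eval x p = (\<Sum>i\<le>degree p. coeff p i *\<^sub>R x ^ i)"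

lemma poly_eval_altdef: "degree p \<le> n \<Longrightarrow> poly_eval x p = (\<Sum>i\<le>n. coeff p i *\<^sub>R x ^ i)"
  unfolding poly_eval_def by (intro sum.mono_neutral_left) (auto simp: coeff_eq_0)

lemma poly_eval_0 [simp]: "poly_eval x 0 = 0"
  by (simp add: poly_eval_def)

lemma poly_eval_pCons [simp]: "poly_eval x (pCons c p) = c *\<^sub>R 1 + x * poly_eval x p"
proof -
  have "poly_eval x (pCons c p) = (\<Sum>i\<le>Suc (degree p). coeff (pCons c p) i *\<^sub>R x ^ i)"
    by (rule poly_eval_altdef) (rule degree_pCons_le)
  then show ?thesis
    by (simp only: sum.atMost_Suc_shift) (simp add: poly_eval_def sum_distrib_left)
qed

lemma poly_eval_add: "poly_eval x (p + q) = poly_eval x p + poly_eval x q"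
proof -
  have "degree (p + q) \<le> max (degree p) (degree q)" by (rule degree_add_le_max)
  then show ?thesis
    by (simp add: poly_eval_altdef[of _ "max (degree p) (degree q)"] scaleR_add_left sum.distrib)
qed

lemma poly_eval_smult: "poly_eval x (smult c p) = c *\<^sub>R poly_eval x p"
  by (induction p) (simp_all add: scaleR_add_right)

lemma poly_eval_minus: "poly_eval x (- p) = - poly_eval x p"
  using poly_eval_smult[of x "-1" p] by simp

lemma poly_eval_diff: "poly_eval x (p - q) = poly_eval x p - poly_eval x q"
  using poly_eval_add[of x p "- q"] by (simp add: poly_eval_minus)

lemma poly_eval_mult: "poly_eval x (p * q) = poly_eval x p * poly_eval x q"
  by (induction p) (simp_all add: poly_eval_add poly_eval_smult algebra_simps)

lemma poly_eval_power: "poly_eval x (p ^ n) = poly_eval x p ^ n"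
  by (induction n) (simp_all add: poly_eval_mult one_pCons)

lemma poly_eval_selfadjoint:
  "star x = x \<Longrightarrow> star (poly_eval x p) = poly_eval (x::'a::{cstar_algebra,real_normed_algebra_1}) p"
proof -
  assume "star x = x"
  then show ?thesis
    unfolding poly_eval_def
    by (simp add: linear_sum[OF bounded_linear.linear[OF bounded_linear_star]] star_scaleR selfadjoint_power)
qed

lemma poly_eval_pcompose: "poly_eval x (pcompose p q) = poly_eval (poly_eval x q) p"
  by (induction p) (simp_all add: pcompose_pCons poly_eval_add poly_eval_mult)

text \<open>A polynomial of degree below \<open>N\<close> is recovered from its values at the \<open>N\<close>-th roots of unity
  by the discrete Fourier transform.\<close>

lemma coeff_le_on_circle:
  fixes G :: "complex poly"
  assumes M: "\<And>z. cmod z = 1 \<Longrightarrow> cmod (poly G z) \<le> M"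
  shows "cmod (coeff G k) \<le> M"
proof (cases "k \<le> degree G")
  case False
  have "0 \<le> M" by (rule order_trans[OF norm_ge_zero M[of 1]]) simp
  with False show ?thesis by (simp add: coeff_eq_0)
next
  case k: True
  define N where "N = Suc (degree G)"
  define w where "w i = cis (2 * pi * (real i - real k) / real N)" for i
  define z where "z j = cis (2 * pi * real j / real N)" for j
  have N: "N > 0" by (simp add: N_def)
  have ws: "(\<Sum>j<N. w i ^ j) = (if i = k then of_nat N else 0)" if i: "i \<le> degree G" for i
  proof (cases "i = k")
    case False
    have "w i \<noteq> 1"
    proof
      assume "w i = 1"
      then have "cos (2 * pi * (real i - real k) / real N) = 1" by (simp add: w_def complex_eq_iff)
      then obtain n :: int where n: "2 * pi * (real i - real k) / real N = real_of_int n * 2 * pi"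
        using cos_one_2pi_int by blast
      then have "2 * pi * ((real i - real k) / real N) = 2 * pi * real_of_int n"
        by (simp add: algebra_simps)
      then have "(real i - real k) / real N = real_of_int n"
        by (simp only: mult_cancel_left) simp
      then have "real_of_int (int i - int k) = real_of_int (n * int N)"
        using N by (simp add: field_simps)
      then have n: "int i - int k = n * int N" by (simp only: of_int_eq_iff)
      have "\<bar>int i - int k\<bar> < int N" using i k by (simp add: N_def)
      then have "\<bar>n\<bar> * int N < 1 * int N" using n N by (simp add: abs_mult)
      then have "n = 0" using N by (simp add: mult_less_cancel_right)
      then show False using n False by simp
    qed
    moreover have "w i ^ N = 1"
    proof -
      have e: "real N * (2 * pi * (real i - real k) / real N) = 2 * pi * of_int (int i - int k)"
        using N by simp
      have "w i ^ N = cis (real N * (2 * pi * (real i - real k) / real N))"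
        by (simp only: w_def Complex.DeMoivre)
      then show ?thesis unfolding e by (simp add: cis_multiple_2pi)
    qed
    ultimately show ?thesis using False by (simp add: geometric_sum)
  qed (simp add: w_def)
  have "(\<Sum>j<N. poly G (z j) * cis (- (2 * pi * real j * real k / real N)))
      = (\<Sum>j<N. \<Sum>i\<le>degree G. coeff G i * w i ^ j)"
  proof (intro sum.cong refl)
    fix j
    have "z j ^ i * cis (- (2 * pi * real j * real k / real N)) = w i ^ j" for i
    proof -
      have "z j ^ i * cis (- (2 * pi * real j * real k / real N)) =
        cis (real i * (2 * pi * real j / real N) - 2 * pi * real j * real k / real N)"
        by (simp add: z_def Complex.DeMoivre cis_mult)
      also have "real i * (2 * pi * real j / real N) - 2 * pi * real j * real k / real N =
        real j * (2 * pi * (real i - real k) / real N)" using N by (simp add: field_simps)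
      finally show ?thesis by (simp add: w_def Complex.DeMoivre)
    qed
    then show "poly G (z j) * cis (- (2 * pi * real j * real k / real N)) = (\<Sum>i\<le>degree G. coeff G i * w i ^ j)"
      by (simp add: poly_altdef sum_distrib_right mult.assoc)
  qed
  also have "\<dots> = (\<Sum>i\<le>degree G. coeff G i * (\<Sum>j<N. w i ^ j))"
    by (subst sum.swap) (simp add: sum_distrib_left)
  also have "\<dots> = (\<Sum>i\<le>degree G. if i = k then coeff G k * of_nat N else 0)"
    by (intro sum.cong) (auto simp: ws)
  also have "\<dots> = coeff G k * of_nat N" using k by simp
  finally have "cmod (coeff G k * of_nat N) \<le> (\<Sum>j<N. cmod (poly G (z j) * cis (- (2 * pi * real j * real k / real N))))"
    by (metis norm_sum)
  also have "\<dots> \<le> (\<Sum>j<N. M)"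
    by (intro sum_mono) (auto simp: norm_mult z_def intro!: M)
  finally show ?thesis using N by (simp add: norm_mult mult.commute)
qed

definition cpoly_eval :: "'a::{cstar_algebra,real_normed_algebra_1} \<Rightarrow> complex poly \<Rightarrow> 'a" where
  "cpoly_eval u G = (\<Sum>i\<le>degree G. coeff G i *\<^sub>C u ^ i)"

lemma cpoly_eval_altdef: "degree p \<le> n \<Longrightarrow> cpoly_eval x p = (\<Sum>i\<le>n. coeff p i *\<^sub>C x ^ i)"
  unfolding cpoly_eval_def by (intro sum.mono_neutral_left) (auto simp: coeff_eq_0)

lemma cpoly_eval_pCons: "cpoly_eval x (pCons c p) = c *\<^sub>C 1 + x * cpoly_eval x p"
proof -
  have "cpoly_eval x (pCons c p) = (\<Sum>i\<le>Suc (degree p). coeff (pCons c p) i *\<^sub>C x ^ i)"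
    by (rule cpoly_eval_altdef) (rule degree_pCons_le)
  then show ?thesis
    by (simp only: sum.atMost_Suc_shift) (simp add: cpoly_eval_def sum_distrib_left mult_scaleC_right)
qed

lemma cpoly_eval_add: "cpoly_eval x (p + q) = cpoly_eval x p + cpoly_eval x q"
proof -
  have "degree (p + q) \<le> max (degree p) (degree q)" by (rule degree_add_le_max)
  then show ?thesis
    by (simp add: cpoly_eval_altdef[of _ "max (degree p) (degree q)"] scaleC_add_left sum.distrib)
qed

lemma cpoly_eval_smult: "cpoly_eval x (smult c p) = c *\<^sub>C cpoly_eval x p"
proof -
  have "cpoly_eval x (smult c p) = (\<Sum>i\<le>degree p. coeff (smult c p) i *\<^sub>C x ^ i)"
    by (rule cpoly_eval_altdef) (rule degree_smult_le)
  then show ?thesis by (simp add: cpoly_eval_def complex_vector.scale_sum_right scaleC_scaleC)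
qed

lemma cpoly_eval_monom: "cpoly_eval x (monom c n) = c *\<^sub>C x ^ n"
  by (induction n) (simp_all add: monom_0 monom_Suc cpoly_eval_pCons mult_scaleC_right cpoly_eval_def[of x 0])

text \<open>Substituting \<open>t = (z + 1/z)/2\<close> into \<open>p(t)\<close> gives a Laurent polynomial, which multiplication by
  \<open>z ^ d\<close> turns into a polynomial \<open>G\<close>. On the unit circle \<open>t\<close> is the real part of \<open>z\<close>, so that bounds
  for \<open>p\<close> on \<open>[-1, 1]\<close> become bounds for \<open>G\<close> on the circle.\<close>

lemma joukowsky_polynomial:
  fixes u v :: "'a::{cstar_algebra,real_normed_algebra_1}"
  assumes uv: "u * v = 1" and a: "2 *\<^sub>R a = u + v" and d: "degree p \<le> d"
  shows "\<exists>G. degree G \<le> 2 * d \<and> u ^ d * poly_eval a p = cpoly_eval u G \<and>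
    (\<forall>z. cmod z = 1 \<longrightarrow> poly G z = z ^ d * complex_of_real (poly p (Re z)))"
  using d
proof (induction d arbitrary: p)
  case 0
  then obtain c where p: "p = [:c:]" by (metis degree_eq_zeroE le_zero_eq)
  show ?case
    by (rule exI[of _ "[:complex_of_real c:]"])
      (simp add: p cpoly_eval_pCons scaleR_scaleC[where 'a='a] cpoly_eval_def[of u 0])
next
  case (Suc d)
  obtain c q where p: "p = pCons c q" by (cases p)
  have "degree q \<le> d" using Suc.prems by (cases "q = 0") (auto simp: p)
  then obtain G where G: "degree G \<le> 2 * d" "u ^ d * poly_eval a q = cpoly_eval u G"
    "\<And>z. cmod z = 1 \<Longrightarrow> poly G z = z ^ d * complex_of_real (poly q (Re z))"
    using Suc.IH by blast
  define H where "H = monom (complex_of_real c) (Suc d) + smult (1/2) (pCons 0 (pCons 0 G) + G)"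
  have "degree (pCons 0 (pCons 0 G) + G) \<le> 2 * Suc d"
    using G(1) degree_pCons_le[of 0 G] degree_pCons_le[of 0 "pCons 0 G"]
    by (intro degree_add_le) auto
  then have 1: "degree H \<le> 2 * Suc d"
    unfolding H_def
    by (intro degree_add_le[OF _ order_trans[OF degree_smult_le]] order_trans[OF degree_monom_le]) auto
  have ua: "u ^ Suc d * a = (1/2) *\<^sub>R (u * u + 1) * u ^ d"
  proof -
    have "2 *\<^sub>R (u ^ Suc d * a) = u ^ Suc d * (u + v)" using a by (metis mult_scaleR_right)
    also have "\<dots> = u ^ Suc d * u + u ^ d * (u * v)"
      by (simp add: distrib_left power_Suc2 mult.assoc del: power_Suc)
    also have "\<dots> = (u * u + 1) * u ^ d"
      by (simp add: uv distrib_right power_commutes mult.assoc)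
    finally have "(1/2) *\<^sub>R 2 *\<^sub>R (u ^ Suc d * a) = (1/2) *\<^sub>R ((u * u + 1) * u ^ d)" by simp
    then show ?thesis by simp
  qed
  have "u ^ Suc d * poly_eval a p = c *\<^sub>R u ^ Suc d + (1/2) *\<^sub>R (u * u + 1) * (u ^ d * poly_eval a q)"
    unfolding p poly_eval_pCons distrib_left mult.assoc[symmetric] ua[symmetric] by simp
  also have "\<dots> = cpoly_eval u H"
    by (simp add: G(2) H_def cpoly_eval_add cpoly_eval_monom cpoly_eval_smult cpoly_eval_pCons scaleR_scaleC[where 'a='a]
        distrib_right mult.assoc mult_scaleC_left scaleC_add_right)
  finally have 2: "u ^ Suc d * poly_eval a p = cpoly_eval u H" .
  have 3: "poly H z = z ^ Suc d * complex_of_real (poly p (Re z))" if z: "cmod z = 1" for z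
  proof -
    have zz: "z * z + 1 = 2 * z * complex_of_real (Re z)"
    proof -
      have "z * cnj z = 1" using complex_norm_square[of z] z by simp
      then have "z * z + 1 = z * (z + cnj z)" by (simp add: algebra_simps)
      then show ?thesis by (simp add: complex_add_cnj)
    qed
    have "poly H z = of_real c * z ^ Suc d + (1/2) * ((z * z + 1) * poly G z)"
      by (simp add: H_def poly_monom algebra_simps)
    also have "\<dots> = z ^ Suc d * complex_of_real (poly p (Re z))"
      unfolding zz G(3)[OF z] by (simp add: p algebra_simps)
    finally show ?thesis .
  qed
  show ?case using 1 2 3 by blast
qed

text \<open>
  Here \<open>a\<close> is the real part of the unitary \<open>u = a + \<i> s\<close> with \<open>s\<^sup>2 = 1 - a\<^sup>2\<close>, and the powers of \<open>u\<close>
  have norm one. The bound with the factor \<open>2 d + 1\<close> is crude, but its growth in \<open>d\<close> is only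
  polynomial. Applied to the powers \<open>p ^ (2 ^ m)\<close> it therefore gives the sharp bound below, because
  the C*-identity makes the norm of a self-adjoint element compatible with squaring.
\<close>

lemma norm_poly_eval_le_degree:
  fixes a :: "'a::{cstar_algebra,real_normed_algebra_1}"
  assumes sa: "star a = a" and a: "norm a < 1" and d: "degree p \<le> d"
    and M: "\<And>t. \<bar>t\<bar> \<le> 1 \<Longrightarrow> \<bar>poly p t\<bar> \<le> M"
  shows "norm (poly_eval a p) \<le> (2 * real d + 1) * M"
proof -
  obtain s where s: "star s = s" "a * s = s * a" "s * s = 1 - a * a"
    using exists_sqrt_one_minus_square[OF sa a] .
  define u v where "u = a + \<i> *\<^sub>C s" and "v = a - \<i> *\<^sub>C s"
  have uv: "u * v = 1" "v * u = 1"
    by (simp_all add: u_def v_def algebra_simps mult_scaleC_left mult_scaleC_right s scaleC_scaleC scaleC_minus_left scaleC_one)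
  have su: "star u = v" by (simp add: u_def v_def star_add star_scaleC sa s scaleC_minus_left)
  have a2: "2 *\<^sub>R a = u + v" by (simp add: u_def v_def scaleR_2)
  have "norm (star u * u) = 1" by (simp add: su uv)
  then have nu: "norm u = 1" using power2_eq_1_iff[of "norm u"] norm_ge_zero[of u] by (simp add: cstar_identity)
  have nv: "norm v = 1" using nu norm_star[of u] su by simp
  obtain G where G: "degree G \<le> 2 * d" "u ^ d * poly_eval a p = cpoly_eval u G"
    "\<And>z. cmod z = 1 \<Longrightarrow> poly G z = z ^ d * complex_of_real (poly p (Re z))"
    using joukowsky_polynomial[OF uv(1) a2 d] by blast
  have "cmod (poly G z) \<le> M" if "cmod z = 1" for z
    using M[of "Re z"] abs_Re_le_cmod[of z] that by (simp add: G(3) norm_mult norm_power)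
  then have c: "cmod (coeff G k) \<le> M" for k by (rule coeff_le_on_circle)
  have npow: "norm (w ^ n) \<le> 1" if "norm w = 1" for w :: 'a and n
    using norm_power_ineq[of w n] that by simp
  have "norm (cpoly_eval u G) \<le> (\<Sum>i\<le>2 * d. norm (coeff G i *\<^sub>C u ^ i))"
    unfolding cpoly_eval_altdef[OF G(1)] by (rule norm_sum)
  also have "\<dots> \<le> (\<Sum>i\<le>2 * d. M)"
  proof (rule sum_mono)
    fix i
    show "norm (coeff G i *\<^sub>C u ^ i) \<le> M"
      using mult_mono[OF c[of i] npow[OF nu, of i] order_trans[OF norm_ge_zero c[of i]] norm_ge_zero]
      by (simp add: norm_scaleC)
  qed
  also have "\<dots> = (2 * real d + 1) * M" by (simp add: algebra_simps)
  finally have le: "norm (u ^ d * poly_eval a p) \<le> (2 * real d + 1) * M" by (simp add: G(2))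
  have "v ^ d * u ^ d = 1" for d
  proof (induction d)
    case (Suc d)
    have "v ^ Suc d * u ^ Suc d = v ^ d * (v * u) * u ^ d"
      unfolding power_Suc2[of v] power_Suc[of u] by (simp only: mult.assoc)
    then show ?case using Suc by (simp add: uv(2))
  qed simp
  then have "poly_eval a p = v ^ d * (u ^ d * poly_eval a p)" by (simp add: mult.assoc[symmetric])
  then have "norm (poly_eval a p) \<le> norm (v ^ d) * norm (u ^ d * poly_eval a p)" by (metis norm_mult_ineq)
  also have "\<dots> \<le> 1 * norm (u ^ d * poly_eval a p)" by (intro mult_right_mono npow nv) simp
  finally show ?thesis using le by simp
qed

lemma norm_selfadjoint_power2:
  fixes x :: "'a::{cstar_algebra,real_normed_algebra_1}"
  assumes "star x = x" shows "norm (x ^ (2 ^ m)) = norm x ^ (2 ^ m)"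
proof (induction m)
  case (Suc m)
  have "x ^ (2 ^ Suc m) = x ^ (2 ^ m) * x ^ (2 ^ m)" by (simp add: mult_2 power_add)
  then show ?case
    using norm_power2_selfadjoint[OF selfadjoint_power[OF assms], of "2 ^ m"] Suc
    by (simp add: power_mult[symmetric] mult.commute)
qed simp

lemma norm_poly_eval_le_unit:
  fixes a :: "'a::{cstar_algebra,real_normed_algebra_1}"
  assumes sa: "star a = a" and a: "norm a < 1"
    and M: "\<And>t. \<bar>t\<bar> \<le> 1 \<Longrightarrow> \<bar>poly p t\<bar> \<le> M"
  shows "norm (poly_eval a p) \<le> M"
proof (rule field_le_epsilon)
  fix e :: real assume e: "0 < e"
  have M0: "0 \<le> M" using M[of 0] by simp
  define x where "x = norm (poly_eval a p)"
  define d where "d = real (degree p)"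
  have bound: "x ^ (2 ^ m) \<le> (2 * d * 2 ^ m + 1) * M ^ (2 ^ m)" for m
  proof -
    have "x ^ (2 ^ m) = norm (poly_eval a (p ^ (2 ^ m)))"
      by (simp add: x_def poly_eval_power norm_selfadjoint_power2[OF poly_eval_selfadjoint[OF sa]])
    also have "\<dots> \<le> (2 * real (degree p * 2 ^ m) + 1) * M ^ (2 ^ m)"
      by (rule norm_poly_eval_le_degree[OF sa a degree_power_le])
        (auto simp: poly_power power_abs intro!: power_mono M)
    finally show ?thesis by (simp add: d_def mult.assoc)
  qed
  show "x \<le> M + e"
  proof (rule ccontr)
    assume "\<not> x \<le> M + e"
    then have x: "M < x" "0 < x" using e M0 by auto
    define r where "r = M / x"
    have r: "0 \<le> r" "r < 1" using x M0 by (auto simp: r_def)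
    have "(\<lambda>n. (2 * d) * (of_nat n * r ^ n) + r ^ n) \<longlonglongrightarrow> (2 * d) * 0 + 0"
      using r by (intro tendsto_intros powser_times_n_limit_0 LIMSEQ_realpow_zero) auto
    then have "\<forall>\<^sub>F n in sequentially. (2 * d) * (of_nat n * r ^ n) + r ^ n < 1"
      by (intro order_tendstoD) auto
    then obtain n0 where n0: "\<And>n. n \<ge> n0 \<Longrightarrow> (2 * d) * (of_nat n * r ^ n) + r ^ n < 1"
      by (auto simp: eventually_sequentially)
    have "(2 * d) * (real (2 ^ n0) * r ^ (2 ^ n0)) + r ^ (2 ^ n0) < 1"
      by (rule n0) (simp add: less_imp_le less_exp)
    then have "((2 * d) * (2 ^ n0 * r ^ (2 ^ n0)) + r ^ (2 ^ n0)) * x ^ (2 ^ n0) < 1 * x ^ (2 ^ n0)"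
      using x by (intro mult_strict_right_mono) auto
    moreover have "r ^ (2 ^ n0) * x ^ (2 ^ n0) = M ^ (2 ^ n0)"
      using x by (simp add: r_def power_mult_distrib[symmetric])
    ultimately have "(2 * d * 2 ^ n0 + 1) * M ^ (2 ^ n0) < x ^ (2 ^ n0)"
      by (simp add: distrib_right mult.assoc)
    with bound[of n0] show False by simp
  qed
qed

lemma norm_poly_eval_le:
  fixes a :: "'a::{cstar_algebra,real_normed_algebra_1}"
  assumes sa: "star a = a" and a: "norm a < R"
    and M: "\<And>t. \<bar>t\<bar> \<le> R \<Longrightarrow> \<bar>poly p t\<bar> \<le> M"
  shows "norm (poly_eval a p) \<le> M"
proof -
  have R: "R > 0" using a norm_ge_zero[of a] by linarith
  define b where "b = (1 / R) *\<^sub>R a"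
  have "poly_eval a p = poly_eval (poly_eval b [:0, R:]) p" using R by (simp add: b_def)
  also have "\<dots> = poly_eval b (pcompose p [:0, R:])" by (simp add: poly_eval_pcompose)
  also have "norm \<dots> \<le> M"
  proof (rule norm_poly_eval_le_unit)
    show "star b = b" by (simp add: b_def star_scaleR sa)
    show "norm b < 1" using a R by (simp add: b_def)
    show "\<bar>poly (pcompose p [:0, R:]) t\<bar> \<le> M" if "\<bar>t\<bar> \<le> 1" for t
      using M[of "t * R"] R that by (simp add: poly_pcompose abs_mult mult_left_le_one_le)
  qed
  finally show ?thesis .
qed

section \<open>Continuous functions of a self-adjoint element\<close>

lemma polynomial_uniform_approximation:
  fixes f :: "real \<Rightarrow> real"
  assumes f: "continuous_on UNIV f" and R: "0 \<le> R"
  shows "\<exists>P. uniform_limit {-R..R} (\<lambda>n. poly (P n)) f sequentially \<and> (\<forall>n. poly (P n) 0 = f 0)"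
proof -
  have "\<exists>p. poly p 0 = f 0 \<and> (\<forall>t\<in>{-R..R}. \<bar>poly p t - f t\<bar> < e)" if "e > 0" for e
  proof -
    have e2: "0 < e / 2" using that by simp
    obtain g where g: "real_polynomial_function g" "\<And>t. t \<in> {-R..R} \<Longrightarrow> \<bar>f t - g t\<bar> < e / 2"
      by (rule Stone_Weierstrass_real_polynomial_function[of "{-R..R}" f "e / 2"])
        (use e2 in \<open>blast intro: continuous_on_subset[OF f] compact_Icc\<close>)+
    obtain a n where a: "g = (\<lambda>x. \<Sum>i\<le>n. a i * x ^ i)"
      using g(1) by (auto simp: real_polynomial_function_iff_sum)
    define q where "q = (\<Sum>i\<le>n. monom (a i) i)"
    have q: "poly q t = g t" for t by (simp add: q_def a poly_sum poly_monom)
    define p where "p = q + [:f 0 - poly q 0:]"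
    have "\<bar>poly p t - f t\<bar> < e" if "t \<in> {-R..R}" for t
    proof -
      have "\<bar>f t - g t\<bar> < e / 2" "\<bar>f 0 - g 0\<bar> < e / 2" using g(2)[OF that] g(2)[of 0] R by auto
      then show ?thesis by (simp add: p_def q) argo
    qed
    moreover have "poly p 0 = f 0" by (simp add: p_def)
    ultimately show ?thesis by blast
  qed
  then have "\<forall>n. \<exists>p. poly p 0 = f 0 \<and> (\<forall>t\<in>{-R..R}. \<bar>poly p t - f t\<bar> < inverse (real (Suc n)))"
    by simp
  then obtain P where P: "\<And>n. poly (P n) 0 = f 0"
    "\<And>n t. t \<in> {-R..R} \<Longrightarrow> \<bar>poly (P n) t - f t\<bar> < inverse (real (Suc n))"
    by metis
  have "uniform_limit {-R..R} (\<lambda>n. poly (P n)) f sequentially"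
  proof (rule uniform_limitI)
    fix e :: real assume "0 < e"
    then obtain N where N: "inverse (real (Suc N)) < e" using reals_Archimedean by blast
    have "\<bar>poly (P n) t - f t\<bar> < e" if "n \<ge> N" "t \<in> {-R..R}" for n t
    proof -
      have "inverse (real (Suc n)) \<le> inverse (real (Suc N))"
        using that(1) by (intro le_imp_inverse_le) auto
      then show ?thesis using P(2)[OF that(2), of n] N by linarith
    qed
    then show "\<forall>\<^sub>F n in sequentially. \<forall>x\<in>{-R..R}. dist (poly (P n) x) (f x) < e"
      unfolding eventually_sequentially dist_real_def by blast
  qed
  then show ?thesis using P(1) by blast
qed

text \<open>By the norm estimate for polynomials, the limit exists for all continuous \<open>f\<close>, and it depends
  neither on the approximating polynomials nor on the interval.\<close>

definition cfc :: "'a::{cstar_algebra,real_normed_algebra_1} \<Rightarrow> (real \<Rightarrow> real) \<Rightarrow> 'a" where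
  "cfc x f = (THE y. \<forall>P R. norm x < R \<and> uniform_limit {-R..R} (\<lambda>n. poly (P n)) f sequentially
     \<longrightarrow> (\<lambda>n. poly_eval x (P n)) \<longlonglongrightarrow> y)"

lemma norm_poly_eval_diff_le:
  fixes x :: "'a::{cstar_algebra,real_normed_algebra_1}"
  assumes "star x = x" "norm x < R" "\<And>t. \<bar>t\<bar> \<le> R \<Longrightarrow> \<bar>poly p t - poly q t\<bar> \<le> e"
  shows "norm (poly_eval x p - poly_eval x q) \<le> e"
  using norm_poly_eval_le[of x R "p - q" e] assms by (simp add: poly_eval_diff)

lemma cfc_limit:
  fixes x :: "'a::{cstar_algebra,real_normed_algebra_1}"
  assumes x: "star x = x" and f: "continuous_on UNIV f"
    and "norm x < R" "uniform_limit {-R..R} (\<lambda>n. poly (P n)) f sequentially"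
  shows "(\<lambda>n. poly_eval x (P n)) \<longlonglongrightarrow> cfc x f"
proof -
  have close: "\<exists>N. \<forall>m\<ge>N. \<forall>n\<ge>N. norm (poly_eval x (P m) - poly_eval x (Q n)) < e"
    if prem: "e > 0" "norm x < R" "uniform_limit {-R..R} (\<lambda>n. poly (P n)) f sequentially"
      "norm x < S" "uniform_limit {-S..S} (\<lambda>n. poly (Q n)) f sequentially" for e P Q R S
  proof -
    obtain N where N: "\<And>n t. n \<ge> N \<Longrightarrow> t \<in> {-R..R} \<Longrightarrow> \<bar>poly (P n) t - f t\<bar> < e / 3"
      using uniform_limitD[OF prem(3), of "e / 3"] prem(1)
      unfolding eventually_sequentially dist_real_def by (metis half_gt_zero zero_less_divide_iff zero_less_numeral)
    obtain M where M: "\<And>n t. n \<ge> M \<Longrightarrow> t \<in> {-S..S} \<Longrightarrow> \<bar>poly (Q n) t - f t\<bar> < e / 3"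
      using uniform_limitD[OF prem(5), of "e / 3"] prem(1)
      unfolding eventually_sequentially dist_real_def by (metis half_gt_zero zero_less_divide_iff zero_less_numeral)
    have "norm (poly_eval x (P m) - poly_eval x (Q n)) \<le> 2 * e / 3" if "m \<ge> max M N" "n \<ge> max M N" for m n
    proof (rule norm_poly_eval_diff_le[OF x, of "min R S"])
      fix t assume t: "\<bar>t\<bar> \<le> min R S"
      show "\<bar>poly (P m) t - poly (Q n) t\<bar> \<le> 2 * e / 3"
      proof -
        have "\<bar>poly (P m) t - f t\<bar> < e / 3" "\<bar>poly (Q n) t - f t\<bar> < e / 3"
          using N[of m t] M[of n t] \<open>m \<ge> _\<close> \<open>n \<ge> _\<close> t by (auto simp: abs_le_iff)
        then show ?thesis by argo
      qed
    qed (use \<open>norm x < R\<close> \<open>norm x < S\<close> in auto)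
    then have "\<forall>m\<ge>max M N. \<forall>n\<ge>max M N. norm (poly_eval x (P m) - poly_eval x (Q n)) < e"
      using \<open>e > 0\<close> by fastforce
    then show ?thesis by blast
  qed
  have "Cauchy (\<lambda>n. poly_eval x (P n))"
    unfolding Cauchy_def dist_norm using close[OF _ assms(3,4) assms(3,4)] by blast
  then obtain y where y: "(\<lambda>n. poly_eval x (P n)) \<longlonglongrightarrow> y"
    by (meson Cauchy_convergent convergent_def)
  have lim: "(\<lambda>n. poly_eval x (Q n)) \<longlonglongrightarrow> y"
    if Q: "norm x < S" "uniform_limit {-S..S} (\<lambda>n. poly (Q n)) f sequentially" for Q S
  proof -
    have "(\<lambda>n. poly_eval x (P n) - poly_eval x (Q n)) \<longlonglongrightarrow> 0"
      unfolding LIMSEQ_iff using close[OF _ assms(3,4) Q] by (metis diff_zero)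
    from tendsto_diff[OF y this] show ?thesis by simp
  qed
  have "cfc x f = y"
    unfolding cfc_def
  proof (rule the_equality)
    show "\<forall>P R. norm x < R \<and> uniform_limit {-R..R} (\<lambda>n. poly (P n)) f sequentially
      \<longrightarrow> (\<lambda>n. poly_eval x (P n)) \<longlonglongrightarrow> y" using lim by blast
    show "z = y" if "\<forall>P R. norm x < R \<and> uniform_limit {-R..R} (\<lambda>n. poly (P n)) f sequentially
      \<longrightarrow> (\<lambda>n. poly_eval x (P n)) \<longlonglongrightarrow> z" for z
      using that[rule_format, OF conjI[OF assms(3,4)]] y by (rule LIMSEQ_unique)
  qed
  then show ?thesis using y by simp
qed

lemma cfc_polynomial_limit:
  fixes x :: "'a::{cstar_algebra,real_normed_algebra_1}"
  assumes f: "continuous_on UNIV f" and R: "norm x < R"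
  obtains P where "uniform_limit {-R..R} (\<lambda>n. poly (P n)) f sequentially"
    "\<And>n. poly (P n) 0 = f 0"
    "\<And>y::'a. star y = y \<Longrightarrow> norm y < R \<Longrightarrow> (\<lambda>n. poly_eval y (P n)) \<longlonglongrightarrow> cfc y f"
proof -
  have "0 \<le> R" using R norm_ge_zero[of x] by linarith
  then obtain P where P: "uniform_limit {-R..R} (\<lambda>n. poly (P n)) f sequentially" "\<And>n. poly (P n) 0 = f 0"
    using polynomial_uniform_approximation[OF f] by blast
  show thesis using that[OF P cfc_limit[OF _ f _ P(1)]] by blast
qed

lemma cfc_poly: "star x = x \<Longrightarrow> cfc x (poly p) = poly_eval x p"
proof -
  assume x: "star x = x"
  have "continuous_on UNIV (poly p)" by (simp add: continuous_on_poly)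
  then have "(\<lambda>n. poly_eval x p) \<longlonglongrightarrow> cfc x (poly p)"
    by (rule cfc_limit[OF x, of _ "norm x + 1"]) (simp_all add: uniform_limit_const)
  then show "cfc x (poly p) = poly_eval x p" by (simp add: LIMSEQ_const_iff)
qed

lemma cfc_id: "star x = x \<Longrightarrow> cfc x (\<lambda>t. t) = x"
proof -
  assume x: "star x = x"
  have "(\<lambda>t::real. t) = poly [:0, 1:]" by (simp add: fun_eq_iff)
  then show ?thesis using cfc_poly[OF x, of "[:0, 1:]"] by simp
qed

lemma cfc_const: "star x = x \<Longrightarrow> cfc x (\<lambda>t. c) = c *\<^sub>R 1"
proof -
  assume x: "star x = x"
  have "(\<lambda>t::real. c) = poly [:c:]" by (simp add: fun_eq_iff)
  then show ?thesis using cfc_poly[OF x, of "[:c:]"] by simp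
qed

lemma cfc_selfadjoint:
  fixes x :: "'a::{cstar_algebra,real_normed_algebra_1}"
  assumes x: "star x = x" and f: "continuous_on UNIV f"
  shows "star (cfc x f) = cfc x f"
proof -
  obtain P where P: "(\<lambda>n. poly_eval x (P n)) \<longlonglongrightarrow> cfc x f"
    by (rule cfc_polynomial_limit[OF f less_add_one[of "norm x"]]) (use x less_add_one[of "norm x"] in blast)
  from tendsto_star[OF P] have "(\<lambda>n. poly_eval x (P n)) \<longlonglongrightarrow> star (cfc x f)"
    by (simp add: poly_eval_selfadjoint x)
  with P show ?thesis using LIMSEQ_unique by blast
qed

lemma poly_fun_simps:
  "poly (p + q) = (\<lambda>t. poly p t + poly q t)" "poly (p * q) = (\<lambda>t. poly p t * poly q t)"
  by (simp_all add: fun_eq_iff)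

lemma cfc_add:
  fixes x :: "'a::{cstar_algebra,real_normed_algebra_1}"
  assumes x: "star x = x" and f: "continuous_on UNIV f" and g: "continuous_on UNIV g"
  shows "cfc x (\<lambda>t. f t + g t) = cfc x f + cfc x g"
proof -
  define R where "R = norm x + 1"
  have R: "norm x < R" by (simp add: R_def)
  obtain P where P: "uniform_limit {-R..R} (\<lambda>n. poly (P n)) f sequentially"
    "(\<lambda>n. poly_eval x (P n)) \<longlonglongrightarrow> cfc x f" by (rule cfc_polynomial_limit[OF f R]) (use x R in blast)
  obtain Q where Q: "uniform_limit {-R..R} (\<lambda>n. poly (Q n)) g sequentially"
    "(\<lambda>n. poly_eval x (Q n)) \<longlonglongrightarrow> cfc x g" by (rule cfc_polynomial_limit[OF g R]) (use x R in blast)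
  have "uniform_limit {-R..R} (\<lambda>n. poly (P n + Q n)) (\<lambda>t. f t + g t) sequentially"
    using uniform_limit_add[OF P(1) Q(1)] by (simp only: poly_fun_simps)
  from cfc_limit[OF x _ R this] have "(\<lambda>n. poly_eval x (P n + Q n)) \<longlonglongrightarrow> cfc x (\<lambda>t. f t + g t)"
    by (simp add: continuous_on_add f g)
  moreover have "(\<lambda>n. poly_eval x (P n + Q n)) \<longlonglongrightarrow> cfc x f + cfc x g"
    using tendsto_add[OF P(2) Q(2)] by (simp add: poly_eval_add)
  ultimately show ?thesis using LIMSEQ_unique by blast
qed

lemma cfc_mult:
  fixes x :: "'a::{cstar_algebra,real_normed_algebra_1}"
  assumes x: "star x = x" and f: "continuous_on UNIV f" and g: "continuous_on UNIV g"
  shows "cfc x (\<lambda>t. f t * g t) = cfc x f * cfc x g"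
proof -
  define R where "R = norm x + 1"
  have R: "norm x < R" by (simp add: R_def)
  obtain P where P: "uniform_limit {-R..R} (\<lambda>n. poly (P n)) f sequentially"
    "(\<lambda>n. poly_eval x (P n)) \<longlonglongrightarrow> cfc x f" by (rule cfc_polynomial_limit[OF f R]) (use x R in blast)
  obtain Q where Q: "uniform_limit {-R..R} (\<lambda>n. poly (Q n)) g sequentially"
    "(\<lambda>n. poly_eval x (Q n)) \<longlonglongrightarrow> cfc x g" by (rule cfc_polynomial_limit[OF g R]) (use x R in blast)
  have bd: "bounded (h ` {-R..R})" if "continuous_on UNIV h" for h :: "real \<Rightarrow> real"
    by (intro compact_imp_bounded compact_continuous_image continuous_on_subset[OF that]) auto
  have "uniform_limit {-R..R} (\<lambda>n. poly (P n * Q n)) (\<lambda>t. f t * g t) sequentially"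
    using uniform_lim_mult[OF P(1) Q(1) bd[OF f] bd[OF g]] by (simp only: poly_fun_simps)
  from cfc_limit[OF x _ R this] have "(\<lambda>n. poly_eval x (P n * Q n)) \<longlonglongrightarrow> cfc x (\<lambda>t. f t * g t)"
    by (simp add: continuous_on_mult f g)
  moreover have "(\<lambda>n. poly_eval x (P n * Q n)) \<longlonglongrightarrow> cfc x f * cfc x g"
    using tendsto_mult[OF P(2) Q(2)] by (simp add: poly_eval_mult)
  ultimately show ?thesis using LIMSEQ_unique by blast
qed

lemma cfc_cmult:
  assumes "star x = x" "continuous_on UNIV f"
  shows "cfc x (\<lambda>t. c * f t) = c *\<^sub>R cfc x f"
  using cfc_mult[OF assms(1) continuous_on_const assms(2), of c] cfc_const[OF assms(1), of c] by simp

lemma cfc_minus: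
  assumes "star x = x" "continuous_on UNIV f"
  shows "cfc x (\<lambda>t. - f t) = - cfc x f"
  using cfc_cmult[OF assms, of "-1"] by simp

lemma cfc_diff:
  assumes "star x = x" "continuous_on UNIV f" "continuous_on UNIV g"
  shows "cfc x (\<lambda>t. f t - g t) = cfc x f - cfc x g"
  using cfc_add[OF assms(1,2), of "\<lambda>t. - g t"] cfc_minus[OF assms(1,3)] assms(3)
  by (simp add: continuous_on_minus)

lemma norm_cfc_le:
  fixes x :: "'a::{cstar_algebra,real_normed_algebra_1}"
  assumes x: "star x = x" and f: "continuous_on UNIV f" and R: "norm x < R"
    and M: "\<And>t. \<bar>t\<bar> \<le> R \<Longrightarrow> \<bar>f t\<bar> \<le> M"
  shows "norm (cfc x f) \<le> M"
proof (rule field_le_epsilon)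
  fix e :: real assume e: "0 < e"
  obtain P where P: "uniform_limit {-R..R} (\<lambda>n. poly (P n)) f sequentially"
    "(\<lambda>n. poly_eval x (P n)) \<longlonglongrightarrow> cfc x f" by (rule cfc_polynomial_limit[OF f R]) (use x R in blast)
  have "\<forall>\<^sub>F n in sequentially. norm (poly_eval x (P n)) \<le> M + e"
    using uniform_limitD[OF P(1) e]
  proof eventually_elim
    case (elim n)
    show ?case
    proof (rule norm_poly_eval_le[OF x R])
      fix t assume "\<bar>t\<bar> \<le> R"
      then show "\<bar>poly (P n) t\<bar> \<le> M + e"
        using M[of t] bspec[OF elim, of t] by (simp add: dist_real_def abs_le_iff) linarith
    qed
  qed
  then show "norm (cfc x f) \<le> M + e"
    by (rule tendsto_upperbound[OF tendsto_norm[OF P(2)]]) simp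
qed

lemma cfc_cong:
  fixes x :: "'a::{cstar_algebra,real_normed_algebra_1}"
  assumes "star x = x" "continuous_on UNIV f" "continuous_on UNIV g" "norm x < R"
    "\<And>t. \<bar>t\<bar> \<le> R \<Longrightarrow> f t = g t"
  shows "cfc x f = cfc x g"
  using norm_cfc_le[of x "\<lambda>t. f t - g t" R 0] assms by (simp add: cfc_diff continuous_on_diff)

lemma cfc_compose:
  fixes x :: "'a::{cstar_algebra,real_normed_algebra_1}"
  assumes x: "star x = x" and f: "continuous_on UNIV f" and g: "continuous_on UNIV g"
  shows "cfc (cfc x g) f = cfc x (\<lambda>t. f (g t))"
proof -
  define R where "R = norm x + 1"
  have R: "norm x < R" by (simp add: R_def)
  have "bounded (g ` {-R..R})"
    by (intro compact_imp_bounded compact_continuous_image continuous_on_subset[OF g]) auto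
  then obtain K where K: "\<And>t. t \<in> {-R..R} \<Longrightarrow> \<bar>g t\<bar> \<le> K" unfolding bounded_real by blast
  define S where "S = max (norm (cfc x g) + 1) K"
  have S: "norm (cfc x g) < S" by (simp add: S_def less_max_iff_disj)
  obtain P where P: "uniform_limit {-S..S} (\<lambda>n. poly (P n)) f sequentially"
    "(\<lambda>n. poly_eval (cfc x g) (P n)) \<longlonglongrightarrow> cfc (cfc x g) f"
    by (rule cfc_polynomial_limit[OF f S]) (use cfc_selfadjoint[OF x g] S in blast)
  have pg: "continuous_on UNIV (\<lambda>t. poly p (g t))" for p by (intro continuous_on_poly g)
  have fg: "continuous_on UNIV (\<lambda>t. f (g t))"
    using continuous_on_compose[OF g continuous_on_subset[OF f]] by (simp add: o_def)
  have e: "poly_eval (cfc x g) p = cfc x (\<lambda>t. poly p (g t))" for p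
  proof (induction p)
    case (pCons c p)
    show ?case
      using cfc_add[OF x continuous_on_const[of UNIV c] continuous_on_mult[OF g pg[of p]]]
      by (simp add: cfc_const[OF x] cfc_mult[OF x g pg[of p]] pCons)
  qed (simp add: cfc_const x)
  have "(\<lambda>n. poly_eval (cfc x g) (P n)) \<longlonglongrightarrow> cfc x (\<lambda>t. f (g t))"
  proof (rule metric_LIMSEQ_I)
    fix r :: real assume r: "0 < r"
    have "\<forall>\<^sub>F n in sequentially. norm (poly_eval (cfc x g) (P n) - cfc x (\<lambda>t. f (g t))) \<le> r / 2"
      using uniform_limitD[OF P(1) half_gt_zero[OF r]]
    proof eventually_elim
      case (elim n)
      have "norm (cfc x (\<lambda>t. poly (P n) (g t) - f (g t))) \<le> r / 2"
      proof (rule norm_cfc_le[OF x _ R])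
        show "continuous_on UNIV (\<lambda>t. poly (P n) (g t) - f (g t))"
          by (intro continuous_on_diff pg fg)
        show "\<bar>poly (P n) (g t) - f (g t)\<bar> \<le> r / 2" if "\<bar>t\<bar> \<le> R" for t
        proof -
          have "g t \<in> {-S..S}" using K[of t] that by (auto simp: S_def abs_le_iff le_max_iff_disj)
          then show ?thesis using bspec[OF elim] by (fastforce simp: dist_real_def)
        qed
      qed
      then show ?case by (simp add: e cfc_diff[OF x pg fg])
    qed
    then show "\<exists>no. \<forall>n\<ge>no. dist (poly_eval (cfc x g) (P n)) (cfc x (\<lambda>t. f (g t))) < r"
      using r by (fastforce simp: eventually_sequentially dist_norm)
  qed
  with P(2) show ?thesis using LIMSEQ_unique by blast
qed

section \<open>Positivity\<close>

lemma cartesian_decomposition: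
  fixes c :: "'a::cstar_algebra"
  obtains h k where "star h = h" "star k = k" "c = h + \<i> *\<^sub>C k"
    "star c * c + c * star c = 2 *\<^sub>R (h * h + k * k)"
proof -
  define h where "h = (1/2) *\<^sub>R (c + star c)"
  define k where "k = (- \<i> / 2) *\<^sub>C (c - star c)"
  have hk: "star h = h" "star k = k"
    by (simp_all add: h_def k_def star_add star_diff star_scaleR star_scaleC star_star algebra_simps
        scaleC_diff_right scaleC_minus_left)
  have "\<i> *\<^sub>C k = (1/2) *\<^sub>R (c - star c)"
    by (simp add: k_def scaleC_scaleC scaleR_scaleC)
  then have c: "c = h + \<i> *\<^sub>C k"
    by (simp add: h_def scaleR_add_right scaleR_diff_right flip: scaleR_add_left)
  have "star c = h - \<i> *\<^sub>C k"
    unfolding c by (simp add: star_add star_scaleC hk scaleC_minus_left)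
  then have "star c * c + c * star c = 2 *\<^sub>R (h * h + k * k)"
    unfolding \<open>star c = _\<close> unfolding c by (simp add: algebra_simps mult_scaleC_left mult_scaleC_right scaleC_scaleC
        scaleC_minus_left scaleC_one scaleR_2)
  then show ?thesis using hk c that by blast
qed

text \<open>
  For self-adjoint \<open>w\<close>, the condition says that the spectrum lies in \<open>[0, 2 R]\<close> for some \<open>R\<close>. In
  this form it is visibly stable under sums.
\<close>

definition positive_element :: "'a::{cstar_algebra,real_normed_algebra_1} \<Rightarrow> bool" where
  "positive_element w \<longleftrightarrow> star w = w \<and> (\<exists>R. norm (R *\<^sub>R 1 - w) \<le> R)"

lemma positive_element_add: "positive_element v \<Longrightarrow> positive_element w \<Longrightarrow> positive_element (v + w)"
proof -
  assume "positive_element v" "positive_element w"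
  then obtain R S where sa: "star v = v" "star w = w" and "norm (R *\<^sub>R 1 - v) \<le> R" "norm (S *\<^sub>R 1 - w) \<le> S"
    by (auto simp: positive_element_def)
  then have "norm ((R *\<^sub>R 1 - v) + (S *\<^sub>R 1 - w)) \<le> R + S" by (intro norm_triangle_le) simp
  then have "norm ((R + S) *\<^sub>R 1 - (v + w)) \<le> R + S" by (simp add: algebra_simps)
  then show ?thesis using sa by (auto simp: positive_element_def star_add)
qed

lemma positive_element_cfc:
  fixes x :: "'a::{cstar_algebra,real_normed_algebra_1}"
  assumes x: "star x = x" and f: "continuous_on UNIV f" and pos: "\<And>t. f t \<ge> 0"
  shows "positive_element (cfc x f)"
proof -
  define R where "R = norm x + 1"
  have R: "norm x < R" by (simp add: R_def)
  have "bounded (f ` {-R..R})"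
    by (intro compact_imp_bounded compact_continuous_image continuous_on_subset[OF f]) auto
  then obtain K where K: "\<And>t. t \<in> {-R..R} \<Longrightarrow> \<bar>f t\<bar> \<le> K" unfolding bounded_real by blast
  have "norm (cfc x (\<lambda>t. K - f t)) \<le> K"
  proof (rule norm_cfc_le[OF x _ R])
    show "\<bar>K - f t\<bar> \<le> K" if "\<bar>t\<bar> \<le> R" for t
      using K[of t] pos[of t] that by (auto simp: abs_le_iff)
  qed (intro continuous_intros f)
  then show ?thesis
    using cfc_selfadjoint[OF x f]
    by (auto simp: positive_element_def cfc_diff[OF x continuous_on_const f] cfc_const[OF x])
qed

definition neg_part :: "real \<Rightarrow> real" where "neg_part t = max (- t) 0"

lemma continuous_neg_part [continuous_intros]:
  "continuous_on S f \<Longrightarrow> continuous_on S (\<lambda>t. neg_part (f t))"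
  unfolding neg_part_def by (intro continuous_intros)

lemma continuous_neg_part_id: "continuous_on UNIV neg_part"
  using continuous_neg_part[OF continuous_on_id] by simp

text \<open>Write \<open>w = R - v\<close> with \<open>norm v \<le> R\<close>; the function \<open>t \<mapsto> neg_part (R - t)\<close> vanishes on \<open>[-R, R]\<close>.\<close>

lemma positive_element_neg_part:
  fixes w :: "'a::{cstar_algebra,real_normed_algebra_1}"
  assumes "positive_element w" shows "cfc w neg_part = 0"
proof -
  obtain R where w: "star w = w" and R: "norm (R *\<^sub>R 1 - w) \<le> R"
    using assms by (auto simp: positive_element_def)
  define v where "v = R *\<^sub>R 1 - w"
  have v: "star v = v" by (simp add: v_def star_diff star_scaleR w)
  have wv: "w = cfc v (\<lambda>t. R - t)"
    by (subst cfc_diff[OF v]) (simp_all add: cfc_const[OF v] cfc_id[OF v], simp add: v_def)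
  have "cfc w neg_part = cfc v (\<lambda>t. neg_part (R - t))"
    unfolding wv by (rule cfc_compose[OF v continuous_neg_part_id]) (intro continuous_intros)
  moreover have "norm (cfc v (\<lambda>t. neg_part (R - t))) \<le> e" if "e > 0" for e
    by (rule norm_cfc_le[OF v, of _ "R + e"])
      (use R that in \<open>auto simp: neg_part_def v_def intro!: continuous_intros\<close>)
  ultimately show ?thesis by (metis field_le_epsilon add_0 norm_le_zero_iff)
qed

lemma poly_eval_intertwine: "star c * poly_eval (c * star c) p * c = star c * c * poly_eval (star c * c) p"
  for c :: "'a::{cstar_algebra,real_normed_algebra_1}"
proof -
  have "poly_eval (c * star c) p * c = c * poly_eval (star c * c) p"
    by (induction p) (simp_all add: distrib_left distrib_right mult.assoc)
  then show ?thesis by (simp add: mult.assoc)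
qed

lemma cfc_intertwine:
  fixes c :: "'a::{cstar_algebra,real_normed_algebra_1}"
  assumes f: "continuous_on UNIV f"
  shows "star c * cfc (c * star c) f * c = star c * c * cfc (star c * c) f"
proof -
  have s: "star (c * star c) = c * star c" "star (star c * c) = star c * c"
    by (simp_all add: star_mult star_star)
  define R where "R = norm (c * star c) + norm (star c * c) + 1"
  have R: "norm (c * star c) < R" "norm (star c * c) < R" by (simp_all add: R_def add_nonneg_pos add_pos_nonneg)
  obtain P where P: "\<And>y::'a. star y = y \<Longrightarrow> norm y < R \<Longrightarrow> (\<lambda>n. poly_eval y (P n)) \<longlonglongrightarrow> cfc y f"
    by (rule cfc_polynomial_limit[OF f R(1)]) blast
  have "(\<lambda>n. star c * poly_eval (c * star c) (P n) * c) \<longlonglongrightarrow> star c * cfc (c * star c) f * c"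
    by (intro tendsto_intros P s R)
  moreover have "(\<lambda>n. star c * c * poly_eval (star c * c) (P n)) \<longlonglongrightarrow> star c * c * cfc (star c * c) f"
    by (intro tendsto_intros P s R)
  ultimately show ?thesis unfolding poly_eval_intertwine using LIMSEQ_unique by blast
qed

text \<open>
  Kaplansky's argument that \<open>x = b\<^sup>* b\<close> has no negative part \<open>z\<close>: for \<open>c = b z\<close> the element
  \<open>c\<^sup>* c = - z\<^sup>3\<close> is negative. As \<open>c\<^sup>* c + c c\<^sup>*\<close> is a sum of squares, \<open>c c\<^sup>*\<close> is positive.
  But \<open>c\<^sup>* c\<close> and \<open>c c\<^sup>*\<close> have the same spectrum away from zero, so \<open>z = 0\<close>.
\<close>

lemma star_mult_neg_part:
  fixes b :: "'a::{cstar_algebra,real_normed_algebra_1}"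
  shows "cfc (star b * b) neg_part = 0"
proof -
  define x where "x = star b * b"
  have x: "star x = x" by (simp add: x_def star_mult star_star)
  define z where "z = cfc x neg_part"
  have z: "star z = z" unfolding z_def by (rule cfc_selfadjoint[OF x continuous_neg_part_id])
  define c where "c = b * z"
  note cn = continuous_neg_part_id
  define z3 where "z3 = cfc x (\<lambda>t. neg_part t ^ 3)"
  have c3: "continuous_on UNIV (\<lambda>t. neg_part t ^ 3)" "continuous_on UNIV (\<lambda>t. - (neg_part t ^ 3))"
    by (intro continuous_intros)+
  have zt: "continuous_on UNIV (\<lambda>t. neg_part t * t)" by (intro continuous_intros)
  have "star c * c = z * x * z" by (simp add: c_def x_def star_mult z mult.assoc)
  also have "\<dots> = cfc x (\<lambda>t. neg_part t * t * neg_part t)"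
    by (simp add: cfc_mult[OF x zt cn] cfc_mult[OF x cn continuous_on_id] cfc_id[OF x] z_def)
  also have "(\<lambda>t. neg_part t * t * neg_part t) = (\<lambda>t. - (neg_part t ^ 3))"
    by (auto simp: fun_eq_iff neg_part_def max_def power3_eq_cube)
  finally have cc: "star c * c = cfc x (\<lambda>t. - (neg_part t ^ 3))" .
  then have cc': "star c * c = - z3" by (simp add: z3_def cfc_minus[OF x c3(1)])
  obtain h k where hk: "star h = h" "star k = k" "star c * c + c * star c = 2 *\<^sub>R (h * h + k * k)"
    using cartesian_decomposition[of c] by metis
  have sq: "2 *\<^sub>R (h * h) = cfc h (\<lambda>t. 2 * (t * t))" if "star h = h" for h :: 'a
    using cfc_cmult[OF that, of "\<lambda>t. t * t" 2] cfc_mult[OF that continuous_on_id continuous_on_id] cfc_id[OF that]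
    by (simp add: continuous_intros)
  have "c * star c = 2 *\<^sub>R (h * h) + 2 *\<^sub>R (k * k) + z3"
    using hk(3) cc' by (simp add: scaleR_add_right algebra_simps)
  moreover have "positive_element (2 *\<^sub>R (h * h))" "positive_element (2 *\<^sub>R (k * k))" "positive_element z3"
    unfolding sq[OF hk(1)] sq[OF hk(2)] z3_def
    by (intro positive_element_cfc hk(1,2) x continuous_intros; simp add: neg_part_def)+
  ultimately have "positive_element (c * star c)" by (simp add: positive_element_add)
  then have "star c * c * cfc (star c * c) neg_part = 0"
    using cfc_intertwine[OF cn, of c] positive_element_neg_part[of "c * star c"] by simp
  moreover have "cfc (star c * c) neg_part = z3"
    unfolding cc cfc_compose[OF x cn c3(2)] z3_def
    by (rule arg_cong[where f="cfc x"]) (auto simp: fun_eq_iff neg_part_def max_def)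
  ultimately have z33: "z3 * z3 = 0" using cc' by simp
  have "star z3 = z3" unfolding z3_def by (rule cfc_selfadjoint[OF x c3(1)])
  then have z30: "z3 = 0" using z33 norm_power2_selfadjoint[of z3] by simp
  have "z3 * z = (z * z) * (z * z)"
    unfolding z3_def z_def cfc_mult[OF x c3(1) cn, symmetric] cfc_mult[OF x cn cn, symmetric]
    by (subst cfc_mult[OF x, symmetric])
       (auto intro!: continuous_intros arg_cong[where f="cfc x"] simp: fun_eq_iff power3_eq_cube mult.assoc)
  then have "norm (z * z) = 0"
    using z30 norm_power2_selfadjoint[of "z * z"] z by (simp add: star_mult)
  then have "z = 0" using norm_power2_selfadjoint[OF z] by simp
  then show ?thesis by (simp add: z_def x_def)
qed

lemma norm_one_minus_star_mult_le:
  fixes b :: "'a::{cstar_algebra,real_normed_algebra_1}"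
  assumes b: "norm b \<le> 1"
  shows "norm (1 - star b * b) \<le> 1"
proof -
  define x where "x = star b * b"
  have x: "star x = x" by (simp add: x_def star_mult star_star)
  have nx: "norm x < 2" using b power_le_one[of "norm b" 2] by (simp add: x_def cstar_identity)
  have cp: "continuous_on UNIV (\<lambda>t::real. max t 0)" by (intro continuous_intros)
  have "x = cfc x (\<lambda>t. max t 0 - neg_part t)"
    by (subst cfc_id[OF x, symmetric]) (auto intro!: arg_cong[where f="cfc x"] simp: fun_eq_iff neg_part_def max_def)
  also have "\<dots> = cfc x (\<lambda>t. max t 0)"
    by (subst cfc_diff[OF x cp continuous_neg_part_id]) (simp add: star_mult_neg_part x_def)
  finally have "1 - x = cfc x (\<lambda>t. 1 - max t 0)"
    by (simp add: cfc_diff[OF x continuous_on_const cp] cfc_const[OF x])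
  also have "norm \<dots> \<le> 1"
    by (rule norm_cfc_le[OF x _ nx]) (auto intro!: continuous_intros)
  finally show ?thesis by (simp add: x_def)
qed

text \<open>Applied to \<open>x = b\<^sup>* b\<close>, this shows that positive functionals satisfy
  \<open>\<Phi> (a\<^sup>* b\<^sup>* b a) \<le> norm b ^ 2 * \<Phi> (a\<^sup>* a)\<close>.\<close>

lemma exists_sqrt_scalar_minus:
  fixes x :: "'a::{cstar_algebra,real_normed_algebra_1}"
  assumes x: "star x = x" and K: "norm x < K"
  defines "y \<equiv> cfc x (\<lambda>t. sqrt (max 0 (K - t)))"
  shows "star y = y" "y * y = K *\<^sub>R 1 - x"
proof -
  have c: "continuous_on UNIV (\<lambda>t. sqrt (max 0 (K - t)))" by (intro continuous_intros)
  show "star y = y" unfolding y_def by (rule cfc_selfadjoint[OF x c])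
  have "y * y = cfc x (\<lambda>t. max 0 (K - t))"
    unfolding y_def cfc_mult[OF x c c, symmetric] by simp
  also have "\<dots> = cfc x (\<lambda>t. K - t)"
    by (rule cfc_cong[OF x _ _ K]) (auto intro!: continuous_intros)
  also have "\<dots> = K *\<^sub>R 1 - x" by (simp add: cfc_diff[OF x] cfc_const[OF x] cfc_id[OF x])
  finally show "y * y = K *\<^sub>R 1 - x" .
qed

section \<open>Subalgebras and closed ideals\<close>

lemma cstar_subalgebraD:
  assumes "cstar_subalgebra B"
  shows "0 \<in> B" "x \<in> B \<Longrightarrow> y \<in> B \<Longrightarrow> x + y \<in> B" "x \<in> B \<Longrightarrow> y \<in> B \<Longrightarrow> x - y \<in> B"
    "x \<in> B \<Longrightarrow> c *\<^sub>C x \<in> B" "x \<in> B \<Longrightarrow> r *\<^sub>R x \<in> B" "x \<in> B \<Longrightarrow> y \<in> B \<Longrightarrow> x * y \<in> B"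
    "x \<in> B \<Longrightarrow> star x \<in> B" "closed B" "x \<in> B \<Longrightarrow> - x \<in> B"
  using assms complex_vector.subspace_0[of B] complex_vector.subspace_add[of B]
    complex_vector.subspace_diff[of B] complex_vector.subspace_scale[of B] complex_vector.subspace_neg[of B]
  by (auto simp: cstar_subalgebra_def scaleR_scaleC)

lemma closed_idealD:
  assumes "I \<in> closed_ideals B"
  shows "0 \<in> I" "x \<in> I \<Longrightarrow> y \<in> I \<Longrightarrow> x + y \<in> I" "x \<in> I \<Longrightarrow> y \<in> I \<Longrightarrow> x - y \<in> I"
    "x \<in> I \<Longrightarrow> c *\<^sub>C x \<in> I" "x \<in> I \<Longrightarrow> r *\<^sub>R x \<in> I" "a \<in> B \<Longrightarrow> y \<in> I \<Longrightarrow> a * y \<in> I"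
    "a \<in> B \<Longrightarrow> y \<in> I \<Longrightarrow> y * a \<in> I" "closed I" "x \<in> I \<Longrightarrow> x \<in> B" "x \<in> I \<Longrightarrow> - x \<in> I"
  using assms complex_vector.subspace_0[of I] complex_vector.subspace_add[of I]
    complex_vector.subspace_diff[of I] complex_vector.subspace_scale[of I] complex_vector.subspace_neg[of I]
  by (auto simp: closed_ideals_def two_sided_ideal_def scaleR_scaleC)

lemma cfc_mem:
  fixes x :: "'a::{cstar_algebra,real_normed_algebra_1}"
  assumes B: "cstar_subalgebra B" and x: "x \<in> B" "star x = x"
    and f: "continuous_on UNIV f" "f 0 = 0 \<or> 1 \<in> B"
  shows "cfc x f \<in> B"
proof -
  obtain P where P: "(\<lambda>n. poly_eval x (P n)) \<longlonglongrightarrow> cfc x f" "\<And>n. poly (P n) 0 = f 0"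
    by (rule cfc_polynomial_limit[OF f(1) less_add_one[of "norm x"]])
      (use x less_add_one[of "norm x"] in blast)
  have 0: "x * poly_eval x p \<in> B" for p
    by (induction p) (simp_all add: distrib_left x cstar_subalgebraD[OF B])
  have "poly_eval x p \<in> B" if "poly p 0 = f 0" for p
    using that f(2) 0 by (cases p) (auto simp: cstar_subalgebraD[OF B])
  then show ?thesis
    using closed_sequentially[OF cstar_subalgebraD(8)[OF B] _ P(1)] P(2) by blast
qed

text \<open>Modulo a closed ideal, a continuous function of \<open>x\<close> depends on \<open>x\<close> only modulo the ideal.
  This takes the place of the calculus in the quotient algebra.\<close>

lemma cfc_diff_mem_ideal:
  fixes x :: "'a::{cstar_algebra,real_normed_algebra_1}"
  assumes I: "I \<in> closed_ideals B" and x: "x \<in> B" "star x = x" and y: "y \<in> B" "star y = y"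
    and xy: "x - y \<in> I" and f: "continuous_on UNIV f"
  shows "cfc x f - cfc y f \<in> I"
proof -
  define R where "R = norm x + norm y + 1"
  have R: "norm x < R" "norm y < R" by (simp_all add: R_def add_nonneg_pos add_pos_nonneg)
  obtain P where P: "\<And>y::'a. star y = y \<Longrightarrow> norm y < R \<Longrightarrow> (\<lambda>n. poly_eval y (P n)) \<longlonglongrightarrow> cfc y f"
    by (rule cfc_polynomial_limit[OF f R(1)]) blast
  have lim: "(\<lambda>n. poly_eval x (P n) - poly_eval y (P n)) \<longlonglongrightarrow> cfc x f - cfc y f"
    by (intro tendsto_diff P x y R)
  note [simp] = closed_idealD[OF I]
  have i: "i * poly_eval x p \<in> I" if "i \<in> I" for i p
    using that by (induction p arbitrary: i) (auto simp: distrib_left mult.assoc[symmetric] x)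
  have "poly_eval x p - poly_eval y p \<in> I" for p
  proof (induction p)
    case (pCons c p)
    have "poly_eval x (pCons c p) - poly_eval y (pCons c p) = (x - y) * poly_eval x p + y * (poly_eval x p - poly_eval y p)"
      by (simp add: algebra_simps)
    then show ?case using i[OF xy, of p] pCons y by simp
  qed simp
  then show ?thesis using closed_sequentially[OF _ _ lim] by simp
qed

text \<open>The functions \<open>e = cfc x (\<lambda>t. t\<^sup>2 / (t\<^sup>2 + d))\<close> of \<open>x = l\<^sup>* l\<close> lie in the ideal, hence so does
  \<open>e l\<^sup>*\<close>. They are close to one where \<open>x\<close> is not small, so that \<open>e l\<^sup>*\<close> tends to \<open>l\<^sup>*\<close> as \<open>d\<close> tends
  to zero.\<close>

lemma closed_ideal_star_unital:
  fixes l :: "'a::{cstar_algebra,real_normed_algebra_1}"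
  assumes B: "cstar_subalgebra B" and I: "I \<in> closed_ideals B" and l: "l \<in> I"
  shows "star l \<in> I"
proof -
  have lB: "l \<in> B" by (rule closed_idealD(9)[OF I l])
  define x where "x = star l * l"
  have x: "star x = x" "x \<in> I" "x \<in> B"
    using l lB closed_idealD(6)[OF I] cstar_subalgebraD[OF B] by (simp_all add: x_def star_mult star_star)
  define e where "e d = cfc x (\<lambda>t. t * (t / (t\<^sup>2 + d)))" for d
  have c1: "continuous_on UNIV (\<lambda>t. t / (t\<^sup>2 + d))" if "d > 0" for d :: real
    using that by (intro continuous_intros) (auto simp: add_nonneg_pos less_imp_neq[symmetric])
  have c2: "continuous_on UNIV (\<lambda>t. t * (t / (t\<^sup>2 + d)))" if "d > 0" for d :: real
    by (intro continuous_on_mult continuous_on_id c1 that)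
  have eI: "e d \<in> I" if "d > 0" for d
  proof -
    have "e d = x * cfc x (\<lambda>t. t / (t\<^sup>2 + d))"
      unfolding e_def by (subst cfc_mult[OF x(1) continuous_on_id c1[OF that]]) (simp add: cfc_id[OF x(1)])
    moreover have "cfc x (\<lambda>t. t / (t\<^sup>2 + d)) \<in> B" by (rule cfc_mem[OF B x(3,1) c1[OF that]]) simp
    ultimately show ?thesis using closed_idealD(7)[OF I _ x(2)] by simp
  qed
  have es: "star (e d) = e d" if "d > 0" for d
    unfolding e_def by (rule cfc_selfadjoint[OF x(1) c2[OF that]])
  have bound: "(norm (star l - e d * star l))\<^sup>2 \<le> sqrt d" if d: "d > 0" for d
  proof -
    define g where "g t = 1 - t * (t / (t\<^sup>2 + d))" for t :: real
    have cg: "continuous_on UNIV g" unfolding g_def by (intro continuous_on_diff continuous_on_const c2 d)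
    have g1: "cfc x g = 1 - e d"
      unfolding g_def e_def by (subst cfc_diff[OF x(1) continuous_on_const c2[OF d]]) (simp add: cfc_const[OF x(1)])
    have "norm (star l - e d * star l) = norm (star (l - l * e d))"
      by (simp add: star_diff star_mult es[OF d])
    also have "\<dots> = norm (l * cfc x g)" unfolding norm_star g1 by (simp add: right_diff_distrib)
    finally have "(norm (star l - e d * star l))\<^sup>2 = norm (star (l * cfc x g) * (l * cfc x g))"
      by (simp add: cstar_identity)
    also have "star (l * cfc x g) * (l * cfc x g) = cfc x g * x * cfc x g"
      unfolding star_mult cfc_selfadjoint[OF x(1) cg] by (simp add: x_def mult.assoc)
    also have "\<dots> = cfc x (\<lambda>t. g t * t * g t)"
      by (subst cfc_mult[OF x(1) continuous_on_mult[OF cg continuous_on_id] cg])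
         (simp add: cfc_mult[OF x(1) cg continuous_on_id] cfc_id[OF x(1)])
    also have "norm \<dots> \<le> sqrt d"
    proof (rule norm_cfc_le[OF x(1) _ less_add_one])
      show "continuous_on UNIV (\<lambda>t. g t * t * g t)" by (intro continuous_on_mult cg continuous_on_id)
      fix t :: real
      have p: "t\<^sup>2 + d > 0" using d by (simp add: add_nonneg_pos)
      have g: "g t = d / (t\<^sup>2 + d)" using p by (simp add: g_def field_simps power2_eq_square)
      have g01: "0 \<le> g t" "g t \<le> 1" using p d by (simp_all add: g)
      have "0 \<le> (\<bar>t\<bar> - sqrt d)\<^sup>2" by simp
      then have "2 * (\<bar>t\<bar> * sqrt d) \<le> t\<^sup>2 + d" using d by (simp add: power2_diff)
      moreover have "0 \<le> \<bar>t\<bar> * sqrt d" using d by simp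
      ultimately have "\<bar>t\<bar> * sqrt d \<le> t\<^sup>2 + d" by linarith
      then have "\<bar>t\<bar> * sqrt d * sqrt d \<le> sqrt d * (t\<^sup>2 + d)"
        using d mult_right_mono[of "\<bar>t\<bar> * sqrt d" "t\<^sup>2 + d" "sqrt d"] by (simp add: mult.commute)
      then have "\<bar>t\<bar> * d \<le> sqrt d * (t\<^sup>2 + d)" using d by (simp add: mult.assoc)
      then have "\<bar>g t * t\<bar> \<le> sqrt d" using p d by (simp add: g abs_mult field_simps)
      then show "\<bar>g t * t * g t\<bar> \<le> sqrt d"
        using mult_mono[of "\<bar>g t * t\<bar>" "sqrt d" "\<bar>g t\<bar>" 1] g01 d by (simp add: abs_mult)
    qed
    finally show ?thesis .
  qed
  have "(\<lambda>n. e (inverse (real (Suc n))) * star l) \<longlonglongrightarrow> star l"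
  proof -
    have "(\<lambda>n. sqrt (sqrt (inverse (real (Suc n))))) \<longlonglongrightarrow> sqrt (sqrt 0)"
      by (intro tendsto_real_sqrt LIMSEQ_inverse_real_of_nat)
    then have L: "(\<lambda>n. sqrt (sqrt (inverse (real (Suc n))))) \<longlonglongrightarrow> 0" by simp
    have "(\<lambda>n. star l - e (inverse (real (Suc n))) * star l) \<longlonglongrightarrow> 0"
      by (rule Lim_null_comparison[OF _ L]) (intro always_eventually allI real_le_rsqrt bound; simp)
    from tendsto_diff[OF tendsto_const this, of "star l"] show ?thesis by simp
  qed
  moreover have "e (inverse (real (Suc n))) * star l \<in> I" for n
    using closed_idealD(7)[OF I cstar_subalgebraD(7)[OF B lB] eI] by simp
  ultimately show ?thesis by (rule closed_sequentially[OF closed_idealD(8)[OF I], rotated])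
qed

text \<open>Soft thresholding: moves \<open>t\<close> towards zero by \<open>r\<close>, but not beyond zero.\<close>

definition soft :: "real \<Rightarrow> real \<Rightarrow> real" where
  "soft r t = t - max (- r) (min r t)"

lemma continuous_soft: "continuous_on UNIV (soft r)"
  unfolding soft_def by (intro continuous_intros)

lemma infdist_less_obtains:
  fixes x :: "'a::real_normed_vector"
  assumes "infdist x A < r" "A \<noteq> {}"
  obtains l where "l \<in> A" "norm (x - l) < r"
proof -
  have "bdd_below (dist x ` A)" by (rule bdd_belowI[of _ 0]) auto
  then show ?thesis
    using assms that cINF_less_iff[of A "dist x" r] by (auto simp: infdist_notempty dist_norm)
qed

text \<open>Choose a self-adjoint \<open>m\<close> in the ideal with \<open>norm (x - m) < r\<close>. Then \<open>f\<close> annihilates \<open>x - m\<close>, and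
  \<open>f(x)\<close> agrees with \<open>f(x - m)\<close> modulo the ideal.\<close>

lemma cfc_soft_mem_ideal:
  fixes x :: "'a::{cstar_algebra,real_normed_algebra_1}"
  assumes B: "cstar_subalgebra B" and I: "I \<in> closed_ideals B" and x: "x \<in> B" "star x = x"
    and f: "continuous_on UNIV f" "\<And>t. \<bar>t\<bar> \<le> r \<Longrightarrow> f t = 0" and r: "infdist x I < r"
  shows "cfc x f \<in> I"
proof -
  have "I \<noteq> {}" using closed_idealD(1)[OF I] by blast
  then obtain l where l: "l \<in> I" "norm (x - l) < r"
    using infdist_less_obtains[OF r] by blast
  define m where "m = (1/2) *\<^sub>R (l + star l)"
  have m: "star m = m" "m \<in> I"
    using closed_ideal_star_unital[OF B I l(1)] closed_idealD[OF I] l(1)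
    by (auto simp: m_def star_scaleR star_add star_star add.commute)
  have "x - m = (1/2) *\<^sub>R ((x - l) + star (x - l))"
    by (simp add: m_def star_diff x algebra_simps flip: scaleR_add_left)
  then have "norm (x - m) \<le> norm (x - l)"
    using norm_triangle_ineq[of "x - l" "star (x - l)"] by simp
  then have n: "norm (x - m) < r" using l(2) by simp
  have s: "star (x - m) = x - m" "x - m \<in> B"
    using m x closed_idealD(9)[OF I] cstar_subalgebraD[OF B] by (auto simp: star_diff)
  have "norm (cfc (x - m) f) \<le> 0" by (rule norm_cfc_le[OF s(1) f(1) n]) (simp add: f)
  moreover have "cfc x f - cfc (x - m) f \<in> I"
    by (rule cfc_diff_mem_ideal[OF I x s(2,1) _ f(1)]) (simp add: m)
  ultimately show ?thesis by simp
qed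

text \<open>The soft thresholds of \<open>y\<close> converge to \<open>y\<close>, and since they vanish near zero they are multiples of \<open>y\<^sup>2\<close>.\<close>

lemma square_mem_ideal_unital:
  fixes y :: "'a::{cstar_algebra,real_normed_algebra_1}"
  assumes B: "cstar_subalgebra B" and I: "I \<in> closed_ideals B" and y: "y \<in> B" "star y = y"
    and yy: "y * y \<in> I"
  shows "y \<in> I"
proof -
  have mem: "cfc y (soft r) \<in> I" if r: "r > 0" for r
  proof -
    \<comment> \<open>The quotient of \<open>soft r t\<close> by \<open>t\<^sup>2\<close>; the maximum matters only where the numerator vanishes.\<close>
    define g where "g t = soft r t / (max r \<bar>t\<bar>)\<^sup>2" for t
    have cg: "continuous_on UNIV g"
      unfolding g_def using r by (intro continuous_intros continuous_soft) (auto simp: max_def)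
    have cy: "continuous_on UNIV (\<lambda>t::real. t * t)" by (intro continuous_intros)
    have "soft r = (\<lambda>t. t * t * g t)"
      using r by (auto simp: fun_eq_iff g_def soft_def max_def min_def power2_eq_square divide_simps)
    then have "cfc y (soft r) = (y * y) * cfc y g"
      by (simp add: cfc_mult[OF y(2) cy cg] cfc_mult[OF y(2) continuous_on_id continuous_on_id] cfc_id[OF y(2)])
    moreover have "cfc y g \<in> B"
      by (rule cfc_mem[OF B y cg]) (simp add: g_def soft_def r less_imp_le)
    ultimately show ?thesis using closed_idealD(7)[OF I _ yy] by simp
  qed
  have "norm (y - cfc y (soft r)) \<le> r" if "r > 0" for r
  proof -
    have "y - cfc y (soft r) = cfc y (\<lambda>t. t - soft r t)"
      by (simp add: cfc_diff[OF y(2) continuous_on_id continuous_soft] cfc_id[OF y(2)])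
    also have "norm \<dots> \<le> r"
      by (rule norm_cfc_le[OF y(2) _ less_add_one])
         (use that in \<open>auto simp: soft_def intro!: continuous_intros continuous_soft\<close>)
    finally show ?thesis .
  qed
  then have "\<exists>z\<in>I. dist z y < e" if "e > 0" for e
    using mem[of "e/2"] that \<open>\<And>r. r > 0 \<Longrightarrow> norm (y - cfc y (soft r)) \<le> r\<close>[of "e/2"]
    by (intro bexI[of _ "cfc y (soft (e/2))"]) (auto simp: dist_norm norm_minus_commute)
  then have "y \<in> closure I" by (simp add: closure_approachable)
  then show ?thesis using closed_idealD(8)[OF I] by simp
qed

section \<open>Transfer to algebras without unit\<close>

abbreviation emb :: "'a::cstar_algebra \<Rightarrow> 'a unitization" where "emb a \<equiv> Unitize a 0"

lemma emb_simps:
  "emb (a + b) = emb a + emb b" "emb (a - b) = emb a - emb b" "emb (c *\<^sub>C a) = c *\<^sub>C emb a"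
  "emb (r *\<^sub>R a) = r *\<^sub>R emb a" "emb (a * b) = emb a * emb b" "emb (star a) = star (emb a)" "emb 0 = 0"
  by (auto intro!: unitization.expand)

lemma base_scal_iff: "u \<in> emb ` B \<longleftrightarrow> base u \<in> B \<and> scal u = 0"
  by (metis (no_types, lifting) image_iff unitization.collapse unitization.sel)

lemma closed_emb:
  assumes "closed B" shows "closed (emb ` B)"
proof -
  have "emb ` B = base -` B \<inter> scal -` {0}" by (auto simp: base_scal_iff)
  moreover have "continuous_on UNIV (base :: 'a unitization \<Rightarrow> 'a)"
    "continuous_on UNIV (scal :: 'a unitization \<Rightarrow> complex)"
    by (intro linear_continuous_on bounded_linear_base bounded_linear_scal)+
  ultimately show ?thesis
    using assms by (simp add: closed_Int continuous_on_closed_vimage[OF closed_UNIV, simplified])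
qed

lemma cstar_subalgebra_emb:
  assumes B: "cstar_subalgebra B" shows "cstar_subalgebra (emb ` B)"
  unfolding cstar_subalgebra_def
  using cstar_subalgebraD[OF B] closed_emb[of B]
  by (auto simp: base_scal_iff intro!: complex_vector.subspaceI)

lemma closed_ideals_emb:
  assumes I: "I \<in> closed_ideals B" shows "emb ` I \<in> closed_ideals (emb ` B)"
  unfolding closed_ideals_def two_sided_ideal_def
  using closed_idealD[OF I] closed_emb[of I]
  by (auto simp: base_scal_iff intro!: complex_vector.subspaceI)

lemma infdist_emb: "I \<noteq> {} \<Longrightarrow> infdist (emb x) (emb ` I) = infdist x I"
  by (simp add: infdist_def image_image dist_norm emb_simps(2)[symmetric])

lemma closed_ideal_star:
  assumes "cstar_subalgebra B" "I \<in> closed_ideals B" "l \<in> I"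
  shows "star l \<in> I"
  using closed_ideal_star_unital[OF cstar_subalgebra_emb closed_ideals_emb, of B I "emb l"] assms
  by (simp add: base_scal_iff)

lemma square_mem_ideal:
  assumes "cstar_subalgebra B" "I \<in> closed_ideals B" "y \<in> B" "star y = y" "y * y \<in> I"
  shows "y \<in> I"
  using square_mem_ideal_unital[OF cstar_subalgebra_emb closed_ideals_emb, of B I "emb y"] assms
  by (simp add: base_scal_iff emb_simps(5,6)[symmetric])

text \<open>
  Whether the distance of a self-adjoint \<open>x\<close> to a closed ideal is below \<open>r\<close> can thus be read off, up
  to the boundary case, from the membership of a single element that depends on neither the ideal
  nor the algebra that contains the ideal.
\<close>

definition soft_threshold :: "real \<Rightarrow> 'a::cstar_algebra \<Rightarrow> 'a" where
  "soft_threshold r x = base (cfc (emb x) (soft r))"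

lemma soft_threshold:
  fixes x :: "'a::cstar_algebra"
  assumes x: "star x = x" and r: "0 < r"
  shows norm_soft_threshold: "norm (x - soft_threshold r x) \<le> r"
    and soft_threshold_mem: "\<lbrakk>cstar_subalgebra B; x \<in> B\<rbrakk> \<Longrightarrow> soft_threshold r x \<in> B"
    and soft_threshold_mem_ideal:
      "\<lbrakk>cstar_subalgebra B; x \<in> B; I \<in> closed_ideals B; infdist x I < r\<rbrakk> \<Longrightarrow> soft_threshold r x \<in> I"
proof -
  have ex: "star (emb x) = emb x" by (simp add: emb_simps(6)[symmetric] x)
  have soft0: "soft r t = 0" if "\<bar>t\<bar> \<le> r" for t using that by (auto simp: soft_def)
  have "emb x - cfc (emb x) (soft r) = cfc (emb x) (\<lambda>t. t - soft r t)"
    by (simp add: cfc_diff[OF ex continuous_on_id continuous_soft] cfc_id[OF ex])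
  also have "norm \<dots> \<le> r"
    by (rule norm_cfc_le[OF ex _ less_add_one])
       (use r in \<open>auto simp: soft_def intro!: continuous_intros continuous_soft\<close>)
  finally have n: "norm (emb x - cfc (emb x) (soft r)) \<le> r" .
  have mem: "soft_threshold r x \<in> B \<and> emb (soft_threshold r x) = cfc (emb x) (soft r)"
    if "cstar_subalgebra B" "x \<in> B" for B
  proof -
    have "cfc (emb x) (soft r) \<in> emb ` B"
      by (rule cfc_mem[OF cstar_subalgebra_emb[OF that(1)] _ ex continuous_soft])
         (use that soft0[of 0] r in auto)
    then show ?thesis by (auto simp: soft_threshold_def)
  qed
  then show "\<lbrakk>cstar_subalgebra B; x \<in> B\<rbrakk> \<Longrightarrow> soft_threshold r x \<in> B" by blast
  have "cstar_subalgebra (UNIV :: 'a set)" by (simp add: cstar_subalgebra_def complex_vector.subspace_UNIV)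
  then have e: "emb (soft_threshold r x) = cfc (emb x) (soft r)" using mem by blast
  show "norm (x - soft_threshold r x) \<le> r"
    using n unfolding e[symmetric] emb_simps(2)[symmetric] by simp
  assume B: "cstar_subalgebra B" "x \<in> B" and I: "I \<in> closed_ideals B" "infdist x I < r"
  have "I \<noteq> {}" using closed_idealD(1)[OF I(1)] by blast
  then have "cfc (emb x) (soft r) \<in> emb ` I"
    by (intro cfc_soft_mem_ideal[OF cstar_subalgebra_emb[OF B(1)] closed_ideals_emb[OF I(1)] _ ex continuous_soft soft0])
       (use I B in \<open>auto simp: infdist_emb\<close>)
  then show "soft_threshold r x \<in> I" by (auto simp: soft_threshold_def)
qed

lemma infdist_le_of_soft_threshold_mem:
  assumes "star x = x" "0 < r" "soft_threshold r x \<in> I"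
  shows "infdist x I \<le> r"
  using infdist_le[OF assms(3), of x] norm_soft_threshold[OF assms(1,2)] by (simp add: dist_norm)

text \<open>\<open>b = 1 - sqrt (1 - a\<^sup>* a)\<close>; unlike the square root itself, it lies in the algebra.\<close>

lemma exists_one_minus_sqrt:
  fixes a :: "'a::cstar_algebra"
  assumes B: "cstar_subalgebra B" and a: "a \<in> B" "norm a < 1"
  obtains b where "b \<in> B" "star b = b" "star a * a = 2 *\<^sub>R b - b * b"
proof -
  define x where "x = emb (star a * a)"
  have x: "star x = x" by (simp add: x_def emb_simps(6)[symmetric] star_mult star_star)
  have "norm x = (norm a)\<^sup>2" by (simp add: x_def cstar_identity)
  then have nx: "norm x < 1" using a(2) power_strict_mono[of "norm a" 1 2] by simp
  define f where "f t = 1 - sqrt (max 0 (1 - t))" for t :: real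
  have cf: "continuous_on UNIV f" unfolding f_def by (intro continuous_intros)
  have "cfc x f \<in> emb ` B"
    by (rule cfc_mem[OF cstar_subalgebra_emb[OF B] _ x cf])
       (use a cstar_subalgebraD[OF B] in \<open>auto simp: x_def f_def\<close>)
  then obtain b where b: "b \<in> B" "cfc x f = emb b" by blast
  have "emb (star b) = emb b" using cfc_selfadjoint[OF x cf] by (simp add: b emb_simps(6))
  then have sb: "star b = b" by simp
  have cff: "continuous_on UNIV (\<lambda>t. f t * f t)" "continuous_on UNIV (\<lambda>t. 2 * f t)"
    by (intro continuous_on_mult cf continuous_on_const)+
  have "emb (2 *\<^sub>R b - b * b) = cfc x (\<lambda>t. 2 * f t - f t * f t)"
    by (simp add: cfc_diff[OF x cff(2,1)] cfc_cmult[OF x cf] cfc_mult[OF x cf cf] b emb_simps)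
  also have "\<dots> = cfc x (\<lambda>t. t)"
  proof (rule cfc_cong[OF x _ _ nx])
    show "continuous_on UNIV (\<lambda>t. 2 * f t - f t * f t)" by (intro continuous_on_diff cff)
    show "2 * f t - f t * f t = t" if "\<bar>t\<bar> \<le> 1" for t
      using that real_sqrt_mult_self[of "1 - t"] by (simp add: f_def algebra_simps)
  qed (rule continuous_on_id)
  also have "\<dots> = emb (star a * a)" by (simp add: cfc_id[OF x]) (simp add: x_def)
  finally have "star a * a = 2 *\<^sub>R b - b * b" by simp
  then show ?thesis using that b sb by blast
qed

section \<open>Extreme functionals below a sublinear functional\<close>

definition sublinear_on :: "'v::real_vector set \<Rightarrow> ('v \<Rightarrow> real) \<Rightarrow> bool" where
  "sublinear_on V q \<longleftrightarrow> (\<forall>x\<in>V. \<forall>y\<in>V. q (x + y) \<le> q x + q y) \<and>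
     (\<forall>r\<ge>0. \<forall>x\<in>V. q (r *\<^sub>R x) = r * q x)"

definition real_linear_on :: "'v::real_vector set \<Rightarrow> ('v \<Rightarrow> real) \<Rightarrow> bool" where
  "real_linear_on V f \<longleftrightarrow> (\<forall>x\<in>V. \<forall>y\<in>V. f (x + y) = f x + f y) \<and>
     (\<forall>r. \<forall>x\<in>V. f (r *\<^sub>R x) = r * f x)"

text \<open>The linear functionals below \<open>q\<close> form a face of those below \<open>p\<close>. The conclusion for \<open>h\<close> is the one
  for \<open>g\<close> with \<open>1 - t\<close> in place of \<open>t\<close>.\<close>

definition facial_on :: "'v::real_vector set \<Rightarrow> ('v \<Rightarrow> real) \<Rightarrow> ('v \<Rightarrow> real) \<Rightarrow> bool" where
  "facial_on V p q \<longleftrightarrow> (\<forall>g h t. real_linear_on V g \<and> real_linear_on V h \<and> (\<forall>x\<in>V. g x \<le> p x) \<and>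
     (\<forall>x\<in>V. h x \<le> p x) \<and> 0 < t \<and> t < 1 \<and> (\<forall>x\<in>V. t * g x + (1 - t) * h x \<le> q x)
     \<longrightarrow> (\<forall>x\<in>V. g x \<le> q x))"

text \<open>For sublinear \<open>q\<close> and \<open>y \<in> V\<close>, the linear functionals below the tilted functional are those below
  \<open>q\<close> that attain the value \<open>q y\<close> at \<open>y\<close>.\<close>

definition tilt :: "'v::real_vector set \<Rightarrow> ('v \<Rightarrow> real) \<Rightarrow> 'v \<Rightarrow> 'v \<Rightarrow> real" where
  "tilt V q y x = (if x \<in> V then INF s\<in>{0..}. q (x + s *\<^sub>R y) - s * q y else 0)"

definition extreme_below :: "'v::real_vector set \<Rightarrow> ('v \<Rightarrow> real) \<Rightarrow> ('v \<Rightarrow> real) \<Rightarrow> bool" where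
  "extreme_below V p f \<longleftrightarrow> (\<forall>g h t. real_linear_on V g \<and> real_linear_on V h \<and> (\<forall>x\<in>V. g x \<le> p x) \<and>
     (\<forall>x\<in>V. h x \<le> p x) \<and> 0 < t \<and> t < 1 \<and> (\<forall>x\<in>V. f x = t * g x + (1 - t) * h x)
     \<longrightarrow> (\<forall>x\<in>V. g x = f x))"

context
  fixes V :: "'v::real_vector set"
  assumes V: "subspace V"
begin

lemma sublinear_onD:
  assumes "sublinear_on V q" "x \<in> V"
  shows "y \<in> V \<Longrightarrow> q (x + y) \<le> q x + q y" "0 \<le> r \<Longrightarrow> q (r *\<^sub>R x) = r * q x"
    "q 0 = 0" "- q (- x) \<le> q x"
proof -
  show *: "y \<in> V \<Longrightarrow> q (x + y) \<le> q x + q y" "0 \<le> r \<Longrightarrow> q (r *\<^sub>R x) = r * q x" for r y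
    using assms by (auto simp: sublinear_on_def)
  show 0: "q 0 = 0" using *(2)[of 0] by simp
  show "- q (- x) \<le> q x" using *(1)[of "- x"] 0 subspace_neg[OF V assms(2)] by simp
qed

lemma tilt_props:
  assumes q: "sublinear_on V q" and y: "y \<in> V"
  shows sublinear_tilt: "sublinear_on V (tilt V q y)"
    and tilt_upper: "\<And>x s. x \<in> V \<Longrightarrow> 0 \<le> s \<Longrightarrow> tilt V q y x \<le> q (x + s *\<^sub>R y) - s * q y"
    and tilt_greatest: "\<And>x c. x \<in> V \<Longrightarrow> (\<And>s. 0 \<le> s \<Longrightarrow> c \<le> q (x + s *\<^sub>R y) - s * q y) \<Longrightarrow> c \<le> tilt V q y x"
proof -
  note [simp] = subspace_add[OF V] subspace_scale[OF V] subspace_neg[OF V] y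
  have bd: "bdd_below ((\<lambda>s. q (x + s *\<^sub>R y) - s * q y) ` {0..})" if x: "x \<in> V" for x
  proof (rule bdd_belowI2[of _ "- q (- x)"])
    fix s :: real assume s: "s \<in> {0..}"
    have "s * q y = q (- x + (x + s *\<^sub>R y))" using sublinear_onD(2)[OF q y, of s] s by simp
    also have "\<dots> \<le> q (- x) + q (x + s *\<^sub>R y)" using x by (intro sublinear_onD(1)[OF q]) auto
    finally show "- q (- x) \<le> q (x + s *\<^sub>R y) - s * q y" by simp
  qed
  show le: "tilt V q y x \<le> q (x + s *\<^sub>R y) - s * q y" if "x \<in> V" "0 \<le> s" for x s
    using cINF_lower[OF bd[OF that(1)], of s] that by (simp add: tilt_def)
  show gr: "c \<le> tilt V q y x" if "x \<in> V" "\<And>s. 0 \<le> s \<Longrightarrow> c \<le> q (x + s *\<^sub>R y) - s * q y" for x c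
    using that by (auto simp: tilt_def intro!: cINF_greatest)
  have add: "tilt V q y (a + b) \<le> tilt V q y a + tilt V q y b" if ab: "a \<in> V" "b \<in> V" for a b
  proof -
    have "tilt V q y (a + b) \<le> (q (a + s *\<^sub>R y) - s * q y) + (q (b + s' *\<^sub>R y) - s' * q y)"
      if s: "0 \<le> s" "0 \<le> s'" for s s'
    proof -
      have "tilt V q y (a + b) \<le> q ((a + b) + (s + s') *\<^sub>R y) - (s + s') * q y"
        using ab s by (intro le) auto
      also have "(a + b) + (s + s') *\<^sub>R y = (a + s *\<^sub>R y) + (b + s' *\<^sub>R y)"
        by (simp add: scaleR_add_left)
      also have "q \<dots> \<le> q (a + s *\<^sub>R y) + q (b + s' *\<^sub>R y)"
        using ab by (intro sublinear_onD(1)[OF q]) auto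
      finally show ?thesis by (simp add: algebra_simps)
    qed
    then have "tilt V q y (a + b) - (q (b + s' *\<^sub>R y) - s' * q y) \<le> tilt V q y a" if "0 \<le> s'" for s'
      using ab that by (intro gr) (auto simp: algebra_simps)
    then have "tilt V q y (a + b) - tilt V q y a \<le> tilt V q y b"
      using ab by (intro gr) (auto simp: algebra_simps)
    then show ?thesis by simp
  qed
  have sc: "tilt V q y (r *\<^sub>R a) \<le> r * tilt V q y a" if r: "r > 0" and a: "a \<in> V" for r a
  proof -
    have "(1 / r) * tilt V q y (r *\<^sub>R a) \<le> tilt V q y a"
    proof (rule gr[OF a])
      fix s :: real assume s: "0 \<le> s"
      have "tilt V q y (r *\<^sub>R a) \<le> q (r *\<^sub>R a + (r * s) *\<^sub>R y) - (r * s) * q y"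
        using a r s by (intro le) auto
      also have "r *\<^sub>R a + (r * s) *\<^sub>R y = r *\<^sub>R (a + s *\<^sub>R y)" by (simp add: scaleR_add_right)
      also have "q \<dots> = r * q (a + s *\<^sub>R y)" using a r by (intro sublinear_onD(2)[OF q]) auto
      finally show "(1 / r) * tilt V q y (r *\<^sub>R a) \<le> q (a + s *\<^sub>R y) - s * q y"
        using r by (simp add: field_simps)
    qed
    then show ?thesis using r by (simp add: field_simps)
  qed
  have "tilt V q y (r *\<^sub>R a) = r * tilt V q y a" if r: "r \<ge> 0" and a: "a \<in> V" for r a
  proof (cases "r = 0")
    case True
    have "tilt V q y 0 \<le> q (0 + 0 *\<^sub>R y) - 0 * q y" by (rule le) (simp_all add: subspace_0[OF V])
    moreover have "0 \<le> tilt V q y 0"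
      by (rule gr) (simp_all add: subspace_0[OF V] sublinear_onD(2)[OF q y])
    ultimately show ?thesis using True sublinear_onD(3)[OF q y] by simp
  next
    case False
    then have r: "r > 0" using that by simp
    have "tilt V q y ((1 / r) *\<^sub>R (r *\<^sub>R a)) \<le> (1 / r) * tilt V q y (r *\<^sub>R a)"
      using r a by (intro sc) auto
    then show ?thesis using sc[OF r a] r by (simp add: field_simps)
  qed
  then show "sublinear_on V (tilt V q y)" using add by (simp add: sublinear_on_def)
qed

lemma tilt_le: "sublinear_on V q \<Longrightarrow> y \<in> V \<Longrightarrow> x \<in> V \<Longrightarrow> tilt V q y x \<le> q x"
  using tilt_upper[of q y x 0] by simp

lemma tilt_uminus_le: "sublinear_on V q \<Longrightarrow> y \<in> V \<Longrightarrow> tilt V q y (- y) \<le> - q y"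
  using tilt_upper[of q y "- y" 1] subspace_neg[OF V] sublinear_onD(3) by fastforce

text \<open>If a proper convex combination of \<open>g\<close> and \<open>h\<close> lies below the tilted functional, then both
  \<open>g\<close> and \<open>h\<close> attain the value \<open>q y\<close> at \<open>y\<close>, and so they lie below the tilted functional.\<close>

lemma facial_tilt:
  assumes q: "sublinear_on V q" and y: "y \<in> V" and fq: "facial_on V p q"
  shows "facial_on V p (tilt V q y)"
  unfolding facial_on_def
proof (intro allI impI, elim conjE)
  fix g h t
  assume g: "real_linear_on V g" "\<forall>x\<in>V. g x \<le> p x" and h: "real_linear_on V h" "\<forall>x\<in>V. h x \<le> p x"
    and t: "0 < t" "t < 1" and le: "\<forall>x\<in>V. t * g x + (1 - t) * h x \<le> tilt V q y x"
  have leq: "t * g x + (1 - t) * h x \<le> q x" if "x \<in> V" for x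
    using le tilt_le[OF q y that] that by fastforce
  have gq: "g x \<le> q x" if "x \<in> V" for x
    using fq[unfolded facial_on_def, rule_format, of g h t x] g h t leq that by blast
  have hq: "h x \<le> q x" if "x \<in> V" for x
    using fq[unfolded facial_on_def, rule_format, of h g "1 - t" x] g h t leq that
    by (simp add: add.commute)
  have neg: "f (- y) = - f y" if "real_linear_on V f" for f
  proof -
    have "f ((-1) *\<^sub>R y) = (-1) * f y" using that y by (auto simp only: real_linear_on_def)
    then show ?thesis by simp
  qed
  have "t * g (- y) + (1 - t) * h (- y) \<le> - q y"
    using le tilt_uminus_le[OF q y] subspace_neg[OF V y] by fastforce
  then have 1: "q y \<le> t * g y + (1 - t) * h y" using neg[OF g(1)] neg[OF h(1)] by simp
  have "(1 - t) * h y \<le> (1 - t) * q y" using hq[OF y] t by (intro mult_left_mono) auto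
  with 1 have "t * q y \<le> t * g y" by (simp add: algebra_simps)
  then have gy: "g y = q y" using gq[OF y] t by simp
  show "\<forall>x\<in>V. g x \<le> tilt V q y x"
  proof
    fix x assume x: "x \<in> V"
    show "g x \<le> tilt V q y x"
    proof (rule tilt_greatest[OF q y x])
      fix s :: real assume "0 \<le> s"
      have "g (x + s *\<^sub>R y) = g x + s * g y"
        using g(1) x y subspace_scale[OF V y] by (simp add: real_linear_on_def)
      then show "g x \<le> q (x + s *\<^sub>R y) - s * q y"
        using gq[of "x + s *\<^sub>R y"] gy x y subspace_add[OF V x subspace_scale[OF V y]] by simp
    qed
  qed
qed

text \<open>
  This combines the Hahn-Banach and Krein-Milman theorems. Among the sublinear functionals whose
  dominated linear functionals form a face, a minimal one cannot be tilted any further, and so it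
  is linear; the face is then a single point.
\<close>

theorem extreme_dominated_functional:
  fixes p :: "'v \<Rightarrow> real"
  assumes p: "sublinear_on V p" and x0: "x0 \<in> V"
  obtains f where "real_linear_on V f" "\<forall>x\<in>V. f x \<le> p x" "f x0 = p x0"
    "extreme_below V p f"
proof -
  define A where "A = {q. sublinear_on V q \<and> (\<forall>x\<in>V. q x \<le> p x) \<and> (\<forall>x. x \<notin> V \<longrightarrow> q x = 0) \<and>
    facial_on V p q \<and> q (- x0) \<le> - p x0}"
  have p_facial: "facial_on V p p" by (simp add: facial_on_def)
  have tiltA: "tilt V q y \<in> A" if q: "q \<in> A" and y: "y \<in> V" for q y
  proof -
    have sq: "sublinear_on V q" using q by (simp add: A_def)
    have "tilt V q y x \<le> q x" if "x \<in> V" for x using tilt_le[OF sq y that] .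
    then show ?thesis
      using q sublinear_tilt[OF sq y] facial_tilt[OF sq y] subspace_neg[OF V x0]
      by (fastforce simp: A_def tilt_def)
  qed
  have q0: "tilt V p x0 \<in> A"
    using sublinear_tilt[OF p x0] tilt_le[OF p x0] facial_tilt[OF p x0 p_facial] tilt_uminus_le[OF p x0]
    by (auto simp: A_def tilt_def)
  have po: "partial_order_on A (relation_of (\<lambda>a b. b \<le> a) A)"
    by (intro partial_order_on_relation_ofI) auto
  have chain: "\<exists>u\<in>A. \<forall>a\<in>C. u \<le> a" if C: "C \<in> Chains (relation_of (\<lambda>a b. b \<le> a) A)" for C
  proof (cases "C = {}")
    case False
    have CA: "C \<subseteq> A" using C by (auto simp: Chains_def relation_of_def)
    have tot: "a \<le> b \<or> b \<le> a" if "a \<in> C" "b \<in> C" for a b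
      using C that by (auto simp: Chains_def relation_of_def)
    have sC: "sublinear_on V q" if "q \<in> C" for q using CA that by (auto simp: A_def)
    define u where "u x = (INF q\<in>C. q x)" for x
    have bd: "bdd_below ((\<lambda>q. q x) ` C)" for x
    proof (cases "x \<in> V")
      case True
      show ?thesis
      proof (rule bdd_belowI2[of _ "- p (- x)"])
        fix q assume "q \<in> C"
        then have "q (- x) \<le> p (- x)" using CA subspace_neg[OF V True] by (auto simp: A_def)
        then show "- p (- x) \<le> q x" using sublinear_onD(4)[OF sC[OF \<open>q \<in> C\<close>] True] by simp
      qed
    next
      case False
      then show ?thesis using CA by (intro bdd_belowI2[of _ 0]) (auto simp: A_def)
    qed
    have le: "u x \<le> q x" if "q \<in> C" for q x
      unfolding u_def by (rule cINF_lower[OF bd that])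
    have gr: "c \<le> u x" if "\<And>q. q \<in> C \<Longrightarrow> c \<le> q x" for c x
      unfolding u_def using False that by (intro cINF_greatest)
    have add: "u (x + y) \<le> u x + u y" if xy: "x \<in> V" "y \<in> V" for x y
    proof -
      have "u (x + y) \<le> q x + q' y" if qq: "q \<in> C" "q' \<in> C" for q q'
      proof -
        consider "q \<le> q'" | "q' \<le> q" using tot[OF qq] by blast
        then show ?thesis
        proof cases
          case 1
          then show ?thesis using le[OF qq(1), of "x + y"] sublinear_onD(1)[OF sC[OF qq(1)] xy] le_funD[OF 1, of y] by linarith
        next
          case 2
          then show ?thesis using le[OF qq(2), of "x + y"] sublinear_onD(1)[OF sC[OF qq(2)] xy] le_funD[OF 2, of x] by linarith
        qed
      qed
      then have "u (x + y) - q' y \<le> u x" if "q' \<in> C" for q' using that by (intro gr) (simp add: algebra_simps)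
      then have "u (x + y) - u x \<le> u y" by (intro gr) (simp add: algebra_simps)
      then show ?thesis by simp
    qed
    have scl: "u (r *\<^sub>R x) \<le> r * u x" if "r > 0" "x \<in> V" for r x
    proof -
      have "(1 / r) * u (r *\<^sub>R x) \<le> u x"
      proof (rule gr)
        fix q assume "q \<in> C"
        then show "(1 / r) * u (r *\<^sub>R x) \<le> q x"
          using le[of q "r *\<^sub>R x"] sublinear_onD(2)[OF sC that(2), of q r] that by (simp add: field_simps)
      qed
      then show ?thesis using that by (simp add: field_simps)
    qed
    have "u (r *\<^sub>R x) = r * u x" if "r \<ge> 0" "x \<in> V" for r x
    proof (cases "r = 0")
      case True
      obtain q where q: "q \<in> C" using False by blast
      have "u 0 \<le> 0" using le[OF q, of 0] sublinear_onD(3)[OF sC[OF q] that(2)] by simp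
      moreover have "0 \<le> u 0" by (rule gr) (simp add: sublinear_onD(3)[OF sC that(2)])
      ultimately show ?thesis using True by simp
    next
      case False
      then have r: "r > 0" using that by simp
      have "u ((1 / r) *\<^sub>R (r *\<^sub>R x)) \<le> (1 / r) * u (r *\<^sub>R x)"
        using r that subspace_scale[OF V] by (intro scl) auto
      then show ?thesis using scl[OF r that(2)] r by (simp add: field_simps)
    qed
    then have su: "sublinear_on V u" using add by (simp add: sublinear_on_def)
    obtain q where q: "q \<in> C" using False by blast
    have fu: "facial_on V p u"
      unfolding facial_on_def
    proof (intro allI impI ballI, elim conjE)
      fix g h t x
      assume g: "real_linear_on V g" "\<forall>x\<in>V. g x \<le> p x" and h: "real_linear_on V h" "\<forall>x\<in>V. h x \<le> p x"
        and t: "0 < t" "t < 1" and l: "\<forall>x\<in>V. t * g x + (1 - t) * h x \<le> u x" and x: "x \<in> V"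
      show "g x \<le> u x"
      proof (rule gr)
        fix q assume q: "q \<in> C"
        have "\<forall>x\<in>V. t * g x + (1 - t) * h x \<le> q x" 
        proof
          fix x assume "x \<in> V"
          then show "t * g x + (1 - t) * h x \<le> q x" using bspec[OF l, of x] le[OF q, of x] by linarith
        qed
        moreover have "facial_on V p q" using q CA by (auto simp: A_def)
        ultimately show "g x \<le> q x"
          unfolding facial_on_def using g h t x by metis
      qed
    qed
    have "q (- x0) \<le> - p x0" using q CA by (auto simp: A_def)
    then have "u (- x0) \<le> - p x0" using le[OF q, of "- x0"] by linarith
    moreover have "u x = 0" if "x \<notin> V" for x
    proof -
      have "(\<lambda>q. q x) ` C = {0}" using CA that q by (fastforce simp: A_def)
      then show ?thesis by (simp add: u_def)
    qed
    moreover have "\<forall>x\<in>V. u x \<le> p x" 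
    proof
      fix x assume x: "x \<in> V"
      have "q x \<le> p x" using q CA x by (auto simp: A_def)
      then show "u x \<le> p x" using le[OF q, of x] by linarith
    qed
    ultimately have "u \<in> A" using su fu by (simp add: A_def)
    then show ?thesis using le by (auto simp: le_fun_def)
  qed (use q0 in blast)
  have "\<exists>m\<in>A. \<forall>a\<in>A. a \<le> m \<longrightarrow> a = m" by (rule predicate_Zorn[OF po]) (rule chain)
  then obtain q where q: "q \<in> A" and min: "\<And>a. a \<in> A \<Longrightarrow> a \<le> q \<Longrightarrow> a = q" by metis
  have sq: "sublinear_on V q" and qp: "\<And>x. x \<in> V \<Longrightarrow> q x \<le> p x" and fq: "facial_on V p q"
    using q by (auto simp: A_def)
  have neg: "q (- y) = - q y" if y: "y \<in> V" for y
  proof -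
    have "tilt V q y \<le> q"
      using tilt_le[OF sq y] q by (auto simp: le_fun_def A_def tilt_def)
    then have "tilt V q y = q" using min[OF tiltA[OF q y]] by blast
    then have "q (- y) \<le> - q y" using tilt_uminus_le[OF sq y] by simp
    then show ?thesis using sublinear_onD(4)[OF sq y] by simp
  qed
  have lin: "real_linear_on V q"
    unfolding real_linear_on_def
  proof (intro conjI ballI allI)
    fix x y assume xy: "x \<in> V" "y \<in> V"
    have "q (- x + - y) \<le> q (- x) + q (- y)"
      using xy subspace_neg[OF V] by (intro sublinear_onD(1)[OF sq]) auto
    moreover have "q (- x + - y) = - q (x + y)"
      using neg[of "x + y"] xy subspace_add[OF V] by (simp add: algebra_simps)
    ultimately show "q (x + y) = q x + q y"
      using sublinear_onD(1)[OF sq xy] neg xy by fastforce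
  next
    fix r x assume x: "x \<in> V"
    show "q (r *\<^sub>R x) = r * q x"
    proof (cases "r \<ge> 0")
      case False
      have "q ((- r) *\<^sub>R x) = (- r) * q x" using False x by (intro sublinear_onD(2)[OF sq]) auto
      then show ?thesis using neg[of "r *\<^sub>R x"] subspace_scale[OF V x] by simp
    qed (rule sublinear_onD(2)[OF sq x])
  qed
  have "q (- x0) \<le> - p x0" using q by (simp add: A_def)
  then have att: "q x0 = p x0" using neg[OF x0] qp[OF x0] by simp
  have ext: "\<forall>x\<in>V. g x = q x"
    if g: "real_linear_on V g" "\<forall>x\<in>V. g x \<le> p x" and h: "real_linear_on V h" "\<forall>x\<in>V. h x \<le> p x"
      and t: "0 < t" "t < 1" and eq: "\<forall>x\<in>V. q x = t * g x + (1 - t) * h x" for g h t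
  proof
    fix x assume x: "x \<in> V"
    have le: "g x \<le> q x" if "x \<in> V" for x
      using fq[unfolded facial_on_def, rule_format, of g h t x] g h t eq that by simp
    have "g ((-1) *\<^sub>R x) = (-1) * g x" using g(1) x by (auto simp only: real_linear_on_def)
    then have "- g x \<le> - q x" using le[of "- x"] neg[OF x] subspace_neg[OF V x] by simp
    then show "g x = q x" using le[OF x] by simp
  qed
  show thesis
  proof (rule that)
    show "extreme_below V p q" unfolding extreme_below_def
      by (intro allI impI, elim conjE, rule ext)
  qed (use lin qp att in auto)
qed

end

section \<open>States\<close>

locale algebra_state =
  fixes D :: "'a::{cstar_algebra,real_normed_algebra_1} set" and \<Phi> :: "'a \<Rightarrow> complex"
  assumes D: "cstar_subalgebra D" and one_mem: "1 \<in> D"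
    and add: "x \<in> D \<Longrightarrow> y \<in> D \<Longrightarrow> \<Phi> (x + y) = \<Phi> x + \<Phi> y"
    and scale: "x \<in> D \<Longrightarrow> \<Phi> (c *\<^sub>C x) = c * \<Phi> x"
    and hermitian: "x \<in> D \<Longrightarrow> \<Phi> (star x) = cnj (\<Phi> x)"
    and positive: "x \<in> D \<Longrightarrow> 0 \<le> Re (\<Phi> (star x * x))"
    and one: "\<Phi> 1 = 1"
begin

lemmas mem = cstar_subalgebraD[OF D]

lemma zero: "\<Phi> 0 = 0"
  using scale[of 0 0] mem by simp

lemma diff: "x \<in> D \<Longrightarrow> y \<in> D \<Longrightarrow> \<Phi> (x - y) = \<Phi> x - \<Phi> y"
  using add[of x "(-1) *\<^sub>C y"] scale[of y "-1"] mem by (simp add: scaleC_minus_left scaleC_one)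

lemma scaleR: "x \<in> D \<Longrightarrow> \<Phi> (r *\<^sub>R x) = complex_of_real r * \<Phi> x"
  by (simp add: scaleR_scaleC scale)

lemma star_square_real: "x \<in> D \<Longrightarrow> \<Phi> (star x * x) = complex_of_real (Re (\<Phi> (star x * x)))"
  using hermitian[of "star x * x"] mem by (simp add: star_mult star_star complex_eq_iff)

lemma cauchy_schwarz:
  assumes u: "u \<in> D" and v: "v \<in> D"
  shows "(cmod (\<Phi> (star v * u)))\<^sup>2 \<le> Re (\<Phi> (star u * u)) * Re (\<Phi> (star v * v))"
proof -
  define w where "w = \<Phi> (star v * u)"
  define A where "A = Re (\<Phi> (star u * u))"
  define C where "C = Re (\<Phi> (star v * v))"
  note [simp] = mem u v
  have uv: "\<Phi> (star u * v) = cnj w"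
    using hermitian[of "star v * u"] by (simp add: star_mult star_star w_def)
  have svv: "\<Phi> (star v * v) = complex_of_real C" unfolding C_def by (rule star_square_real[OF v])
  have key: "0 \<le> A - 2 * r * (cmod w)\<^sup>2 + r\<^sup>2 * (cmod w)\<^sup>2 * C" for r
  proof -
    define c where "c = complex_of_real r * w"
    have "\<Phi> (star (u - c *\<^sub>C v) * (u - c *\<^sub>C v)) =
      \<Phi> (star u * u - c *\<^sub>C (star u * v) - (cnj c *\<^sub>C (star v * u) - (cnj c * c) *\<^sub>C (star v * v)))"
      by (simp add: star_diff star_scaleC algebra_simps mult_scaleC_left mult_scaleC_right scaleC_scaleC)
    also have "\<dots> = \<Phi> (star u * u) - c * cnj w - (cnj c * w - (cnj c * c) * \<Phi> (star v * v))"
      by (simp add: diff scale uv w_def)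
    also have "Re \<dots> = A - 2 * r * (cmod w)\<^sup>2 + r\<^sup>2 * (cmod w)\<^sup>2 * C"
      unfolding svv c_def cmod_power2 A_def
      by (simp add: power2_eq_square algebra_simps)
    finally show ?thesis using positive[of "u - c *\<^sub>C v"] by simp
  qed
  have A: "A \<ge> 0" and C: "C \<ge> 0" using positive by (simp_all add: A_def C_def)
  have "(cmod w)\<^sup>2 \<le> A * C"
  proof (cases "C = 0")
    case True
    have "w = 0"
    proof (rule ccontr)
      assume "w \<noteq> 0"
      then have "2 * ((A + 1) / (cmod w)\<^sup>2) * (cmod w)\<^sup>2 = 2 * (A + 1)" by simp
      then show False using key[of "(A + 1) / (cmod w)\<^sup>2"] True A by simp
    qed
    then show ?thesis using True by simp
  next
    case False
    then have C: "C > 0" using C by simp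
    have "A - 2 * (1 / C) * (cmod w)\<^sup>2 + (1 / C)\<^sup>2 * (cmod w)\<^sup>2 * C = A - (cmod w)\<^sup>2 / C"
      using C by (simp add: power2_eq_square field_simps)
    then have "(cmod w)\<^sup>2 / C \<le> A" using key[of "1 / C"] by simp
    then show ?thesis using C by (simp add: divide_le_eq)
  qed
  then show ?thesis by (simp add: w_def A_def C_def)
qed

text \<open>For \<open>K > norm b ^ 2\<close> the element \<open>K - b\<^sup>* b\<close> is a square \<open>y\<^sup>2\<close> with \<open>y\<close> in \<open>D\<close>, and
  \<open>a\<^sup>* y\<^sup>2 a = (y a)\<^sup>* (y a)\<close>.\<close>

lemma mult_left_bound:
  assumes a: "a \<in> D" and b: "b \<in> D"
  shows "Re (\<Phi> (star (b * a) * (b * a))) \<le> (norm b)\<^sup>2 * Re (\<Phi> (star a * a))"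
proof (rule field_le_epsilon)
  fix e :: real assume e: "0 < e"
  define x where "x = star b * b"
  define q where "q = Re (\<Phi> (star a * a))"
  define K where "K = (norm b)\<^sup>2 + e / (q + 1)"
  have q: "q \<ge> 0" using positive[OF a] by (simp add: q_def)
  have x: "star x = x" "x \<in> D" using b mem by (simp_all add: x_def star_mult star_star)
  have K: "norm x < K" using e q by (simp add: x_def K_def cstar_identity add_nonneg_pos)
  define y where "y = cfc x (\<lambda>t. sqrt (max 0 (K - t)))"
  have y: "star y = y" "y * y = K *\<^sub>R 1 - x"
    using exists_sqrt_scalar_minus[OF x(1) K] by (simp_all add: y_def)
  have yD: "y \<in> D" unfolding y_def
    by (rule cfc_mem[OF D x(2,1)]) (auto intro!: continuous_intros one_mem)
  have "star (y * a) * (y * a) = star a * (y * y) * a" by (simp add: star_mult y(1) mult.assoc)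
  also have "\<dots> = K *\<^sub>R (star a * a) - star (b * a) * (b * a)"
    unfolding y(2) by (simp add: x_def star_mult algebra_simps)
  finally have "Re (\<Phi> (star (b * a) * (b * a))) \<le> K * q"
    using positive[of "y * a"] a b yD mem by (simp add: diff scaleR q_def)
  also have "K * q \<le> (norm b)\<^sup>2 * q + e" using e q by (simp add: K_def field_simps)
  finally show "Re (\<Phi> (star (b * a) * (b * a))) \<le> (norm b)\<^sup>2 * Re (\<Phi> (star a * a)) + e" by (simp add: q_def)
qed

lemma cmod_le_norm:
  assumes "x \<in> D" shows "cmod (\<Phi> x) \<le> norm x"
proof -
  have "(cmod (\<Phi> x))\<^sup>2 \<le> Re (\<Phi> (star x * x))"
    using cauchy_schwarz[OF assms one_mem] by (simp add: one)
  also have "\<dots> \<le> (norm x)\<^sup>2" using mult_left_bound[OF one_mem assms] by (simp add: one)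
  finally show ?thesis by (rule power2_le_imp_le) simp
qed

end

definition extreme_state :: "'a::{cstar_algebra,real_normed_algebra_1} set \<Rightarrow> 'a set \<Rightarrow> ('a \<Rightarrow> complex) \<Rightarrow> bool" where
  "extreme_state D L \<Phi> \<longleftrightarrow> (\<forall>\<Psi> \<Psi>' t. algebra_state D \<Psi> \<and> algebra_state D \<Psi>' \<and> (\<forall>l\<in>L. \<Psi> l = 0) \<and>
     (\<forall>l\<in>L. \<Psi>' l = 0) \<and> 0 < t \<and> t < 1 \<and>
     (\<forall>x\<in>D. \<Phi> x = complex_of_real t * \<Psi> x + complex_of_real (1 - t) * \<Psi>' x)
     \<longrightarrow> (\<forall>x\<in>D. \<Psi> x = \<Phi> x))"

definition selfadjoint_part :: "'a::cstar_algebra \<Rightarrow> 'a" where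
  "selfadjoint_part x = (1/2) *\<^sub>R (x + star x)"

definition imaginary_part :: "'a::cstar_algebra \<Rightarrow> 'a" where
  "imaginary_part x = (- \<i> / 2) *\<^sub>C (x - star x)"

lemma parts:
  shows selfadjoint_part_eq: "star h = h \<Longrightarrow> star k = k \<Longrightarrow> selfadjoint_part (h + \<i> *\<^sub>C k) = h"
    and imaginary_part_eq: "star h = h \<Longrightarrow> star k = k \<Longrightarrow> imaginary_part (h + \<i> *\<^sub>C k) = k"
    and star_selfadjoint_part: "star (selfadjoint_part x) = selfadjoint_part x"
    and star_imaginary_part: "star (imaginary_part x) = imaginary_part x"
    and parts_decomposition: "x = selfadjoint_part x + \<i> *\<^sub>C imaginary_part x"
proof -
  assume hk: "star h = h" "star k = k"
  have "h + \<i> *\<^sub>C k + star (h + \<i> *\<^sub>C k) = 2 *\<^sub>R h"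
    by (simp add: star_add star_scaleC hk scaleC_minus_left scaleR_2)
  then show "selfadjoint_part (h + \<i> *\<^sub>C k) = h" by (simp add: selfadjoint_part_def)
  have "\<i> *\<^sub>C k + \<i> *\<^sub>C k = (2 * \<i>) *\<^sub>C k"
    unfolding scaleC_add_left[symmetric] by (simp only: mult_2)
  then have "h + \<i> *\<^sub>C k - star (h + \<i> *\<^sub>C k) = (2 * \<i>) *\<^sub>C k"
    by (simp add: star_add star_scaleC hk scaleC_minus_left)
  then show "imaginary_part (h + \<i> *\<^sub>C k) = k"
    by (simp only: imaginary_part_def scaleC_scaleC) (simp add: scaleC_one)
next
  show "star (selfadjoint_part x) = selfadjoint_part x" "star (imaginary_part x) = imaginary_part x"
    by (simp_all add: selfadjoint_part_def imaginary_part_def star_add star_diff star_scaleR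
        star_scaleC star_star add.commute scaleC_diff_right scaleC_minus_left)
  have "\<i> *\<^sub>C imaginary_part x = (1/2) *\<^sub>R (x - star x)"
    by (simp add: imaginary_part_def scaleC_scaleC scaleR_scaleC)
  then have "selfadjoint_part x + \<i> *\<^sub>C imaginary_part x = (1/2) *\<^sub>R ((x + star x) + (x - star x))"
    by (simp only: selfadjoint_part_def scaleR_add_right)
  also have "(x + star x) + (x - star x) = 2 *\<^sub>R x" by (simp add: scaleR_2)
  finally show "x = selfadjoint_part x + \<i> *\<^sub>C imaginary_part x" by simp
qed

lemma sublinear_on_infdist:
  assumes L: "subspace (L :: 'a::real_normed_vector set)"
  shows "sublinear_on V (\<lambda>x. infdist x L)"
  unfolding sublinear_on_def
proof (intro conjI ballI allI impI)
  have ne: "L \<noteq> {}" using subspace_0[OF L] by blast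
  show "infdist (x + y) L \<le> infdist x L + infdist y L" for x y
  proof (rule field_le_epsilon)
    fix e :: real assume e: "0 < e"
    obtain l where l: "l \<in> L" "norm (x - l) < infdist x L + e / 2"
      using infdist_less_obtains[of x L "infdist x L + e / 2"] e ne by auto
    obtain m where m: "m \<in> L" "norm (y - m) < infdist y L + e / 2"
      using infdist_less_obtains[of y L "infdist y L + e / 2"] e ne by auto
    have "infdist (x + y) L \<le> norm (x + y - (l + m))"
      using infdist_le[OF subspace_add[OF L l(1) m(1)]] by (simp add: dist_norm)
    also have "\<dots> \<le> norm (x - l) + norm (y - m)"
      using norm_triangle_ineq[of "x - l" "y - m"] by (simp add: algebra_simps)
    finally show "infdist (x + y) L \<le> infdist x L + infdist y L + e" using l m by simp
  qed
  have le: "infdist (r *\<^sub>R x) L \<le> r * infdist x L" if r: "r > 0" for r x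
  proof (rule field_le_epsilon)
    fix e :: real assume e: "0 < e"
    obtain l where l: "l \<in> L" "norm (x - l) < infdist x L + e / r"
      using infdist_less_obtains[of x L "infdist x L + e / r"] e r ne by auto
    have "infdist (r *\<^sub>R x) L \<le> norm (r *\<^sub>R x - r *\<^sub>R l)"
      using infdist_le[OF subspace_scale[OF L l(1)]] by (simp add: dist_norm)
    also have "\<dots> = r * norm (x - l)" using r by (simp flip: scaleR_diff_right)
    also have "\<dots> \<le> r * (infdist x L + e / r)" using l r by (intro mult_left_mono) auto
    finally show "infdist (r *\<^sub>R x) L \<le> r * infdist x L + e" using r by (simp add: algebra_simps)
  qed
  show "infdist (r *\<^sub>R x) L = r * infdist x L" if "0 \<le> r" for r x
  proof (cases "r = 0")
    case True
    then show ?thesis using subspace_0[OF L] by simp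
  next
    case False
    then have r: "r > 0" using that by simp
    have "infdist ((1 / r) *\<^sub>R (r *\<^sub>R x)) L \<le> (1 / r) * infdist (r *\<^sub>R x) L"
      using r by (intro le) auto
    then show ?thesis using le[OF r, of x] r by (simp add: field_simps)
  qed
qed

lemma closed_ideal_subspace: "L \<in> closed_ideals B \<Longrightarrow> subspace L"
  using closed_idealD[of L B] by (auto simp: subspace_def)

text \<open>
  If the distance of \<open>y\<^sup>2 + 1\<close> to \<open>L\<close> is less than \<open>R\<close>, then its soft threshold by \<open>R\<close> lies in \<open>L\<close>.
  For \<open>R \<ge> 1\<close> this threshold is within \<open>R - 1\<close> of \<open>y\<^sup>2\<close>, because \<open>y\<^sup>2\<close> is positive.
\<close>

lemma infdist_square_plus_one:
  fixes y :: "'a::{cstar_algebra,real_normed_algebra_1}"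
  assumes D: "cstar_subalgebra D" "1 \<in> D" and L: "L \<in> closed_ideals D"
    and y: "y \<in> D" "star y = y" and d: "infdist (y * y) L > 0"
  shows "infdist (y * y + 1) L \<ge> infdist (y * y) L + 1"
proof (rule ccontr)
  assume "\<not> ?thesis"
  then have lt: "infdist (y * y + 1) L < infdist (y * y) L + 1" by simp
  \<comment> \<open>As \<open>d > 0\<close>, the gap above the distance of \<open>y\<^sup>2 + 1\<close> contains a number \<open>R \<ge> 1\<close>.\<close>
  define R where "R = max 1 ((infdist (y * y + 1) L + (infdist (y * y) L + 1)) / 2)"
  have R: "1 \<le> R" "infdist (y * y + 1) L < R" "R < infdist (y * y) L + 1"
    using lt d by (auto simp: R_def less_max_iff_disj)
  have s: "star (y * y + 1) = y * y + 1" "y * y + 1 \<in> D"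
    using y D cstar_subalgebraD[OF D(1)] by (simp_all add: star_add star_mult)
  have cs: "continuous_on UNIV (\<lambda>t. soft R (t * t + 1))"
    using continuous_on_compose2[OF continuous_soft[of R], of UNIV "\<lambda>t. t * t + 1"]
    by (simp add: continuous_intros)
  have ct: "continuous_on UNIV (\<lambda>t::real. t * t + 1)" "continuous_on UNIV (\<lambda>t::real. t * t)"
    by (intro continuous_intros)+
  have m: "cfc (y * y + 1) (soft R) \<in> L"
    by (rule cfc_soft_mem_ideal[OF D(1) L s(2,1) continuous_soft _ R(2)]) (auto simp: soft_def)
  have yy: "y * y = cfc y (\<lambda>t. t * t)"
    by (simp add: cfc_mult[OF y(2) continuous_on_id continuous_on_id] cfc_id[OF y(2)])
  have yy1: "y * y + 1 = cfc y (\<lambda>t. t * t + 1)"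
    by (simp add: cfc_add[OF y(2) ct(2) continuous_on_const] cfc_const[OF y(2)] yy)
  have "y * y - cfc (y * y + 1) (soft R) = cfc y (\<lambda>t. t * t - soft R (t * t + 1))"
    unfolding yy1 cfc_compose[OF y(2) continuous_soft ct(1)]
    by (simp add: cfc_diff[OF y(2) ct(2) cs] yy)
  also have "norm \<dots> \<le> R - 1"
  proof (rule norm_cfc_le[OF y(2) _ less_add_one])
    show "continuous_on UNIV (\<lambda>t. t * t - soft R (t * t + 1))" by (intro continuous_on_diff ct cs)
    have "\<bar>u - soft R (u + 1)\<bar> \<le> R - 1" if "0 \<le> u" for u
      using that R(1) by (auto simp: soft_def max_def min_def abs_le_iff)
    then show "\<bar>t * t - soft R (t * t + 1)\<bar> \<le> R - 1" for t by simp
  qed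
  finally have "infdist (y * y) L \<le> R - 1" using infdist_le[OF m, of "y * y"] by (simp add: dist_norm)
  then show False using R(3) by simp
qed

text \<open>After scaling \<open>b\<close> to norm at most one, \<open>1 - f (b\<^sup>* b) = f (1 - b\<^sup>* b) \<le> norm (1 - b\<^sup>* b) \<le> 1\<close>.\<close>

lemma functional_positive:
  fixes b :: "'a::{cstar_algebra,real_normed_algebra_1}"
  assumes D: "cstar_subalgebra D" "1 \<in> D" and V: "V = {x\<in>D. star x = x}"
    and lin: "real_linear_on V f" and le: "\<And>x. x \<in> V \<Longrightarrow> f x \<le> norm x" and one: "f 1 = 1" and b: "b \<in> D"
  shows "0 \<le> f (star b * b)"
proof -
  define r where "r = 1 / (norm b + 1)"
  have r: "r > 0" by (simp add: r_def add_nonneg_pos)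
  define c where "c = r *\<^sub>R b"
  have nc: "norm c \<le> 1" by (simp add: c_def r_def) (simp add: divide_le_eq add_nonneg_pos)
  note mem = cstar_subalgebraD[OF D(1)]
  have m: "star b * b \<in> V" "star c * c \<in> V" "1 \<in> V" "1 - star c * c \<in> V"
    using b mem D(2) by (auto simp: V c_def star_mult star_star star_diff star_scaleR)
  have "f (1 - star c * c) \<le> 1" using le[OF m(4)] norm_one_minus_star_mult_le[OF nc] by simp
  moreover have "f 1 = f (1 - star c * c) + f (star c * c)"
    using lin m unfolding real_linear_on_def by (metis diff_add_cancel)
  ultimately have "0 \<le> f (star c * c)" using one by simp
  also have "star c * c = (r * r) *\<^sub>R (star b * b)" by (simp add: c_def star_scaleR)
  also have "f \<dots> = (r * r) * f (star b * b)" using lin m(1) by (simp only: real_linear_on_def)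
  finally show ?thesis using mult_pos_pos[OF r r] by (auto simp: zero_le_mult_iff)
qed

text \<open>
  A functional on the self-adjoint part that lies below the distance to \<open>L\<close> vanishes on \<open>L\<close> and has
  norm at most one. Demanding the largest possible value at \<open>y\<^sup>2 + 1\<close> forces the largest possible
  values at \<open>y\<^sup>2\<close> and at \<open>1\<close>, so that the functional is a state. Conversely the real parts of
  states vanishing on \<open>L\<close> lie below the distance, and so extremality carries over to states.
\<close>

theorem exists_extreme_state:
  fixes y :: "'a::{cstar_algebra,real_normed_algebra_1}"
  assumes D: "cstar_subalgebra D" "1 \<in> D" and L: "L \<in> closed_ideals D"
    and y: "y \<in> D" "star y = y" and d: "infdist (y * y) L > 0"
  obtains \<Phi> where "algebra_state D \<Phi>" "\<forall>l\<in>L. \<Phi> l = 0" "Re (\<Phi> (y * y)) = infdist (y * y) L"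
    "extreme_state D L \<Phi>"
proof -
  define V where "V = {x\<in>D. star x = x}"
  note mem = cstar_subalgebraD[OF D(1)]
  have V: "subspace V"
    using mem by (auto simp: V_def subspace_def star_add star_scaleR)
  have yV: "y * y + 1 \<in> V" "y * y \<in> V" "1 \<in> V" "0 \<in> V"
    using y D mem by (auto simp: V_def star_add star_mult)
  have partV: "selfadjoint_part x \<in> V" "imaginary_part x \<in> V" if "x \<in> D" for x
    using that mem by (auto simp: V_def star_selfadjoint_part star_imaginary_part)
      (auto simp: selfadjoint_part_def imaginary_part_def)
  define p where "p x = infdist x L" for x
  have L0: "0 \<in> L" using closed_idealD[OF L] by blast
  have p_norm: "p x \<le> norm x" for x using infdist_le[OF L0, of x] by (simp add: p_def dist_norm)
  have sub: "sublinear_on V p"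
    unfolding p_def by (rule sublinear_on_infdist[OF closed_ideal_subspace[OF L]])
  obtain f where f: "real_linear_on V f" "\<forall>x\<in>V. f x \<le> p x" "f (y * y + 1) = p (y * y + 1)"
    and ext: "extreme_below V p f"
    by (rule extreme_dominated_functional[OF V sub yV(1)]) (rule that)
  have fadd: "f (a + b) = f a + f b" if "a \<in> V" "b \<in> V" for a b
    using f(1) that by (auto simp: real_linear_on_def)
  have fsc: "f (r *\<^sub>R a) = r * f a" if "a \<in> V" for a r
    using f(1) that by (auto simp: real_linear_on_def)
  have "f (y * y) + f 1 \<ge> infdist (y * y) L + 1"
    using infdist_square_plus_one[OF D L y d] f(3) fadd[OF yV(2,3)] by (simp add: p_def)
  moreover have "f (y * y) \<le> infdist (y * y) L" "f 1 \<le> 1"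
    using bspec[OF f(2) yV(2)] bspec[OF f(2) yV(3)] p_norm[of 1] by (simp_all add: p_def)
  ultimately have fy: "f (y * y) = infdist (y * y) L" and f1: "f 1 = 1" by linarith+
  define \<Phi> where "\<Phi> x = Complex (f (selfadjoint_part x)) (f (imaginary_part x))" for x
  have \<Phi>V: "\<Phi> (h + \<i> *\<^sub>C k) = Complex (f h) (f k)" if "h \<in> V" "k \<in> V" for h k
    using that by (simp add: \<Phi>_def V_def selfadjoint_part_eq imaginary_part_eq)
  have f0: "f 0 = 0" using fsc[OF yV(4), of 0] by simp
  have \<Phi>h: "\<Phi> h = complex_of_real (f h)" if "h \<in> V" for h
    using \<Phi>V[OF that yV(4)] f0 by (simp add: complex_eq_iff)
  note Vadd = subspace_add[OF V] and Vsc = subspace_scale[OF V] and Vdiff = subspace_diff[OF V]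
  have st: "algebra_state D \<Phi>"
  proof (rule algebra_state.intro[OF D])
    fix a b assume ab: "a \<in> D" "b \<in> D"
    define h k h' k' where "h = selfadjoint_part a" and "k = imaginary_part a"
      and "h' = selfadjoint_part b" and "k' = imaginary_part b"
    have m: "h \<in> V" "k \<in> V" "h' \<in> V" "k' \<in> V" using partV ab by (auto simp: h_def k_def h'_def k'_def)
    have a: "a = h + \<i> *\<^sub>C k" and b: "b = h' + \<i> *\<^sub>C k'"
      using parts_decomposition by (auto simp: h_def k_def h'_def k'_def)
    have e: "a + b = (h + h') + \<i> *\<^sub>C (k + k')" unfolding a b scaleC_add_right by simp
    show "\<Phi> (a + b) = \<Phi> a + \<Phi> b"
      unfolding e \<Phi>V[OF Vadd[OF m(1,3)] Vadd[OF m(2,4)]]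
      unfolding a b \<Phi>V[OF m(1,2)] \<Phi>V[OF m(3,4)] by (simp add: fadd m complex_eq_iff)
  next
    fix a c assume ab: "a \<in> D"
    define h k where "h = selfadjoint_part a" and "k = imaginary_part a"
    have m: "h \<in> V" "k \<in> V" using partV ab by (auto simp: h_def k_def)
    have a: "a = h + \<i> *\<^sub>C k" using parts_decomposition by (auto simp: h_def k_def)
    have ce: "c = complex_of_real (Re c) + \<i> * complex_of_real (Im c)" by (simp add: complex_eq_iff)
    have e: "c *\<^sub>C a = (Re c *\<^sub>R h + (- Im c) *\<^sub>R k) + \<i> *\<^sub>C (Im c *\<^sub>R h + Re c *\<^sub>R k)"
    proof -
      have cs: "c *\<^sub>C x = Re c *\<^sub>R x + Im c *\<^sub>R (\<i> *\<^sub>C x)" for x :: 'a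
        by (subst ce) (simp only: scaleC_add_left scaleR_scaleC scaleC_scaleC mult.commute)
      show ?thesis unfolding a scaleC_add_right cs[of h] cs[of "\<i> *\<^sub>C k"]
        by (simp add: scaleC_scaleC scaleR_scaleC scaleC_minus_left mult.commute)
    qed
    show "\<Phi> (c *\<^sub>C a) = c * \<Phi> a"
      unfolding e \<Phi>V[OF Vadd[OF Vsc[OF m(1)] Vsc[OF m(2)]] Vadd[OF Vsc[OF m(1)] Vsc[OF m(2)]]]
      unfolding a \<Phi>V[OF m] fadd[OF Vsc[OF m(1)] Vsc[OF m(2)]] fsc[OF m(1)] fsc[OF m(2)]
      by (simp add: complex_eq_iff)
  next
    fix a assume ab: "a \<in> D"
    define h k where "h = selfadjoint_part a" and "k = imaginary_part a"
    have m: "h \<in> V" "k \<in> V" using partV ab by (auto simp: h_def k_def)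
    have a: "a = h + \<i> *\<^sub>C k" using parts_decomposition by (auto simp: h_def k_def)
    have e: "star a = h + \<i> *\<^sub>C ((-1) *\<^sub>R k)"
      using m unfolding a by (simp add: star_add star_scaleC V_def scaleC_minus_left scaleC_minus_right)
    show "\<Phi> (star a) = cnj (\<Phi> a)"
      unfolding e \<Phi>V[OF m(1) Vsc[OF m(2)]] fsc[OF m(2)] unfolding a \<Phi>V[OF m] by (simp add: complex_eq_iff)
  next
    fix a assume a: "a \<in> D"
    have "star a * a \<in> V" using a mem by (simp add: V_def star_mult star_star)
    moreover have "0 \<le> f (star a * a)"
      by (rule functional_positive[OF D V_def f(1) _ f1 a]) (rule order_trans[OF bspec[OF f(2)] p_norm])
    ultimately show "0 \<le> Re (\<Phi> (star a * a))" by (simp add: \<Phi>h)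
  next
    show "\<Phi> 1 = 1" using \<Phi>h[OF yV(3)] f1 by simp
  qed
  have van: "\<Phi> l = 0" if l: "l \<in> L" for l
  proof -
    have sl: "star l \<in> L" using closed_ideal_star[OF D(1) L l] .
    have LL: "selfadjoint_part l \<in> L" "imaginary_part l \<in> L"
      using l sl closed_idealD[OF L] by (auto simp: selfadjoint_part_def imaginary_part_def)
    have fz: "f h = 0" if h: "h \<in> L" "h \<in> V" for h
    proof -
      have "f h \<le> 0" using bspec[OF f(2) h(2)] h(1) by (simp add: p_def)
      moreover have "f ((-1) *\<^sub>R h) \<le> 0"
        using bspec[OF f(2) Vsc[OF h(2), of "-1"]] closed_idealD(10)[OF L h(1)] by (simp add: p_def)
      ultimately show ?thesis using fsc[OF h(2), of "-1"] by simp
    qed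
    have "l \<in> D" using closed_idealD(9)[OF L l] .
    then show ?thesis using fz[OF LL(1)] fz[OF LL(2)] partV by (simp add: \<Phi>_def complex_eq_iff)
  qed
  have ext': "\<forall>x\<in>D. \<Psi> x = \<Phi> x"
    if s: "algebra_state D \<Psi>" "algebra_state D \<Psi>'" and z: "\<forall>l\<in>L. \<Psi> l = 0" "\<forall>l\<in>L. \<Psi>' l = 0"
       and t: "0 < t" "t < 1"
       and eq: "\<forall>x\<in>D. \<Phi> x = complex_of_real t * \<Psi> x + complex_of_real (1 - t) * \<Psi>' x"
    for \<Psi> \<Psi>' t
  proof
    fix x assume x: "x \<in> D"
    have lin: "real_linear_on V (\<lambda>x. Re (\<Psi> x))" if "algebra_state D \<Psi>" for \<Psi>
      using algebra_state.add[OF that] algebra_state.scaleR[OF that]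
      by (auto simp: real_linear_on_def V_def)
    have le: "Re (\<Psi> x) \<le> p x" if "algebra_state D \<Psi>" "\<forall>l\<in>L. \<Psi> l = 0" "x \<in> V" for \<Psi> x
    proof -
      have "Re (\<Psi> x) \<le> norm (x - l)" if l: "l \<in> L" for l
      proof -
        have lD: "l \<in> D" using closed_idealD(9)[OF L l] .
        have "\<Psi> x = \<Psi> (x - l)"
          using algebra_state.diff[OF \<open>algebra_state D \<Psi>\<close> _ lD, of x] \<open>x \<in> V\<close> bspec[OF \<open>\<forall>l\<in>L. \<Psi> l = 0\<close> l]
          by (simp add: V_def)
        then show ?thesis
          using algebra_state.cmod_le_norm[OF \<open>algebra_state D \<Psi>\<close>, of "x - l"] complex_Re_le_cmod[of "\<Psi> (x - l)"]
            \<open>x \<in> V\<close> lD mem by (simp add: V_def)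
      qed
      moreover have "L \<noteq> {}" using L0 by blast
      ultimately show ?thesis unfolding p_def infdist_notempty[OF \<open>L \<noteq> {}\<close>] dist_norm
        by (intro cINF_greatest)
    qed
    have feq: "f x = t * Re (\<Psi> x) + (1 - t) * Re (\<Psi>' x)" if "x \<in> V" for x
      using arg_cong[OF bspec[OF eq, of x], of Re] that \<Phi>h[OF that] by (simp add: V_def)
    have gV: "Re (\<Psi> x) = f x" if xV: "x \<in> V" for x
    proof -
      have "\<forall>x\<in>V. Re (\<Psi> x) = f x"
        by (rule ext[unfolded extreme_below_def, rule_format, of "\<lambda>x. Re (\<Psi> x)" "\<lambda>x. Re (\<Psi>' x)" t, THEN ballI])
          (intro conjI ballI lin le s z t feq; assumption)+
      then show ?thesis using xV by blast
    qed
    have V\<Psi>: "\<Psi> h = \<Phi> h" if "h \<in> V" for h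
    proof -
      have "Im (\<Psi> h) = 0"
        using algebra_state.hermitian[OF s(1), of h] that by (simp add: V_def complex_eq_iff)
      then show ?thesis using gV[OF that] \<Phi>h[OF that] by (simp add: complex_eq_iff)
    qed
    have m: "selfadjoint_part x \<in> V" "imaginary_part x \<in> V" using partV x by auto
    then have mD: "selfadjoint_part x \<in> D" "imaginary_part x \<in> D" by (auto simp: V_def)
    have "\<Psi> x = \<Psi> (selfadjoint_part x) + \<i> * \<Psi> (imaginary_part x)" if "algebra_state D \<Psi>" for \<Psi>
      using algebra_state.add[OF that mD(1) mem(4)[OF mD(2)]] algebra_state.scale[OF that mD(2)]
      by (subst parts_decomposition[of x]) simp
    from this[OF s(1)] this[OF st] show "\<Psi> x = \<Phi> x" using V\<Psi> m by simp
  qed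
  have re: "Re (\<Phi> (y * y)) = infdist (y * y) L" by (simp add: \<Phi>h[OF yV(2)] fy)
  show thesis
  proof (rule that)
    show "extreme_state D L \<Phi>" unfolding extreme_state_def
      by (intro allI impI, elim conjE, rule ext')
  qed (use st van re in blast)+
qed

lemma inverse_Suc_eventually_less:
  assumes e: "0 < (e::real)" shows "\<exists>N. \<forall>n\<ge>N. inverse (real (Suc n)) < e"
proof -
  obtain N where N: "inverse (real (Suc N)) < e" using reals_Archimedean[OF e] by blast
  have "inverse (real (Suc n)) < e" if "n \<ge> N" for n
  proof -
    have "inverse (real (Suc n)) \<le> inverse (real (Suc N))" using that by (intro le_imp_inverse_le) auto
    with N show ?thesis by linarith
  qed
  then show ?thesis by blast
qed

section \<open>Orthogonal projection in a Hilbert space\<close>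

context hilbert_space
begin

lemma inner_scale_right:
  "\<lbrakk>x \<in> hcarrier H; y \<in> hcarrier H\<rbrakk> \<Longrightarrow> \<langle>x, c \<odot> y\<rangle> = cnj c * \<langle>x, y\<rangle>"
  using inner_commute[of "c \<odot> y" x] inner_commute[of y x] by (simp add: inner_scale_left scale_closed)

lemma inner_zero_right [simp]: "y \<in> hcarrier H \<Longrightarrow> \<langle>y, \<zero>\<rangle> = 0"
  using inner_commute[of \<zero> y] by (simp add: zero_closed)

lemma inner_self_real: "x \<in> hcarrier H \<Longrightarrow> \<langle>x, x\<rangle> = complex_of_real (Re \<langle>x, x\<rangle>)"
  using inner_commute[of x x] by (simp add: complex_eq_iff)

lemma norm_squared: "x \<in> hcarrier H \<Longrightarrow> (hnorm H x)\<^sup>2 = Re \<langle>x, x\<rangle>"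
  using inner_nonneg[of x] by (simp add: hnorm_def)

text \<open>
  A minimising sequence for the distance to \<open>M\<close> becomes orthogonal to \<open>M\<close>. Applied to the
  differences of its own members, this shows that it is a Cauchy sequence.
\<close>

lemma orthogonal_projection:
  assumes M: "closed_hsubspace H M" and x: "x \<in> hcarrier H"
  obtains m where "m \<in> M" "\<And>z. z \<in> M \<Longrightarrow> \<langle>x \<oplus> (-1) \<odot> m, z\<rangle> = 0"
proof -
  have Mc: "z \<in> hcarrier H" if "z \<in> M" for z using M that by (auto simp: closed_hsubspace_def)
  have M0: "\<zero> \<in> M" and Madd: "\<And>a b. a \<in> M \<Longrightarrow> b \<in> M \<Longrightarrow> a \<oplus> b \<in> M"
    and Msc: "\<And>c a. a \<in> M \<Longrightarrow> c \<odot> a \<in> M"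
    using M unfolding closed_hsubspace_def by blast+
  note [simp] = add_closed scale_closed Mc x
  define D where "D m = Re \<langle>x \<oplus> (-1) \<odot> m, x \<oplus> (-1) \<odot> m\<rangle>" for m
  define d where "d = (INF m\<in>M. D m)"
  have Dnn: "0 \<le> D m" if "m \<in> M" for m using that by (simp add: D_def inner_nonneg)
  then have bd: "bdd_below (D ` M)" by (intro bdd_belowI2[of _ 0]) auto
  have dle: "d \<le> D m" if "m \<in> M" for m unfolding d_def by (rule cINF_lower[OF bd that])
  have "\<exists>m\<in>M. D m < d + inverse (real (Suc n))" for n
    using cINF_less_iff[OF _ bd, of "d + inverse (real (Suc n))"] M0 by (auto simp: d_def)
  then obtain X where X: "\<And>n. X n \<in> M" "\<And>n. D (X n) < d + inverse (real (Suc n))" by metis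
  have orth: "(cmod \<langle>x \<oplus> (-1) \<odot> m, z\<rangle>)\<^sup>2 \<le> e * Re \<langle>z, z\<rangle>"
    if m: "m \<in> M" and z: "z \<in> M" and e: "D m < d + e" for m z e
  proof -
    define w where "w = \<langle>x \<oplus> (-1) \<odot> m, z\<rangle>"
    define C where "C = Re \<langle>z, z\<rangle>"
    define v where "v = x \<oplus> (-1) \<odot> m"
    have v: "v \<in> hcarrier H" using m by (simp add: v_def)
    have zz: "\<langle>z, z\<rangle> = complex_of_real C" using inner_self_real[of z] z by (simp add: C_def)
    have C: "C \<ge> 0" using inner_nonneg[of z] z by (simp add: C_def)
    have key: "2 * r * (cmod w)\<^sup>2 - r\<^sup>2 * (cmod w)\<^sup>2 * C \<le> e" for r
    proof -
      define c where "c = complex_of_real r * w"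
      define m' where "m' = m \<oplus> c \<odot> z"
      have m': "m' \<in> M" using m z by (simp add: m'_def Madd Msc)
      have eq: "\<langle>x \<oplus> (-1) \<odot> m', y\<rangle> = \<langle>v, y\<rangle> - c * \<langle>z, y\<rangle>" if "y \<in> hcarrier H" for y
        using that m z by (simp add: m'_def v_def inner_add_left inner_scale_left algebra_simps)
      have eq': "\<langle>y, x \<oplus> (-1) \<odot> m'\<rangle> = \<langle>y, v\<rangle> - cnj c * \<langle>y, z\<rangle>" if "y \<in> hcarrier H" for y
        using that m z by (simp add: m'_def v_def inner_add_right inner_scale_right algebra_simps)
      have zv: "\<langle>z, v\<rangle> = cnj w" using inner_commute[of v z] v z by (simp add: w_def v_def)
      have "\<langle>x \<oplus> (-1) \<odot> m', x \<oplus> (-1) \<odot> m'\<rangle> = \<langle>v, v\<rangle> - cnj c * w - c * (cnj w - cnj c * complex_of_real C)"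
        using m' z v by (simp add: eq eq' zv zz) (simp add: w_def v_def algebra_simps)
      then have "D m' = Re (\<langle>v, v\<rangle> - cnj c * w - c * (cnj w - cnj c * complex_of_real C))"
        unfolding D_def by (rule arg_cong)
      also have "\<dots> = D m - 2 * r * (cmod w)\<^sup>2 + r\<^sup>2 * (cmod w)\<^sup>2 * C"
        unfolding D_def v_def[symmetric] c_def cmod_power2
        by (simp add: power2_eq_square algebra_simps)
      finally have "D m' = D m - 2 * r * (cmod w)\<^sup>2 + r\<^sup>2 * (cmod w)\<^sup>2 * C" .
      then show ?thesis using dle[OF m'] e by linarith
    qed
    have "(cmod w)\<^sup>2 \<le> e * C"
    proof (cases "C = 0")
      case True
      then have "z = \<zero>" using inner_definite[of z] z zz by simp
      then show ?thesis using v True by (simp add: w_def v_def[symmetric])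
    next
      case False
      then have C: "C > 0" using C by simp
      have "2 * (1 / C) * (cmod w)\<^sup>2 - (1 / C)\<^sup>2 * (cmod w)\<^sup>2 * C = (cmod w)\<^sup>2 / C"
        using C by (simp add: power2_eq_square field_simps)
      then have "(cmod w)\<^sup>2 / C \<le> e" using key[of "1 / C"] by simp
      then show ?thesis using C by (simp add: divide_le_eq)
    qed
    then show ?thesis by (simp add: w_def C_def)
  qed
  have close: "hdist H (X j) (X k) \<le> 2 * sqrt e" if e: "0 < e" "D (X j) < d + e" "D (X k) < d + e" for j k e
  proof -
    define z where "z = X j \<oplus> (-1) \<odot> X k"
    define h where "h = hdist H (X j) (X k)"
    have z: "z \<in> M" using X by (simp add: z_def Madd Msc)
    have zh: "Re \<langle>z, z\<rangle> = h\<^sup>2" using norm_squared[of z] z by (simp add: h_def hdist_def z_def)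
    have h0: "0 \<le> h" using inner_nonneg[of z] z by (simp add: h_def hdist_def hnorm_def z_def)
    have b: "cmod \<langle>x \<oplus> (-1) \<odot> X i, z\<rangle> \<le> sqrt e * h" if "D (X i) < d + e" for i
    proof -
      have "cmod \<langle>x \<oplus> (-1) \<odot> X i, z\<rangle> \<le> sqrt (e * Re \<langle>z, z\<rangle>)"
        by (rule real_le_rsqrt[OF orth[OF X(1) z that]])
      then show ?thesis using h0 by (simp add: zh real_sqrt_mult)
    qed
    have "\<langle>z, z\<rangle> = \<langle>x \<oplus> (-1) \<odot> X k, z\<rangle> - \<langle>x \<oplus> (-1) \<odot> X j, z\<rangle>"
    proof -
      have "\<langle>X j \<oplus> (-1) \<odot> X k, y\<rangle> = \<langle>x \<oplus> (-1) \<odot> X k, y\<rangle> - \<langle>x \<oplus> (-1) \<odot> X j, y\<rangle>" if "y \<in> hcarrier H" for y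
        using X that by (simp add: inner_add_left inner_scale_left)
      from this[of z] show ?thesis using z by (simp add: z_def[symmetric])
    qed
    then have "h\<^sup>2 \<le> cmod \<langle>x \<oplus> (-1) \<odot> X k, z\<rangle> + cmod \<langle>x \<oplus> (-1) \<odot> X j, z\<rangle>"
      using norm_triangle_ineq4 complex_Re_le_cmod[of "\<langle>z, z\<rangle>"] zh by (metis order_trans)
    then have "h * h \<le> (2 * sqrt e) * h" using b[OF e(2)] b[OF e(3)] by (simp add: power2_eq_square)
    then show ?thesis using h0 e by (cases "h = 0") (auto simp: h_def[symmetric])
  qed
  have "\<exists>l\<in>hcarrier H. (\<lambda>n. hdist H (X n) l) \<longlonglongrightarrow> 0"
  proof (rule complete)
    show "X n \<in> hcarrier H" for n using X by simp
    fix e :: real assume e: "0 < e"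
    define r where "r = (e / 4)\<^sup>2"
    have r: "r > 0" "sqrt r = e / 4" using e by (simp_all add: r_def)
    obtain N where N: "\<And>n. n \<ge> N \<Longrightarrow> inverse (real (Suc n)) < r" using inverse_Suc_eventually_less[OF r(1)] by blast
    have "hdist H (X m) (X n) < e" if "m \<ge> N" "n \<ge> N" for m n
      using close[OF r(1), of m n] X(2)[of m] X(2)[of n] N[OF that(1)] N[OF that(2)] r(2) e by simp
    then show "\<exists>N. \<forall>m\<ge>N. \<forall>n\<ge>N. hdist H (X m) (X n) < e" by blast
  qed
  then obtain l where l: "l \<in> hcarrier H" "(\<lambda>n. hdist H (X n) l) \<longlonglongrightarrow> 0" by blast
  have Mcl: "l \<in> M" using M X(1) l unfolding closed_hsubspace_def by blast
  have "\<langle>x \<oplus> (-1) \<odot> l, z\<rangle> = 0" if z: "z \<in> M" for z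
  proof -
    have "(\<lambda>n. \<langle>X n \<oplus> (-1) \<odot> l, z\<rangle>) \<longlonglongrightarrow> 0"
    proof -
      have cs: "cmod \<langle>y, z\<rangle> \<le> hnorm H y * sqrt (Re \<langle>z, z\<rangle> + 1)" if y: "y \<in> hcarrier H" for y
      proof -
        define C where "C = Re \<langle>z, z\<rangle> + 1"
        define w where "w = \<langle>y, z\<rangle>"
        have C: "C > 0" using inner_nonneg[of z] z by (simp add: C_def)
        define c where "c = w / complex_of_real C"
        have zz: "\<langle>z, z\<rangle> = complex_of_real (C - 1)" using inner_self_real[of z] z by (simp add: C_def)
        have zy: "\<langle>z, y\<rangle> = cnj w" using inner_commute[of y z] y z by (simp add: w_def)
        have "\<langle>y \<oplus> (- c) \<odot> z, y \<oplus> (- c) \<odot> z\<rangle> = \<langle>y, y\<rangle> - cnj c * w - c * (cnj w - cnj c * complex_of_real (C - 1))"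
          using y z by (simp add: inner_add_left inner_add_right inner_scale_left inner_scale_right zy zz w_def algebra_simps)
        moreover have "Re (cnj c * w) = (cmod w)\<^sup>2 / C" "Re (c * cnj w) = (cmod w)\<^sup>2 / C"
          "Re (c * cnj c * complex_of_real (C - 1)) = (cmod w)\<^sup>2 / C * ((C - 1) / C)"
          using C unfolding c_def cmod_power2 by (simp_all add: power2_eq_square field_simps Re_divide_of_real Im_divide_of_real)
        ultimately have "Re \<langle>y \<oplus> (- c) \<odot> z, y \<oplus> (- c) \<odot> z\<rangle> =
            Re \<langle>y, y\<rangle> - (cmod w)\<^sup>2 / C - (cmod w)\<^sup>2 / C + (cmod w)\<^sup>2 / C * ((C - 1) / C)"
          by (simp add: right_diff_distrib mult.assoc)
        moreover have "0 \<le> Re \<langle>y \<oplus> (- c) \<odot> z, y \<oplus> (- c) \<odot> z\<rangle>" using y z by (intro inner_nonneg) simp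
        moreover have "(cmod w)\<^sup>2 / C * ((C - 1) / C) \<le> (cmod w)\<^sup>2 / C"
          using C mult_left_le[of "(C - 1) / C" "(cmod w)\<^sup>2 / C"] by simp
        ultimately have "(cmod w)\<^sup>2 / C \<le> Re \<langle>y, y\<rangle>" by linarith
        then have "(cmod w)\<^sup>2 \<le> (hnorm H y)\<^sup>2 * C" using C y by (simp add: divide_le_eq norm_squared)
        then have "cmod w \<le> sqrt ((hnorm H y)\<^sup>2 * C)" by (rule real_le_rsqrt)
        then show ?thesis using inner_nonneg[OF y] by (simp add: real_sqrt_mult w_def C_def hnorm_def)
      qed
      have "(\<lambda>n. hdist H (X n) l * sqrt (Re \<langle>z, z\<rangle> + 1)) \<longlonglongrightarrow> 0 * sqrt (Re \<langle>z, z\<rangle> + 1)"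
        by (intro tendsto_mult l tendsto_const)
      then have lim: "(\<lambda>n. hdist H (X n) l * sqrt (Re \<langle>z, z\<rangle> + 1)) \<longlonglongrightarrow> 0" by simp
      show ?thesis
        by (rule Lim_null_comparison[OF _ lim])
           (intro always_eventually allI, unfold hdist_def, rule cs, use X l in simp)
    qed
    moreover have "(\<lambda>n. \<langle>x \<oplus> (-1) \<odot> X n, z\<rangle>) \<longlonglongrightarrow> 0"
    proof -
      have "(\<lambda>n. sqrt (inverse (real (Suc n)) * Re \<langle>z, z\<rangle>)) \<longlonglongrightarrow> sqrt (0 * Re \<langle>z, z\<rangle>)"
        by (intro tendsto_intros LIMSEQ_inverse_real_of_nat)
      then have lim: "(\<lambda>n. sqrt (inverse (real (Suc n)) * Re \<langle>z, z\<rangle>)) \<longlonglongrightarrow> 0" by simp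
      show ?thesis
        by (rule Lim_null_comparison[OF _ lim])
           (intro always_eventually allI real_le_rsqrt orth X z)
    qed
    ultimately have "(\<lambda>n. \<langle>x \<oplus> (-1) \<odot> X n, z\<rangle> + \<langle>X n \<oplus> (-1) \<odot> l, z\<rangle>) \<longlonglongrightarrow> 0 + 0"
      by (intro tendsto_add)
    moreover have "\<langle>x \<oplus> (-1) \<odot> X n, z\<rangle> + \<langle>X n \<oplus> (-1) \<odot> l, z\<rangle> = \<langle>x \<oplus> (-1) \<odot> l, z\<rangle>" for n
      using X l z by (simp add: inner_add_left inner_scale_left)
    ultimately show ?thesis by (simp add: LIMSEQ_const_iff)
  qed
  then show thesis using that Mcl by blast
qed

end

section \<open>The GNS representation\<close>

text \<open>
  A vector \<open>f\<close> of the completion is stored as the function \<open>b \<mapsto> \<langle>f, b\<rangle>\<close> on \<open>D\<close>. Then the vector space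
  operations are pointwise, the algebra acts by translation of the argument, and no quotient by
  the null space of the state is formed.
\<close>

context algebra_state
begin

definition nrm :: "'a \<Rightarrow> real" where "nrm a = sqrt (Re (\<Phi> (star a * a)))"

definition cauchy :: "(nat \<Rightarrow> 'a) \<Rightarrow> bool" where
  "cauchy a \<longleftrightarrow> (\<forall>n. a n \<in> D) \<and> (\<forall>e>0. \<exists>N. \<forall>m\<ge>N. \<forall>n\<ge>N. nrm (a m - a n) < e)"

definition functional :: "(nat \<Rightarrow> 'a) \<Rightarrow> 'a \<Rightarrow> complex" where
  "functional a = (\<lambda>b. if b \<in> D then lim (\<lambda>n. \<Phi> (star b * a n)) else 0)"

definition gns_vectors :: "('a \<Rightarrow> complex) set" where
  "gns_vectors = functional ` {a. cauchy a}"

definition representative :: "('a \<Rightarrow> complex) \<Rightarrow> nat \<Rightarrow> 'a" where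
  "representative f = (SOME a. cauchy a \<and> functional a = f)"

definition gns_inner :: "('a \<Rightarrow> complex) \<Rightarrow> ('a \<Rightarrow> complex) \<Rightarrow> complex" where
  "gns_inner f g = lim (\<lambda>n. \<Phi> (star (representative g n) * representative f n))"

definition gns_space :: "('a \<Rightarrow> complex) hspace" where
  "gns_space = \<lparr>hcarrier = gns_vectors, hzero = (\<lambda>b. 0), hadd = (\<lambda>f g b. f b + g b),
     hscale = (\<lambda>c f b. c * f b), hinner = gns_inner\<rparr>"

definition gns_rep :: "'a \<Rightarrow> ('a \<Rightarrow> complex) \<Rightarrow> 'a \<Rightarrow> complex" where
  "gns_rep x f = (\<lambda>b. if b \<in> D then f (star x * b) else 0)"

lemma gns_space_simps [simp]:
  "hcarrier gns_space = gns_vectors" "hzero gns_space = (\<lambda>b. 0)"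
  "hadd gns_space = (\<lambda>f g b. f b + g b)" "hscale gns_space = (\<lambda>c f b. c * f b)"
  "hinner gns_space = gns_inner"
  by (simp_all add: gns_space_def)

lemma nrm_nonneg: "x \<in> D \<Longrightarrow> 0 \<le> nrm x"
  by (simp add: nrm_def positive)

lemma nrm_squared: "x \<in> D \<Longrightarrow> (nrm x)\<^sup>2 = Re (\<Phi> (star x * x))"
  by (simp add: nrm_def positive)

lemma cmod_inner_le: "a \<in> D \<Longrightarrow> b \<in> D \<Longrightarrow> cmod (\<Phi> (star b * a)) \<le> nrm b * nrm a"
proof -
  assume ab: "a \<in> D" "b \<in> D"
  have "(cmod (\<Phi> (star b * a)))\<^sup>2 \<le> (nrm b * nrm a)\<^sup>2"
    using cauchy_schwarz[OF ab] ab by (simp add: power_mult_distrib nrm_squared mult.commute)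
  then show ?thesis by (rule power2_le_imp_le) (simp add: nrm_nonneg ab)
qed

lemma nrm_mult_le: "a \<in> D \<Longrightarrow> b \<in> D \<Longrightarrow> nrm (b * a) \<le> norm b * nrm a"
  using real_sqrt_le_mono[OF mult_left_bound[of a b]] by (simp add: nrm_def real_sqrt_mult)

lemma nrm_triangle: "a \<in> D \<Longrightarrow> b \<in> D \<Longrightarrow> nrm (a + b) \<le> nrm a + nrm b"
proof -
  assume ab: "a \<in> D" "b \<in> D"
  have "(nrm (a + b))\<^sup>2 = Re (\<Phi> (star a * a)) + Re (\<Phi> (star a * b)) + Re (\<Phi> (star b * a)) + Re (\<Phi> (star b * b))"
    using ab by (simp add: nrm_squared mem star_add distrib_left distrib_right add)
  also have "\<dots> \<le> (nrm a)\<^sup>2 + nrm a * nrm b + nrm b * nrm a + (nrm b)\<^sup>2"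
    unfolding nrm_squared[OF ab(1)] nrm_squared[OF ab(2)]
    by (intro add_mono order_refl order_trans[OF complex_Re_le_cmod cmod_inner_le] ab)
  also have "\<dots> = (nrm a + nrm b)\<^sup>2" by (simp add: power2_eq_square algebra_simps)
  finally show ?thesis by (rule power2_le_imp_le) (simp add: nrm_nonneg ab)
qed

lemma nrm_minus_commute: "nrm (a - b) = nrm (b - a)"
proof -
  have "star (a - b) * (a - b) = star (b - a) * (b - a)" by (simp add: star_diff algebra_simps)
  then show ?thesis by (simp add: nrm_def)
qed

lemma nrm_zero [simp]: "nrm 0 = 0"
  by (simp add: nrm_def zero)

lemma nrm_diff_triangle: "a \<in> D \<Longrightarrow> b \<in> D \<Longrightarrow> c \<in> D \<Longrightarrow> nrm (a - c) \<le> nrm (a - b) + nrm (b - c)"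
  using nrm_triangle[of "a - b" "b - c"] by (simp add: mem)

lemma cauchyD: "cauchy a \<Longrightarrow> a n \<in> D"
  by (simp add: cauchy_def)

lemma cauchy_const: "x \<in> D \<Longrightarrow> cauchy (\<lambda>n. x)"
  by (simp add: cauchy_def)

lemma cauchy_add:
  assumes a: "cauchy a" and b: "cauchy b" shows "cauchy (\<lambda>n. a n + b n)"
  unfolding cauchy_def
proof (intro conjI allI impI)
  show "a n + b n \<in> D" for n using cauchyD[OF a] cauchyD[OF b] by (simp add: mem)
  fix e :: real assume e: "0 < e"
  then have "0 < e / 2" by simp
  then obtain M N where M: "\<forall>m\<ge>M. \<forall>n\<ge>M. nrm (a m - a n) < e / 2" and N: "\<forall>m\<ge>N. \<forall>n\<ge>N. nrm (b m - b n) < e / 2"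
    using a b unfolding cauchy_def by meson
  have "nrm (a m + b m - (a n + b n)) < e" if "m \<ge> max M N" "n \<ge> max M N" for m n
  proof -
    have "nrm ((a m - a n) + (b m - b n)) \<le> nrm (a m - a n) + nrm (b m - b n)"
      using cauchyD[OF a] cauchyD[OF b] by (intro nrm_triangle) (simp_all add: mem)
    moreover have "nrm (a m - a n) < e / 2" "nrm (b m - b n) < e / 2" using M N that by auto
    moreover have "nrm (a m + b m - (a n + b n)) = nrm ((a m - a n) + (b m - b n))"
      by (rule arg_cong[where f=nrm]) simp
    ultimately show ?thesis by linarith
  qed
  then show "\<exists>N. \<forall>m\<ge>N. \<forall>n\<ge>N. nrm (a m + b m - (a n + b n)) < e" by blast
qed

lemma cauchy_mult:
  assumes x: "x \<in> D" and a: "cauchy a" shows "cauchy (\<lambda>n. x * a n)"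
  unfolding cauchy_def
proof (intro conjI allI impI)
  show "x * a n \<in> D" for n using cauchyD[OF a] x by (simp add: mem)
  fix e :: real assume e: "0 < e"
  have k: "0 < norm x + 1" by (simp add: add_nonneg_pos)
  with e have "0 < e / (norm x + 1)" by simp
  then obtain M where M: "\<forall>m\<ge>M. \<forall>n\<ge>M. nrm (a m - a n) < e / (norm x + 1)"
    using a unfolding cauchy_def by meson
  have "nrm (x * a m - x * a n) < e" if "m \<ge> M" "n \<ge> M" for m n
  proof -
    have d: "a m - a n \<in> D" using cauchyD[OF a] by (simp add: mem)
    have "nrm (x * (a m - a n)) \<le> norm x * nrm (a m - a n)" by (rule nrm_mult_le[OF d x])
    also have "\<dots> \<le> (norm x + 1) * nrm (a m - a n)"
      using nrm_nonneg[OF d] by (intro mult_right_mono) auto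
    also have "\<dots> < (norm x + 1) * (e / (norm x + 1))"
      using M that k by (intro mult_strict_left_mono) auto
    finally show ?thesis using k by (simp add: right_diff_distrib)
  qed
  then show "\<exists>N. \<forall>m\<ge>N. \<forall>n\<ge>N. nrm (x * a m - x * a n) < e" by blast
qed

lemma cauchy_scale: "cauchy a \<Longrightarrow> cauchy (\<lambda>n. c *\<^sub>C a n)"
  using cauchy_mult[of "c *\<^sub>C 1" a] by (simp add: mem one_mem mult_scaleC_left)

lemma cauchy_diff: "cauchy a \<Longrightarrow> cauchy b \<Longrightarrow> cauchy (\<lambda>n. a n - b n)"
  using cauchy_add[OF _ cauchy_scale[of b "-1"], of a] by (simp add: scaleC_minus_left scaleC_one)

lemma cauchy_bounded:
  assumes a: "cauchy a" obtains K where "K > 0" "\<And>n. nrm (a n) \<le> K"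
proof -
  obtain N where N: "\<forall>m\<ge>N. \<forall>n\<ge>N. nrm (a m - a n) < 1"
    using a unfolding cauchy_def by (meson zero_less_one)
  define K where "K = 1 + (\<Sum>i\<le>N. nrm (a i))"
  note [simp] = cauchyD[OF a] nrm_nonneg
  have s: "nrm (a i) \<le> (\<Sum>i\<le>N. nrm (a i))" if "i \<le> N" for i
    using that by (intro member_le_sum) auto
  have "nrm (a n) \<le> K" for n
  proof (cases "n \<le> N")
    case False
    have "nrm (a n) \<le> nrm (a n - a N) + nrm (a N)"
      using nrm_triangle[of "a n - a N" "a N"] by (simp add: mem)
    also have "nrm (a n - a N) < 1" using N False by simp
    finally show ?thesis using s[of N] by (simp add: K_def)
  qed (use s in \<open>simp add: K_def add_increasing\<close>)
  moreover have "K > 0" by (simp add: K_def add_pos_nonneg sum_nonneg)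
  ultimately show ?thesis using that by blast
qed

lemma inner_Cauchy:
  assumes a: "cauchy a" and b: "cauchy b"
  shows "convergent (\<lambda>n. \<Phi> (star (b n) * a n))"
proof -
  obtain K where K: "K > 0" "\<And>n. nrm (a n) \<le> K" using cauchy_bounded[OF a] by blast
  obtain L where L: "L > 0" "\<And>n. nrm (b n) \<le> L" using cauchy_bounded[OF b] by blast
  note [simp] = cauchyD[OF a] cauchyD[OF b] nrm_nonneg mem
  have "Cauchy (\<lambda>n. \<Phi> (star (b n) * a n))"
    unfolding Cauchy_def
  proof (intro allI impI)
    fix e :: real assume e: "0 < e"
    have "0 < e / (K + L)" using e K L by simp
    then obtain M N where M: "\<forall>m\<ge>M. \<forall>n\<ge>M. nrm (a m - a n) < e / (K + L)"
      and N: "\<forall>m\<ge>N. \<forall>n\<ge>N. nrm (b m - b n) < e / (K + L)"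
      using a b unfolding cauchy_def by meson
    have "dist (\<Phi> (star (b m) * a m)) (\<Phi> (star (b n) * a n)) < e" if "m \<ge> max M N" "n \<ge> max M N" for m n
    proof -
      have "star (b m) * a m - star (b n) * a n = star (b m) * (a m - a n) + star (b m - b n) * a n"
        by (simp add: star_diff algebra_simps)
      then have "\<Phi> (star (b m) * a m) - \<Phi> (star (b n) * a n) =
          \<Phi> (star (b m) * (a m - a n)) + \<Phi> (star (b m - b n) * a n)"
        by (simp add: diff[symmetric] add[symmetric])
      then have "dist (\<Phi> (star (b m) * a m)) (\<Phi> (star (b n) * a n)) \<le>
          cmod (\<Phi> (star (b m) * (a m - a n))) + cmod (\<Phi> (star (b m - b n) * a n))"
        unfolding dist_norm by (metis norm_triangle_ineq)
      also have "\<dots> \<le> nrm (b m) * nrm (a m - a n) + nrm (b m - b n) * nrm (a n)"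
        by (intro add_mono cmod_inner_le) auto
      also have "\<dots> \<le> L * nrm (a m - a n) + nrm (b m - b n) * K"
        using K L by (intro add_mono mult_right_mono mult_left_mono) auto
      also have "\<dots> < L * (e / (K + L)) + (e / (K + L)) * K"
        using M N K L that by (intro add_strict_mono mult_strict_left_mono mult_strict_right_mono) auto
      also have "\<dots> = (K + L) * (e / (K + L))" by (simp only: distrib_right mult.commute add.commute)
      also have "\<dots> = e" using K L by simp
      finally show ?thesis .
    qed
    then show "\<exists>M. \<forall>m\<ge>M. \<forall>n\<ge>M. dist (\<Phi> (star (b m) * a m)) (\<Phi> (star (b n) * a n)) < e" by blast
  qed
  then show ?thesis by (rule Cauchy_convergent)
qed

lemma functional_limit: "cauchy a \<Longrightarrow> b \<in> D \<Longrightarrow> (\<lambda>n. \<Phi> (star b * a n)) \<longlonglongrightarrow> functional a b"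
  using inner_Cauchy[OF _ cauchy_const, of a b] by (simp add: functional_def convergent_LIMSEQ_iff)

lemma functional_eqI:
  assumes "\<And>b. b \<in> D \<Longrightarrow> (\<lambda>n. \<Phi> (star b * a n)) \<longlonglongrightarrow> f b" "\<And>b. b \<notin> D \<Longrightarrow> f b = 0"
  shows "functional a = f"
  using assms by (auto simp: functional_def fun_eq_iff limI)

text \<open>\<open>\<langle>z n, z n\<rangle> = \<langle>z n - z m, z n\<rangle> + \<langle>z m, z n\<rangle>\<close>; let \<open>m\<close> tend to infinity first.\<close>

lemma functional_zero_imp_null:
  assumes z: "cauchy z" and 0: "functional z = (\<lambda>b. 0)"
  shows "(\<lambda>n. nrm (z n)) \<longlonglongrightarrow> 0"
proof (rule LIMSEQ_I)
  fix e :: real assume e: "0 < e"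
  then have e2: "0 < e / 2" by simp
  note [simp] = cauchyD[OF z] nrm_nonneg mem
  obtain N where N: "\<forall>m\<ge>N. \<forall>n\<ge>N. nrm (z m - z n) < e / 2"
    using z e2 unfolding cauchy_def by meson
  have "nrm (z n) \<le> e / 2" if n: "n \<ge> N" for n
  proof -
    have "(\<lambda>m. cmod (\<Phi> (star (z n) * z m)) + nrm (z n) * (e / 2)) \<longlonglongrightarrow> cmod 0 + nrm (z n) * (e / 2)"
      using functional_limit[OF z, of "z n"] by (intro tendsto_intros) (simp add: 0)
    moreover have "\<forall>\<^sub>F m in sequentially. (nrm (z n))\<^sup>2 \<le> cmod (\<Phi> (star (z n) * z m)) + nrm (z n) * (e / 2)"
      using eventually_ge_at_top[of N]
    proof eventually_elim
      case (elim m)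
      have "\<Phi> (star (z n) * z n) = \<Phi> (star (z n) * z m) + \<Phi> (star (z n) * (z n - z m))"
        by (simp add: add[symmetric] right_diff_distrib)
      then have "(nrm (z n))\<^sup>2 \<le> cmod (\<Phi> (star (z n) * z m)) + cmod (\<Phi> (star (z n) * (z n - z m)))"
        using complex_Re_le_cmod[of "\<Phi> (star (z n) * z m)"] complex_Re_le_cmod[of "\<Phi> (star (z n) * (z n - z m))"]
        by (simp add: nrm_squared)
      also have "cmod (\<Phi> (star (z n) * (z n - z m))) \<le> nrm (z n) * nrm (z n - z m)"
        by (rule cmod_inner_le) auto
      also have "\<dots> \<le> nrm (z n) * (e / 2)" using N n elim by (intro mult_left_mono) (auto simp: less_imp_le)
      finally show ?case by simp
    qed
    ultimately have "(nrm (z n))\<^sup>2 \<le> cmod 0 + nrm (z n) * (e / 2)"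
      by (rule tendsto_lowerbound) simp
    then have "nrm (z n) * nrm (z n) \<le> nrm (z n) * (e / 2)" by (simp add: power2_eq_square)
    then show ?thesis 
    proof (cases "nrm (z n) = 0")
      case False
      then have "0 < nrm (z n)" using nrm_nonneg[OF cauchyD[OF z, of n]] by linarith
      then show ?thesis using \<open>nrm (z n) * nrm (z n) \<le> _\<close> by (simp only: mult_le_cancel_left_pos)
    qed (use e in simp)
  qed
  then have "\<forall>n\<ge>N. norm (nrm (z n) - 0) < e" using e by fastforce
  then show "\<exists>no. \<forall>n\<ge>no. norm (nrm (z n) - 0) < e" by blast
qed

lemma functional_add:
  assumes "cauchy a" "cauchy b"
  shows "functional (\<lambda>n. a n + b n) = (\<lambda>c. functional a c + functional b c)"
proof (rule functional_eqI)
  fix c assume c: "c \<in> D"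
  show "(\<lambda>n. \<Phi> (star c * (a n + b n))) \<longlonglongrightarrow> functional a c + functional b c"
    using tendsto_add[OF functional_limit[OF assms(1) c] functional_limit[OF assms(2) c]]
      cauchyD[OF assms(1)] cauchyD[OF assms(2)] c
    by (simp add: distrib_left add mem)
qed (simp add: functional_def)

lemma functional_mult:
  assumes "cauchy a" "x \<in> D"
  shows "functional (\<lambda>n. x * a n) = gns_rep x (functional a)"
proof (rule functional_eqI)
  fix c assume c: "c \<in> D"
  then have "star x * c \<in> D" using assms by (simp add: mem)
  from functional_limit[OF assms(1) this]
  show "(\<lambda>n. \<Phi> (star c * (x * a n))) \<longlonglongrightarrow> gns_rep x (functional a) c"
    using c by (simp add: gns_rep_def star_mult star_star mult.assoc)
qed (simp add: gns_rep_def)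

lemma functional_scale:
  assumes "cauchy a"
  shows "functional (\<lambda>n. s *\<^sub>C a n) = (\<lambda>c. s * functional a c)"
proof (rule functional_eqI)
  fix c assume c: "c \<in> D"
  show "(\<lambda>n. \<Phi> (star c * (s *\<^sub>C a n))) \<longlonglongrightarrow> s * functional a c"
    using tendsto_mult[OF tendsto_const functional_limit[OF assms c], of s] cauchyD[OF assms] c
    by (simp add: mult_scaleC_right scale mem)
qed (simp add: functional_def)

lemma functional_diff:
  assumes "cauchy a" "cauchy b"
  shows "functional (\<lambda>n. a n - b n) = (\<lambda>c. functional a c + (-1) * functional b c)"
  using functional_add[OF assms(1) cauchy_scale[OF assms(2), of "-1"]] functional_scale[OF assms(2), of "-1"]
  by (simp add: scaleC_minus_left scaleC_one)

lemma gns_vectorsE: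
  assumes "f \<in> gns_vectors" obtains a where "cauchy a" "f = functional a"
  using assms by (auto simp: gns_vectors_def)

lemma functional_mem [simp]: "cauchy a \<Longrightarrow> functional a \<in> gns_vectors"
  by (simp add: gns_vectors_def)

text \<open>The inner product may be computed with arbitrary representing sequences: two of them for the same
  vector differ by a null sequence.\<close>

lemma gns_inner_limit:
  assumes a: "cauchy a" and b: "cauchy b"
  shows "(\<lambda>n. \<Phi> (star (b n) * a n)) \<longlonglongrightarrow> gns_inner (functional a) (functional b)"
proof -
  have rep: "cauchy (representative (functional c)) \<and> functional (representative (functional c)) = functional c"
    if "cauchy c" for c
    unfolding representative_def by (rule someI[of _ c]) (simp add: that)
  define a' b' where "a' = representative (functional a)" and "b' = representative (functional b)"
  have a': "cauchy a'" "functional a' = functional a" and b': "cauchy b'" "functional b' = functional b"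
    using rep[OF a] rep[OF b] by (simp_all add: a'_def b'_def)
  note [simp] = cauchyD[OF a] cauchyD[OF b] cauchyD[OF a'(1)] cauchyD[OF b'(1)] nrm_nonneg mem
  obtain K where K: "K > 0" "\<And>n. nrm (a' n) \<le> K" using cauchy_bounded[OF a'(1)] by blast
  obtain L where L: "L > 0" "\<And>n. nrm (b n) \<le> L" using cauchy_bounded[OF b] by blast
  have na: "(\<lambda>n. nrm (a n - a' n)) \<longlonglongrightarrow> 0" and nb: "(\<lambda>n. nrm (b n - b' n)) \<longlonglongrightarrow> 0"
    using a' b' by (intro functional_zero_imp_null cauchy_diff a b; simp add: functional_diff a b)+
  have "(\<lambda>n. L * nrm (a n - a' n) + nrm (b n - b' n) * K) \<longlonglongrightarrow> L * 0 + 0 * K"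
    by (intro tendsto_intros na nb)
  then have lim: "(\<lambda>n. L * nrm (a n - a' n) + nrm (b n - b' n) * K) \<longlonglongrightarrow> 0" by simp
  have "(\<lambda>n. \<Phi> (star (b n) * a n) - \<Phi> (star (b' n) * a' n)) \<longlonglongrightarrow> 0"
  proof (rule Lim_null_comparison[OF always_eventually lim], rule allI)
    fix n
    have "star (b n) * a n - star (b' n) * a' n = star (b n) * (a n - a' n) + star (b n - b' n) * a' n"
      by (simp add: star_diff algebra_simps)
    then have "\<Phi> (star (b n) * a n) - \<Phi> (star (b' n) * a' n) =
        \<Phi> (star (b n) * (a n - a' n)) + \<Phi> (star (b n - b' n) * a' n)"
      by (simp add: diff[symmetric] add[symmetric])
    then have "cmod (\<Phi> (star (b n) * a n) - \<Phi> (star (b' n) * a' n)) \<le>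
        cmod (\<Phi> (star (b n) * (a n - a' n))) + cmod (\<Phi> (star (b n - b' n) * a' n))"
      by (metis norm_triangle_ineq)
    also have "\<dots> \<le> nrm (b n) * nrm (a n - a' n) + nrm (b n - b' n) * nrm (a' n)"
      by (intro add_mono cmod_inner_le) auto
    also have "\<dots> \<le> L * nrm (a n - a' n) + nrm (b n - b' n) * K"
      using K L by (intro add_mono mult_right_mono mult_left_mono) auto
    finally show "cmod (\<Phi> (star (b n) * a n) - \<Phi> (star (b' n) * a' n)) \<le> L * nrm (a n - a' n) + nrm (b n - b' n) * K" .
  qed
  moreover have "(\<lambda>n. \<Phi> (star (b' n) * a' n)) \<longlonglongrightarrow> gns_inner (functional a) (functional b)"
    using inner_Cauchy[OF a'(1) b'(1)]
    by (simp add: gns_inner_def a'_def[symmetric] b'_def[symmetric] convergent_LIMSEQ_iff)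
  ultimately have "(\<lambda>n. (\<Phi> (star (b n) * a n) - \<Phi> (star (b' n) * a' n)) + \<Phi> (star (b' n) * a' n))
      \<longlonglongrightarrow> 0 + gns_inner (functional a) (functional b)" by (rule tendsto_add)
  then show ?thesis by simp
qed

lemma gns_inner_eqI:
  "cauchy a \<Longrightarrow> cauchy b \<Longrightarrow> (\<lambda>n. \<Phi> (star (b n) * a n)) \<longlonglongrightarrow> c \<Longrightarrow>
   gns_inner (functional a) (functional b) = c"
  using gns_inner_limit LIMSEQ_unique by blast

lemma hnorm_limit:
  assumes a: "cauchy a"
  shows "(\<lambda>n. nrm (a n)) \<longlonglongrightarrow> hnorm gns_space (functional a)"
  using tendsto_real_sqrt[OF tendsto_Re[OF gns_inner_limit[OF a a]]]
  by (simp add: nrm_def hnorm_def)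

lemma hdist_limit:
  assumes a: "cauchy a" and b: "cauchy b"
  shows "(\<lambda>n. nrm (a n - b n)) \<longlonglongrightarrow> hdist gns_space (functional a) (functional b)"
  using hnorm_limit[OF cauchy_diff[OF a b]] unfolding functional_diff[OF a b] by (simp add: hdist_def)

lemma hdist_triangle:
  assumes "f \<in> gns_vectors" "g \<in> gns_vectors" "h \<in> gns_vectors"
  shows "hdist gns_space f h \<le> hdist gns_space f g + hdist gns_space g h"
proof -
  obtain a b c where *: "cauchy a" "cauchy b" "cauchy c" "f = functional a" "g = functional b" "h = functional c"
    using assms by (metis gns_vectorsE)
  show ?thesis unfolding *
    by (rule LIMSEQ_le[OF hdist_limit[OF *(1,3)] tendsto_add[OF hdist_limit[OF *(1,2)] hdist_limit[OF *(2,3)]]])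
       (use * in \<open>auto intro!: nrm_diff_triangle cauchyD\<close>)
qed

lemma hdist_commute:
  assumes "f \<in> gns_vectors" "g \<in> gns_vectors"
  shows "hdist gns_space f g = hdist gns_space g f"
proof -
  obtain a b where *: "cauchy a" "cauchy b" "f = functional a" "g = functional b"
    using assms by (metis gns_vectorsE)
  have "(\<lambda>n. nrm (a n - b n)) = (\<lambda>n. nrm (b n - a n))" by (simp add: nrm_minus_commute fun_eq_iff)
  then show ?thesis unfolding *
    using hdist_limit[OF *(1,2)] hdist_limit[OF *(2,1)] LIMSEQ_unique by metis
qed

lemma hdist_embedding:
  assumes "x \<in> D" "y \<in> D"
  shows "hdist gns_space (functional (\<lambda>n. x)) (functional (\<lambda>n. y)) = nrm (x - y)"
  using hdist_limit[OF cauchy_const[OF assms(1)] cauchy_const[OF assms(2)]] by (simp add: LIMSEQ_const_iff)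

text \<open>In particular, the image of the algebra is dense in the space of vectors.\<close>

lemma hdist_terms_tendsto_zero:
  assumes a: "cauchy a"
  shows "(\<lambda>k. hdist gns_space (functional (\<lambda>n. a k)) (functional a)) \<longlonglongrightarrow> 0"
proof (rule LIMSEQ_I)
  fix e :: real assume e: "0 < e"
  then have e2: "0 < e / 2" by simp
  then obtain N where N: "\<forall>m\<ge>N. \<forall>n\<ge>N. nrm (a m - a n) < e / 2"
    using a unfolding cauchy_def by meson
  have "norm (hdist gns_space (functional (\<lambda>n. a k)) (functional a) - 0) < e" if k: "k \<ge> N" for k
  proof -
    note lim = hdist_limit[OF cauchy_const[OF cauchyD[OF a, of k]] a]
    have "hdist gns_space (functional (\<lambda>n. a k)) (functional a) \<le> e / 2"
      by (rule LIMSEQ_le_const2[OF lim]) (use N k in \<open>auto intro!: exI[of _ N] less_imp_le\<close>)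
    moreover have "0 \<le> hdist gns_space (functional (\<lambda>n. a k)) (functional a)"
      by (rule LIMSEQ_le_const[OF lim]) (auto intro!: nrm_nonneg mem cauchyD[OF a])
    ultimately show ?thesis using e by simp
  qed
  then show "\<exists>no. \<forall>k\<ge>no. norm (hdist gns_space (functional (\<lambda>n. a k)) (functional a) - 0) < e" by blast
qed

lemma gns_hilbert_space: "hilbert_space gns_space"
proof
  fix f g h :: "'a \<Rightarrow> complex" and c d :: complex
  have z: "functional (\<lambda>n. 0) = (\<lambda>b. 0)" by (rule functional_eqI) (simp_all add: zero)
  show "hzero gns_space \<in> hcarrier gns_space"
    using functional_mem[OF cauchy_const[OF mem(1)]] by (simp add: z)
  show "f \<in> hcarrier gns_space \<Longrightarrow> g \<in> hcarrier gns_space \<Longrightarrow> hadd gns_space f g \<in> hcarrier gns_space"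
    using functional_mem[OF cauchy_add] by (auto elim!: gns_vectorsE simp: functional_add)
  show "f \<in> hcarrier gns_space \<Longrightarrow> hscale gns_space c f \<in> hcarrier gns_space"
    using functional_mem[OF cauchy_scale] by (auto elim!: gns_vectorsE simp: functional_scale)
  {
    assume "f \<in> hcarrier gns_space" "g \<in> hcarrier gns_space"
    then obtain a b where *: "cauchy a" "cauchy b" "f = functional a" "g = functional b"
      by (auto elim!: gns_vectorsE)
    note [simp] = cauchyD[OF *(1)] cauchyD[OF *(2)] mem
    show "hinner gns_space (hscale gns_space c f) g = c * hinner gns_space f g"
      using gns_inner_eqI[OF cauchy_scale[OF *(1)] *(2), of c] tendsto_mult[OF tendsto_const gns_inner_limit[OF *(1,2)], of c]
      by (simp add: * functional_scale mult_scaleC_right scale)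
    show "hinner gns_space g f = cnj (hinner gns_space f g)"
    proof -
      have "\<Phi> (star (a n) * b n) = cnj (\<Phi> (star (b n) * a n))" for n
        using hermitian[of "star (b n) * a n"] by (simp add: star_mult star_star)
      then show ?thesis
        using gns_inner_eqI[OF *(2,1)] tendsto_cnj[OF gns_inner_limit[OF *(1,2)]] by (simp add: *)
    qed
    assume "h \<in> hcarrier gns_space"
    then obtain e where e: "cauchy e" "h = functional e" by (auto elim!: gns_vectorsE)
    show "hinner gns_space (hadd gns_space f g) h = hinner gns_space f h + hinner gns_space g h"
      using gns_inner_eqI[OF cauchy_add[OF *(1,2)] e(1)] cauchyD[OF e(1)]
        tendsto_add[OF gns_inner_limit[OF *(1) e(1)] gns_inner_limit[OF *(2) e(1)]]
      by (simp add: * e functional_add distrib_left add)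
  }
  {
    assume "f \<in> hcarrier gns_space"
    then obtain a where a: "cauchy a" "f = functional a" by (auto elim!: gns_vectorsE)
    note [simp] = cauchyD[OF a(1)] mem
    note lim = gns_inner_limit[OF a(1) a(1)]
    show "0 \<le> Re (hinner gns_space f f)"
      using tendsto_lowerbound[OF tendsto_Re[OF lim], of 0] by (simp add: a positive)
    assume 0: "hinner gns_space f f = 0"
    have n0: "(\<lambda>n. nrm (a n)) \<longlonglongrightarrow> 0"
      using hnorm_limit[OF a(1)] 0 by (simp add: hnorm_def a)
    have "functional a = (\<lambda>b. 0)"
    proof (rule functional_eqI)
      fix b assume b: "b \<in> D"
      have "(\<lambda>n. nrm b * nrm (a n)) \<longlonglongrightarrow> nrm b * 0" by (intro tendsto_intros n0)
      then have "(\<lambda>n. nrm b * nrm (a n)) \<longlonglongrightarrow> 0" by simp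
      then show "(\<lambda>n. \<Phi> (star b * a n)) \<longlonglongrightarrow> 0"
        by (rule Lim_null_comparison[rotated]) (simp add: cmod_inner_le b)
    qed simp
    then show "f = hzero gns_space" by (simp add: a)
  }
next
  fix X :: "nat \<Rightarrow> 'a \<Rightarrow> complex"
  assume "\<And>n. X n \<in> hcarrier gns_space"
    and C: "\<And>e. 0 < e \<Longrightarrow> \<exists>N. \<forall>m\<ge>N. \<forall>n\<ge>N. hdist gns_space (X m) (X n) < e"
  then have X: "X n \<in> gns_vectors" for n by simp
  \<comment> \<open>By density, \<open>X k\<close> may be replaced by the image of some \<open>x k\<close>; then \<open>x\<close> itself represents the limit.\<close>
  have "\<exists>x\<in>D. hdist gns_space (functional (\<lambda>n. x)) f < e" if fe: "f \<in> gns_vectors" "0 < e" for f e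
  proof -
    obtain a where a: "cauchy a" "f = functional a" using gns_vectorsE[OF fe(1)] .
    from LIMSEQ_D[OF hdist_terms_tendsto_zero[OF a(1)] fe(2)]
    obtain k where "norm (hdist gns_space (functional (\<lambda>n. a k)) f) < e" using a by auto
    then show ?thesis using cauchyD[OF a(1), of k] by (intro bexI[of _ "a k"]) auto
  qed
  then have "\<exists>x\<in>D. hdist gns_space (functional (\<lambda>n. x)) (X k) < inverse (real (Suc k))" for k
    using X by simp
  then obtain x where x: "\<And>k. x k \<in> D" "\<And>k. hdist gns_space (functional (\<lambda>n. x k)) (X k) < inverse (real (Suc k))"
    by metis
  have \<eta>: "functional (\<lambda>n. x k) \<in> gns_vectors" for k by (simp add: cauchy_const x)
  have xc: "cauchy x"
    unfolding cauchy_def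
  proof (intro conjI allI impI x(1))
    fix e :: real assume "0 < e"
    then have e3: "0 < e / 3" by simp
    obtain M where M: "\<forall>m\<ge>M. \<forall>n\<ge>M. hdist gns_space (X m) (X n) < e / 3" using C[OF e3] by blast
    obtain N where N: "\<forall>n\<ge>N. inverse (real (Suc n)) < e / 3" using inverse_Suc_eventually_less[OF e3] by blast
    have "nrm (x m - x n) < e" if mn: "m \<ge> max M N" "n \<ge> max M N" for m n
    proof -
      have "nrm (x m - x n) = hdist gns_space (functional (\<lambda>i. x m)) (functional (\<lambda>i. x n))"
        by (simp add: hdist_embedding x)
      also have "\<dots> \<le> hdist gns_space (functional (\<lambda>i. x m)) (X m) + (hdist gns_space (X m) (X n) + hdist gns_space (X n) (functional (\<lambda>i. x n)))"
        using hdist_triangle[OF \<eta>[of m] X[of m] \<eta>[of n]] hdist_triangle[OF X[of m] X[of n] \<eta>[of n]] by simp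
      also have "\<dots> < e / 3 + (e / 3 + e / 3)"
        using M N mn x(2)[of m] x(2)[of n] hdist_commute[OF X \<eta>, of n n]
        by (intro add_strict_mono) (auto intro: less_trans)
      finally show ?thesis by simp
    qed
    then show "\<exists>N. \<forall>m\<ge>N. \<forall>n\<ge>N. nrm (x m - x n) < e" by blast
  qed
  have "(\<lambda>k. hdist gns_space (X k) (functional x)) \<longlonglongrightarrow> 0"
  proof (rule tendsto_sandwich[of "\<lambda>_. 0" _ _ "\<lambda>k. inverse (real (Suc k)) + hdist gns_space (functional (\<lambda>n. x k)) (functional x)"])
    show "(\<lambda>k. inverse (real (Suc k)) + hdist gns_space (functional (\<lambda>n. x k)) (functional x)) \<longlonglongrightarrow> 0"
      using tendsto_add[OF LIMSEQ_inverse_real_of_nat hdist_terms_tendsto_zero[OF xc]] by simp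
    have "hdist gns_space (X k) (functional x) \<le> inverse (real (Suc k)) + hdist gns_space (functional (\<lambda>n. x k)) (functional x)" for k
      using hdist_triangle[OF X \<eta> functional_mem[OF xc], of k k] x(2)[of k] hdist_commute[OF X \<eta>, of k k] by linarith
    then show "\<forall>\<^sub>F k in sequentially. hdist gns_space (X k) (functional x) \<le> inverse (real (Suc k)) + hdist gns_space (functional (\<lambda>n. x k)) (functional x)"
      by simp
    have "0 \<le> hdist gns_space (X k) (functional x)" for k
    proof -
      obtain a where a: "cauchy a" "X k = functional a" using gns_vectorsE[OF X] .
      show ?thesis unfolding a
        by (rule LIMSEQ_le_const[OF hdist_limit[OF a(1) xc]]) (auto intro!: exI[of _ 0] nrm_nonneg mem(3) cauchyD[OF a(1)] cauchyD[OF xc])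
    qed
    then show "\<forall>\<^sub>F k in sequentially. 0 \<le> hdist gns_space (X k) (functional x)" by simp
  qed simp
  then show "\<exists>l\<in>hcarrier gns_space. (\<lambda>n. hdist gns_space (X n) l) \<longlonglongrightarrow> 0"
    using functional_mem[OF xc] by auto
qed (auto simp: algebra_simps fun_eq_iff)

end

section \<open>Irreducibility\<close>

context algebra_state
begin

interpretation gns: hilbert_space gns_space
  by (rule gns_hilbert_space)

lemmas gns_inner_simps =
  gns.inner_add_left[simplified] gns.inner_add_right[simplified]
  gns.inner_scale_left[simplified] gns.inner_scale_right[simplified]

lemma gns_rep_mem: "x \<in> D \<Longrightarrow> f \<in> gns_vectors \<Longrightarrow> gns_rep x f \<in> gns_vectors"
  by (auto elim!: gns_vectorsE simp: functional_mult[symmetric] cauchy_mult)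

lemma gns_rep_add_right: "gns_rep x (\<lambda>b. f b + g b) = (\<lambda>b. gns_rep x f b + gns_rep x g b)"
  and gns_rep_scale_right: "gns_rep x (\<lambda>b. c * f b) = (\<lambda>b. c * gns_rep x f b)"
  by (auto simp: gns_rep_def)

lemma gns_rep_mult: "x \<in> D \<Longrightarrow> y \<in> D \<Longrightarrow> gns_rep (x * y) f = gns_rep x (gns_rep y f)"
  by (auto simp: gns_rep_def star_mult mult.assoc mem)

lemma gns_rep_add_left:
  assumes "x \<in> D" "y \<in> D" "f \<in> gns_vectors"
  shows "gns_rep (x + y) f = (\<lambda>b. gns_rep x f b + gns_rep y f b)"
proof -
  obtain a where a: "cauchy a" "f = functional a" using gns_vectorsE[OF assms(3)] .
  show ?thesis
    using functional_add[OF cauchy_mult[OF assms(1) a(1)] cauchy_mult[OF assms(2) a(1)]]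
    by (simp add: a(2) functional_mult[OF a(1), symmetric] assms mem distrib_right)
qed

lemma gns_rep_scale_left:
  assumes "x \<in> D" "f \<in> gns_vectors"
  shows "gns_rep (c *\<^sub>C x) f = (\<lambda>b. c * gns_rep x f b)"
proof -
  obtain a where a: "cauchy a" "f = functional a" using gns_vectorsE[OF assms(2)] .
  show ?thesis
    using functional_scale[OF cauchy_mult[OF assms(1) a(1)], of c]
    by (simp add: a(2) functional_mult[OF a(1), symmetric] assms mem mult_scaleC_left)
qed

lemma gns_rep_one: "f \<in> gns_vectors \<Longrightarrow> gns_rep 1 f = f"
  by (auto elim!: gns_vectorsE simp: functional_mult[symmetric] one_mem)

lemma gns_inner_rep:
  assumes x: "x \<in> D" and f: "f \<in> gns_vectors" and g: "g \<in> gns_vectors"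
  shows "gns_inner (gns_rep x f) g = gns_inner f (gns_rep (star x) g)"
proof -
  obtain a where a: "cauchy a" "f = functional a" using gns_vectorsE[OF f] .
  obtain b where b: "cauchy b" "g = functional b" using gns_vectorsE[OF g] .
  have sx: "star x \<in> D" using x by (simp add: mem)
  have "(\<lambda>n. \<Phi> (star (b n) * (x * a n))) \<longlonglongrightarrow> gns_inner f (gns_rep (star x) g)"
    using gns_inner_limit[OF a(1) cauchy_mult[OF sx b(1)]]
    by (simp add: functional_mult[OF b(1) sx] a(2) b(2) star_mult star_star mult.assoc)
  from gns_inner_eqI[OF cauchy_mult[OF x a(1)] b(1) this]
  show ?thesis by (simp add: functional_mult[OF a(1) x] a(2) b(2))
qed

lemma hnorm_gns_rep_le:
  assumes x: "x \<in> D" and f: "f \<in> gns_vectors"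
  shows "hnorm gns_space (gns_rep x f) \<le> norm x * hnorm gns_space f"
proof -
  obtain a where a: "cauchy a" "f = functional a" using gns_vectorsE[OF f] .
  show ?thesis
    unfolding a(2) functional_mult[OF a(1) x, symmetric]
    by (rule LIMSEQ_le[OF hnorm_limit[OF cauchy_mult[OF x a(1)]]
          tendsto_mult[OF tendsto_const hnorm_limit[OF a(1)]]])
       (auto intro!: nrm_mult_le cauchyD[OF a(1)] x)
qed

lemma gns_star_representation:
  assumes "B \<subseteq> D" shows "star_representation B gns_space gns_rep"
proof (intro star_representation.intro star_representation_axioms.intro gns_hilbert_space)
  fix a assume "a \<in> B"
  then have a: "a \<in> D" using assms by blast
  show "bounded_operator gns_space (gns_rep a)"
    unfolding bounded_operator_def
    using gns_rep_mem[OF a] hnorm_gns_rep_le[OF a]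
    by (auto simp: gns_rep_add_right gns_rep_scale_right)
qed (use assms in \<open>auto simp: gns_rep_add_left gns_rep_scale_left gns_rep_mult gns_inner_rep subset_iff\<close>)

definition cyclic_vector :: "'a \<Rightarrow> complex" where
  "cyclic_vector = functional (\<lambda>n. 1)"

lemma cyclic_vector_mem: "cyclic_vector \<in> gns_vectors"
  by (simp add: cyclic_vector_def cauchy_const one_mem)

lemma gns_rep_cyclic_vector: "x \<in> D \<Longrightarrow> gns_rep x cyclic_vector = functional (\<lambda>n. x)"
  using functional_mult[OF cauchy_const[OF one_mem], of x] by (simp add: cyclic_vector_def)

lemma inner_cyclic_vector: "x \<in> D \<Longrightarrow> gns_inner (gns_rep x cyclic_vector) cyclic_vector = \<Phi> x"
  unfolding gns_rep_cyclic_vector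
  unfolding cyclic_vector_def by (rule gns_inner_eqI) (simp_all add: cauchy_const one_mem)

lemma evaluate_gns_vector:
  assumes "f \<in> gns_vectors" "b \<in> D"
  shows "gns_inner f (gns_rep b cyclic_vector) = f b"
proof -
  obtain a where a: "cauchy a" "f = functional a" using gns_vectorsE[OF assms(1)] .
  show ?thesis unfolding gns_rep_cyclic_vector[OF assms(2)] a(2)
    by (rule gns_inner_eqI[OF a(1) cauchy_const functional_limit]) (simp_all add: a assms)
qed

lemma gns_vector_eqI:
  assumes "f \<in> gns_vectors" "g \<in> gns_vectors"
    "\<And>b. b \<in> D \<Longrightarrow> gns_inner f (gns_rep b cyclic_vector) = gns_inner g (gns_rep b cyclic_vector)"
  shows "f = g"
proof
  fix b
  show "f b = g b"
  proof (cases "b \<in> D")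
    case True
    then show ?thesis using assms evaluate_gns_vector by metis
  next
    case False
    then show ?thesis using assms(1,2) by (auto elim!: gns_vectorsE simp: functional_def)
  qed
qed

text \<open>The components of the cyclic vector in an invariant subspace and in its orthogonal complement give
  rise to such states.\<close>

lemma vector_state:
  assumes m: "m \<in> gns_vectors" and pos: "0 < Re (gns_inner m m)"
  shows "algebra_state D (\<lambda>x. gns_inner (gns_rep x m) m / complex_of_real (Re (gns_inner m m)))"
proof (rule algebra_state.intro[OF D one_mem])
  define r where "r = Re (gns_inner m m)"
  have mm: "gns_inner m m = complex_of_real r" using gns.inner_self_real[of m] m by (simp add: r_def)
  note [simp] = gns_rep_mem m
  fix x y :: 'a and c :: complex
  show "x \<in> D \<Longrightarrow> y \<in> D \<Longrightarrow> gns_inner (gns_rep (x + y) m) m / complex_of_real (Re (gns_inner m m)) =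
      gns_inner (gns_rep x m) m / complex_of_real (Re (gns_inner m m)) +
      gns_inner (gns_rep y m) m / complex_of_real (Re (gns_inner m m))"
    by (simp add: gns_rep_add_left gns_inner_simps add_divide_distrib)
  show "x \<in> D \<Longrightarrow> gns_inner (gns_rep (c *\<^sub>C x) m) m / complex_of_real (Re (gns_inner m m)) =
      c * (gns_inner (gns_rep x m) m / complex_of_real (Re (gns_inner m m)))"
    by (simp add: gns_rep_scale_left gns_inner_simps)
  {
    assume x: "x \<in> D"
    then have sx: "star x \<in> D" by (simp add: mem)
    show "gns_inner (gns_rep (star x) m) m / complex_of_real (Re (gns_inner m m)) =
      cnj (gns_inner (gns_rep x m) m / complex_of_real (Re (gns_inner m m)))"
      using gns_inner_rep[OF sx m m] gns.inner_commute[of "gns_rep x m" m] x by (simp add: star_star)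
    have "gns_inner (gns_rep (star x * x) m) m = gns_inner (gns_rep x m) (gns_rep x m)"
      using x sx gns_inner_rep[OF sx, of "gns_rep x m" m] by (simp add: gns_rep_mult star_star)
    then show "0 \<le> Re (gns_inner (gns_rep (star x * x) m) m / complex_of_real (Re (gns_inner m m)))"
      using gns.inner_nonneg[of "gns_rep x m"] x pos by (simp add: Re_divide_of_real)
  }
  show "gns_inner (gns_rep 1 m) m / complex_of_real (Re (gns_inner m m)) = 1"
    using pos by (simp add: gns_rep_one mm)
qed

lemma gns_rep_eq_zero:
  assumes L: "L \<in> closed_ideals D" "\<forall>l\<in>L. \<Phi> l = 0" and l: "l \<in> L" and f: "f \<in> gns_vectors"
  shows "gns_rep l f = (\<lambda>b. 0)"
proof -
  obtain a where a: "cauchy a" "f = functional a" using gns_vectorsE[OF f] .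
  have "functional (\<lambda>n. l * a n) = (\<lambda>b. 0)"
  proof (rule functional_eqI)
    fix b assume b: "b \<in> D"
    have "star b * (l * a n) \<in> L" for n
      using closed_idealD[OF L(1)] l b cauchyD[OF a(1)] mem by simp
    then show "(\<lambda>n. \<Phi> (star b * (l * a n))) \<longlonglongrightarrow> 0" using L(2) by simp
  qed simp
  then show ?thesis using functional_mult[OF a(1) closed_idealD(9)[OF L(1) l]] a(2) by simp
qed

text \<open>
  An invariant subspace splits the cyclic vector into orthogonal components \<open>m\<close> and \<open>n\<close>, and the
  state into a convex combination of the two vector states. By extremality both are the state
  itself, so that \<open>m\<close> is a multiple of the cyclic vector; this leaves only \<open>m = 0\<close> or \<open>n = 0\<close>.
\<close>

theorem gns_irreducible:
  assumes L: "L \<in> closed_ideals D" "\<forall>l\<in>L. \<Phi> l = 0"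
    and ext: "extreme_state D L \<Phi>"
    and B: "B \<subseteq> D" "\<And>x. x \<in> D \<Longrightarrow> \<exists>b\<in>B. \<exists>c. x = b + c *\<^sub>C 1" and nz: "\<exists>b\<in>B. \<Phi> b \<noteq> 0"
  shows "irreducible_representation B gns_space gns_rep"
proof (intro irreducible_representation.intro irreducible_representation_axioms.intro gns_star_representation B)
  define \<xi> where "\<xi> = cyclic_vector"
  have \<xi>: "\<xi> \<in> gns_vectors" by (simp add: \<xi>_def cyclic_vector_mem)
  have z: "(\<lambda>b. 0) \<in> gns_vectors" using gns.zero_closed by simp
  obtain b where b: "b \<in> B" "\<Phi> b \<noteq> 0" using nz by blast
  have "gns_rep b \<xi> \<noteq> (\<lambda>b. 0)"
    using inner_cyclic_vector[of b] b B(1) gns.inner_zero_left[of \<xi>] \<xi> by (auto simp: \<xi>_def)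
  then show "\<exists>a\<in>B. \<exists>x\<in>hcarrier gns_space. gns_rep a x \<noteq> hzero gns_space"
    using b \<xi> by auto
  fix M assume M: "closed_hsubspace gns_space M" and "\<And>a x. a \<in> B \<Longrightarrow> x \<in> M \<Longrightarrow> gns_rep a x \<in> M"
  then have inv: "\<And>a x. a \<in> B \<Longrightarrow> x \<in> M \<Longrightarrow> gns_rep a x \<in> M" by blast
  have Mv: "M \<subseteq> gns_vectors" and Mz: "(\<lambda>b. 0) \<in> M"
    and Madd: "\<And>f g. f \<in> M \<Longrightarrow> g \<in> M \<Longrightarrow> (\<lambda>b. f b + g b) \<in> M"
    and Msc: "\<And>c f. f \<in> M \<Longrightarrow> (\<lambda>b. c * f b) \<in> M"
    and Mcl: "\<And>X l. \<lbrakk>\<forall>n. X n \<in> M; l \<in> gns_vectors; (\<lambda>n. hdist gns_space (X n) l) \<longlonglongrightarrow> 0\<rbrakk> \<Longrightarrow> l \<in> M"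
    using M by (auto simp: closed_hsubspace_def)
  have invD: "gns_rep x f \<in> M" if xf: "x \<in> D" "f \<in> M" for x f
  proof -
    obtain b c where b: "b \<in> B" "x = b + c *\<^sub>C 1" using B(2)[OF xf(1)] by blast
    have bD: "b \<in> D" using b B by blast
    have f: "f \<in> gns_vectors" using xf Mv by blast
    have "gns_rep x f = (\<lambda>d. gns_rep b f d + c * f d)"
      by (simp add: b(2) gns_rep_add_left bD one_mem mem f gns_rep_scale_left gns_rep_one)
    then show ?thesis using Madd[OF inv[OF b(1) xf(2)] Msc[OF xf(2)]] by simp
  qed
  obtain m where m: "m \<in> M" and orth: "\<And>z. z \<in> M \<Longrightarrow> gns_inner (\<lambda>b. \<xi> b + (-1) * m b) z = 0"
    using gns.orthogonal_projection[OF M, of \<xi>] \<xi> by auto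
  have mv: "m \<in> gns_vectors" using m Mv by blast
  define n where "n = (\<lambda>b. \<xi> b + (-1) * m b)"
  have nv: "n \<in> gns_vectors"
    using gns.add_closed[of \<xi> "hscale gns_space (-1) m"] gns.scale_closed[of m "-1"] \<xi> mv by (simp add: n_def)
  have \<xi>mn: "\<xi> = (\<lambda>b. m b + n b)" by (simp add: n_def)
  have nM: "gns_inner n f = 0" if "f \<in> M" for f using orth[OF that] by (simp add: n_def)
  have Mn: "gns_inner f n = 0" if "f \<in> M" for f
    using nM[OF that] gns.inner_commute[of n f] nv Mv that by auto
  note [simp] = gns_rep_mem mv nv
  have split: "\<Phi> x = gns_inner (gns_rep x m) m + gns_inner (gns_rep x n) n" if x: "x \<in> D" for x
  proof -
    have "gns_inner (gns_rep x n) m = 0"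
      using gns_inner_rep[OF x nv mv] nM[OF invD[OF _ m]] x by (simp add: mem)
    moreover have "gns_inner (gns_rep x m) n = 0" by (rule Mn[OF invD[OF x m]])
    moreover have "\<Phi> x = gns_inner (gns_rep x \<xi>) \<xi>" by (simp add: \<xi>_def inner_cyclic_vector x)
    moreover have "gns_rep x \<xi> = (\<lambda>b. gns_rep x m b + gns_rep x n b)"
      by (subst \<xi>mn) (rule gns_rep_add_right)
    ultimately show ?thesis
      using x \<xi> gns_inner_simps(1)[of "gns_rep x m" "gns_rep x n" \<xi>]
        gns_inner_simps(2)[of m n "gns_rep x m"] gns_inner_simps(2)[of m n "gns_rep x n"]
      by (simp add: \<xi>mn[symmetric])
  qed
  define a where "a = Re (gns_inner m m)"
  define c where "c = Re (gns_inner n n)"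
  have aa: "gns_inner m m = complex_of_real a" and cc: "gns_inner n n = complex_of_real c"
    using gns.inner_self_real[of m] gns.inner_self_real[of n] by (simp_all add: a_def c_def)
  have a0: "0 \<le> a" and c0: "0 \<le> c"
    using gns.inner_nonneg[of m] gns.inner_nonneg[of n] by (simp_all add: a_def c_def)
  have ac: "a + c = 1"
    using arg_cong[OF split[OF one_mem], of Re] by (simp add: gns_rep_one aa cc one)
  show "M = {hzero gns_space} \<or> M = hcarrier gns_space"
  proof -
    consider "a = 0" | "c = 0" | "0 < a" "0 < c" using a0 c0 by linarith
    then show ?thesis
    proof cases
      case 1
      then have "m = (\<lambda>b. 0)" using gns.inner_definite[of m] by (simp add: aa)
      then have "n = \<xi>" by (simp add: n_def)
      have "f = (\<lambda>b. 0)" if f: "f \<in> M" for f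
      proof (rule gns_vector_eqI)
        fix b assume b: "b \<in> D"
        then have sb: "star b \<in> D" by (simp add: mem)
        have "gns_inner f (gns_rep b cyclic_vector) = gns_inner (gns_rep (star b) f) n"
          using gns_inner_rep[OF sb subsetD[OF Mv f] \<xi>] by (simp only: \<open>n = \<xi>\<close> star_star \<xi>_def)
        also have "\<dots> = 0" by (rule Mn[OF invD[OF sb f]])
        finally show "gns_inner f (gns_rep b cyclic_vector) = gns_inner (\<lambda>b. 0) (gns_rep b cyclic_vector)"
          using gns.inner_zero_left[of "gns_rep b cyclic_vector"] b cyclic_vector_mem by simp
      qed (use f Mv z in blast)+
      then have "M = {\<lambda>b. 0}" using Mz by blast
      then show ?thesis by simp
    next
      case 2
      then have "n = (\<lambda>b. 0)" using gns.inner_definite[of n] by (simp add: cc)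
      then have "\<xi> \<in> M" using m by (simp add: \<xi>mn)
      have "f \<in> M" if f: "f \<in> gns_vectors" for f
      proof -
        obtain s where s: "cauchy s" "f = functional s" using gns_vectorsE[OF f] .
        have "functional (\<lambda>n. s k) \<in> M" for k
          using invD[OF cauchyD[OF s(1)] \<open>\<xi> \<in> M\<close>, of k] gns_rep_cyclic_vector[OF cauchyD[OF s(1)], of k]
          by (simp only: \<xi>_def)
        then show ?thesis
          using Mcl[of "\<lambda>k. functional (\<lambda>n. s k)" f] f hdist_terms_tendsto_zero[OF s(1)] s(2) by blast
      qed
      then show ?thesis using Mv by auto
    next
      case 3
      define \<Psi> where "\<Psi> = (\<lambda>x. gns_inner (gns_rep x m) m / complex_of_real a)"
      define \<Psi>' where "\<Psi>' = (\<lambda>x. gns_inner (gns_rep x n) n / complex_of_real c)"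
      have st: "algebra_state D \<Psi>" "algebra_state D \<Psi>'"
        using vector_state[OF mv] vector_state[OF nv] 3 by (simp_all add: \<Psi>_def \<Psi>'_def a_def c_def)
      have van: "\<forall>l\<in>L. \<Psi> l = 0" "\<forall>l\<in>L. \<Psi>' l = 0"
      proof -
        have "gns_inner (\<lambda>b. 0) m = 0" "gns_inner (\<lambda>b. 0) n = 0"
          using gns.inner_zero_left[of m] gns.inner_zero_left[of n] by simp_all
        then show "\<forall>l\<in>L. \<Psi> l = 0" "\<forall>l\<in>L. \<Psi>' l = 0"
          unfolding \<Psi>_def \<Psi>'_def by (simp_all add: gns_rep_eq_zero[OF L _ mv] gns_rep_eq_zero[OF L _ nv])
      qed
      have conv: "\<Phi> x = complex_of_real a * \<Psi> x + complex_of_real (1 - a) * \<Psi>' x" if "x \<in> D" for x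
      proof -
        have "complex_of_real (1 - a) = complex_of_real c" using ac by (intro arg_cong[where f=complex_of_real]) simp
        moreover have "complex_of_real a \<noteq> 0" "complex_of_real c \<noteq> 0" using 3 by simp_all
        ultimately show ?thesis unfolding \<Psi>_def \<Psi>'_def split[OF that] by simp
      qed
      have eq: "\<forall>x\<in>D. \<Psi> x = \<Phi> x"
      proof -
        have "a < 1" using 3 ac by simp
        with st van 3 conv show ?thesis
          by (intro ext[unfolded extreme_state_def, THEN spec, THEN spec, THEN spec, THEN mp, of \<Psi> \<Psi>' a]) blast
      qed
      have meq: "m = (\<lambda>b. complex_of_real a * \<xi> b)"
      proof (rule gns_vector_eqI)
        show sc: "(\<lambda>b. complex_of_real a * \<xi> b) \<in> gns_vectors"
          using gns.scale_closed[of \<xi> "complex_of_real a"] \<xi> by simp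
        fix b assume b: "b \<in> D"
        then have sb: "star b \<in> D" by (simp add: mem)
        have "gns_inner m (gns_rep b \<xi>) = gns_inner (gns_rep (star b) m) \<xi>"
          using gns_inner_rep[OF sb mv \<xi>] by (simp add: star_star)
        also have "\<dots> = gns_inner (gns_rep (star b) m) m"
          using gns_inner_simps(2)[of m n "gns_rep (star b) m"] sb Mn[OF invD[OF sb m]] by (simp add: \<xi>mn[symmetric])
        also have "\<dots> = complex_of_real a * \<Phi> (star b)"
          using bspec[OF eq sb] 3 by (simp add: \<Psi>_def field_simps)
        also have "\<dots> = complex_of_real a * gns_inner \<xi> (gns_rep b \<xi>)"
          using inner_cyclic_vector[OF sb] gns_inner_rep[OF sb \<xi> \<xi>] by (simp add: \<xi>_def star_star)
        also have "\<dots> = gns_inner (\<lambda>d. complex_of_real a * \<xi> d) (gns_rep b \<xi>)"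
          using gns_inner_simps(3)[of \<xi> "gns_rep b \<xi>" "complex_of_real a"] \<xi> b by simp
        finally show "gns_inner m (gns_rep b cyclic_vector) =
            gns_inner (\<lambda>d. complex_of_real a * \<xi> d) (gns_rep b cyclic_vector)" by (simp add: \<xi>_def)
      qed simp
      have "gns_inner (\<lambda>b. complex_of_real a * \<xi> b) n = complex_of_real a * gns_inner \<xi> n"
        by (rule gns_inner_simps(3)[OF \<xi> nv])
      then have "gns_inner m n = complex_of_real a * gns_inner \<xi> n" by (simp only: meq[symmetric])
      also have "gns_inner \<xi> n = complex_of_real c"
        using gns_inner_simps(1)[OF mv nv nv] Mn[OF m] by (simp only: \<xi>mn[symmetric] cc add_0)
      finally have "complex_of_real a * complex_of_real c = 0" using Mn[OF m] by simp
      then show ?thesis using 3 by simp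
    qed
  qed
qed

end

section \<open>Separation by primitive ideals\<close>

lemma irreducible_representation_emb:
  assumes "irreducible_representation (emb ` B) H \<pi>"
  shows "irreducible_representation B H (\<lambda>a. \<pi> (emb a))"
proof -
  interpret irreducible_representation "emb ` B" H \<pi> by fact
  show ?thesis
  proof (intro irreducible_representation.intro irreducible_representation_axioms.intro
      star_representation.intro star_representation_axioms.intro hilbert_space_axioms)
    show "\<exists>a\<in>B. \<exists>x\<in>hcarrier H. \<pi> (emb a) x \<noteq> hzero H" using nonzero by blast
    show "\<And>M. closed_hsubspace H M \<Longrightarrow> (\<And>a x. a \<in> B \<Longrightarrow> x \<in> M \<Longrightarrow> \<pi> (emb a) x \<in> M) \<Longrightarrow>
      M = {hzero H} \<or> M = hcarrier H"
      by (rule irreducible) blast+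
  qed (simp_all add: emb_simps rep_bounded rep_add rep_scale rep_mult rep_star)
qed

text \<open>
  The kernel of the GNS representation of an extreme state \<open>\<Phi>\<close> with \<open>\<Phi> (y\<^sup>2) = infdist (y\<^sup>2) L\<close> will do.
  The state vanishes on the kernel and has norm one, so that no element of the kernel is closer to
  \<open>y\<^sup>2\<close> than \<open>\<Phi> (y\<^sup>2)\<close>. The state lives on \<open>B\<close> with a unit adjoined; restricting the
  representation to \<open>B\<close> changes no invariant subspace.
\<close>

theorem exists_primitive_ideal_attaining_infdist:
  assumes B: "cstar_subalgebra B" and L: "L \<in> closed_ideals B"
    and y: "y \<in> B" "star y = y" and d: "infdist (y * y) L > 0"
  obtains J where "J \<in> primitive_ideals B" "L \<subseteq> J" "infdist (y * y) L \<le> infdist (y * y) J"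
proof -
  define D where "D = {u. base u \<in> B}"
  define B' where "B' = emb ` B"
  define L' where "L' = emb ` L"
  have cb: "continuous_on UNIV (base :: 'a unitization \<Rightarrow> 'a)"
    by (intro linear_continuous_on bounded_linear_base)
  have "closed (base -` B)"
    using continuous_on_closed_vimage[OF closed_UNIV, THEN iffD1, OF cb] cstar_subalgebraD(8)[OF B] by simp
  then have "closed D" by (simp add: D_def vimage_def)
  then have D: "cstar_subalgebra D"
    using cstar_subalgebraD[OF B]
    by (auto simp: cstar_subalgebra_def D_def intro!: complex_vector.subspaceI)
  have one: "1 \<in> D" using cstar_subalgebraD[OF B] by (simp add: D_def)
  have L': "L' \<in> closed_ideals D"
    unfolding closed_ideals_def two_sided_ideal_def
    using closed_idealD[OF L] closed_emb[OF closed_idealD(8)[OF L]]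
    by (auto simp: L'_def D_def base_scal_iff intro!: complex_vector.subspaceI)
  have ne: "L \<noteq> {}" using closed_idealD(1)[OF L] by blast
  have y': "emb y \<in> D" "star (emb y) = emb y" using y by (simp_all add: D_def emb_simps(6)[symmetric])
  have yy: "infdist (emb y * emb y) L' = infdist (y * y) L"
    using infdist_emb[OF ne, of "y * y"] by (simp add: L'_def emb_simps)
  have d': "infdist (emb y * emb y) L' > 0" using d yy by simp
  obtain \<Phi> where st: "algebra_state D \<Phi>" and van: "\<forall>l\<in>L'. \<Phi> l = 0"
    and \<Phi>y: "Re (\<Phi> (emb y * emb y)) = infdist (emb y * emb y) L'"
    and ext: "extreme_state D L' \<Phi>"
    by (rule exists_extreme_state[OF D one L' y' d']) (rule that)
  interpret algebra_state D \<Phi> by (rule st)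
  have yB: "emb y * emb y \<in> B'" using cstar_subalgebraD(6)[OF B y(1) y(1)] by (auto simp: B'_def emb_simps[symmetric])
  have "irreducible_representation B' gns_space gns_rep"
  proof (rule gns_irreducible[OF L' van ext])
    show "B' \<subseteq> D" by (auto simp: B'_def D_def)
    show "\<exists>b\<in>B'. \<exists>c. x = b + c *\<^sub>C 1" if "x \<in> D" for x
      by (rule bexI[of _ "emb (base x)"], rule exI[of _ "scal x"])
         (use that in \<open>auto simp: B'_def D_def intro: unitization.expand\<close>)
    show "\<exists>b\<in>B'. \<Phi> b \<noteq> 0" using yB \<Phi>y d yy by (intro bexI[of _ "emb y * emb y"]) auto
  qed
  then have irr: "irreducible_representation B gns_space (\<lambda>a. gns_rep (emb a))"
    unfolding B'_def by (rule irreducible_representation_emb)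
  define J where "J = rep_kernel B gns_space (\<lambda>a. gns_rep (emb a))"
  have "J \<in> primitive_ideals B" unfolding J_def by (rule rep_kernel_primitive[OF B irr])
  moreover have "L \<subseteq> J"
  proof
    fix l assume l: "l \<in> L"
    then have "emb l \<in> L'" by (simp add: L'_def)
    then show "l \<in> J"
      using gns_rep_eq_zero[OF L' van] closed_idealD(9)[OF L l] by (auto simp: J_def rep_kernel_def)
  qed
  moreover have "infdist (y * y) L \<le> infdist (y * y) J"
  proof -
    have Jne: "J \<noteq> {}" using \<open>L \<subseteq> J\<close> ne by blast
    have "infdist (y * y) L \<le> dist (y * y) j" if j: "j \<in> J" for j
    proof -
      have jD: "emb j \<in> D" using j by (auto simp: J_def rep_kernel_def D_def)
      have "gns_rep (emb j) cyclic_vector = (\<lambda>b. 0)"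
        using j cyclic_vector_mem by (auto simp: J_def rep_kernel_def)
      then have "\<Phi> (emb j) = 0"
        using inner_cyclic_vector[OF jD] hilbert_space.inner_zero_left[OF gns_hilbert_space, of cyclic_vector]
          cyclic_vector_mem by simp
      then have "\<Phi> (emb y * emb y) = \<Phi> (emb y * emb y - emb j)"
        using diff[of "emb y * emb y" "emb j"] y'(1) jD mem by simp
      then have "infdist (y * y) L = Re (\<Phi> (emb y * emb y - emb j))" using \<Phi>y yy by simp
      also have "\<dots> \<le> norm (emb y * emb y - emb j)"
        using cmod_le_norm[of "emb y * emb y - emb j"] complex_Re_le_cmod y'(1) jD mem
        by (meson order_trans)
      also have "\<dots> = dist (y * y) j"
        by (simp add: emb_simps(2,5)[symmetric] dist_norm)
      finally show ?thesis .
    qed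
    then show ?thesis unfolding infdist_notempty[OF Jne] by (intro cINF_greatest[OF Jne])
  qed
  ultimately show thesis using that by blast
qed

section \<open>Primitive ideals\<close>

lemma (in star_representation) rep_closed: "a \<in> B \<Longrightarrow> x \<in> hcarrier H \<Longrightarrow> \<pi> a x \<in> hcarrier H"
  using rep_bounded by (auto simp: bounded_operator_def)

text \<open>If \<open>a\<^sup>* a = 2 b - b\<^sup>2\<close> with \<open>b\<close> self-adjoint, then
  \<open>norm x ^ 2 - norm (\<pi> a x) ^ 2 = norm (x - \<pi> b x) ^ 2\<close>.\<close>

lemma (in star_representation) rep_contractive:
  assumes B: "cstar_subalgebra B" and a: "a \<in> B" "norm a < 1" and x: "x \<in> hcarrier H"
  shows "Re \<langle>\<pi> a x, \<pi> a x\<rangle> \<le> Re \<langle>x, x\<rangle>"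
proof -
  obtain b where b: "b \<in> B" "star b = b" and ab: "star a * a = 2 *\<^sub>R b - b * b"
    using exists_one_minus_sqrt[OF B a] .
  note mem = cstar_subalgebraD[OF B]
  note [simp] = rep_closed mem x b(1) a(1) add_closed scale_closed
  define v where "v = \<pi> b x"
  have v: "v \<in> hcarrier H" by (simp add: v_def)
  have eq: "star a * a = 2 *\<^sub>C b + (-1) *\<^sub>C (b * b)"
    by (simp add: ab scaleC_minus_left scaleC_one scaleR_scaleC)
  have "\<langle>\<pi> a x, \<pi> a x\<rangle> = \<langle>x, \<pi> (star a * a) x\<rangle>"
    using rep_star[of a x "\<pi> a x"] by (simp add: rep_mult)
  also have "\<pi> (star a * a) x = 2 \<odot> v \<oplus> (-1) \<odot> \<pi> b v"
  proof -
    have "\<pi> (star a * a) x = \<pi> (2 *\<^sub>C b) x \<oplus> \<pi> ((-1) *\<^sub>C (b * b)) x"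
      unfolding eq by (rule rep_add) simp_all
    then show ?thesis
      by (simp only: v_def rep_scale[OF b(1) x] rep_scale[OF mem(6)[OF b(1) b(1)] x] rep_mult[OF b(1) b(1) x])
  qed
  also have "\<langle>x, 2 \<odot> v \<oplus> (-1) \<odot> \<pi> b v\<rangle> = 2 * \<langle>x, v\<rangle> - \<langle>x, \<pi> b v\<rangle>"
    using v by (simp add: inner_add_right inner_scale_right)
  also have "\<langle>x, \<pi> b v\<rangle> = \<langle>v, v\<rangle>"
    using rep_star[of b x v] v by (simp add: v_def b(2))
  finally have 1: "\<langle>\<pi> a x, \<pi> a x\<rangle> = 2 * \<langle>x, v\<rangle> - \<langle>v, v\<rangle>" .
  have vx: "\<langle>v, x\<rangle> = \<langle>x, v\<rangle>" using rep_star[of b x x] by (simp add: v_def b(2))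
  have "\<langle>x \<oplus> (-1) \<odot> v, x \<oplus> (-1) \<odot> v\<rangle> = \<langle>x, x\<rangle> - 2 * \<langle>x, v\<rangle> + \<langle>v, v\<rangle>"
    using v by (simp add: inner_add_left inner_add_right inner_scale_left inner_scale_right vx)
  then have "0 \<le> Re (\<langle>x, x\<rangle> - 2 * \<langle>x, v\<rangle> + \<langle>v, v\<rangle>)"
    using inner_nonneg[of "x \<oplus> (-1) \<odot> v"] v by simp
  then show ?thesis unfolding 1 by simp
qed

lemma (in star_representation) rep_zero:
  assumes B: "cstar_subalgebra B" and x: "x \<in> hcarrier H" shows "\<pi> 0 x = \<zero>"
proof (rule inner_definite)
  have 0: "0 \<in> B" using cstar_subalgebraD[OF B] by blast
  show "\<pi> 0 x \<in> hcarrier H" by (rule rep_closed[OF 0 x])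
  then have "\<langle>0 \<odot> \<pi> 0 x, \<pi> 0 x\<rangle> = 0" by (simp add: inner_scale_left)
  then show "\<langle>\<pi> 0 x, \<pi> 0 x\<rangle> = 0" using rep_scale[OF 0 x, of 0] by simp
qed

lemma (in star_representation) scale_hzero: "x \<in> hcarrier H \<Longrightarrow> c \<odot> \<zero> = \<zero>"
  using inner_definite[of "c \<odot> \<zero>"] scale_closed[OF zero_closed, of c]
  by (simp add: inner_scale_left zero_closed)

lemma (in star_representation) rep_apply_zero:
  assumes a: "a \<in> B" shows "\<pi> a \<zero> = \<zero>"
proof -
  have "\<pi> a (0 \<odot> \<zero>) = 0 \<odot> \<pi> a \<zero>"
    using rep_bounded[OF a] zero_closed by (auto simp: bounded_operator_def)
  moreover have "0 \<odot> y = \<zero>" if "y \<in> hcarrier H" for y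
    using that inner_definite[of "0 \<odot> y"] scale_closed[OF that, of 0]
    by (simp add: inner_scale_left)
  ultimately show ?thesis using rep_closed[OF a zero_closed] zero_closed by simp
qed

lemma (in star_representation) rep_kernel_closed_ideal:
  assumes B: "cstar_subalgebra B"
  shows "rep_kernel B H \<pi> \<in> closed_ideals B"
proof -
  define J where "J = rep_kernel B H \<pi>"
  note mem = cstar_subalgebraD[OF B]
  have J: "a \<in> J \<longleftrightarrow> a \<in> B \<and> (\<forall>x\<in>hcarrier H. \<pi> a x = \<zero>)" for a
    by (auto simp: J_def rep_kernel_def)
  have "closed J"
    unfolding closed_sequential_limits
  proof (intro allI impI, elim conjE)
    fix s a assume s: "\<forall>n. s n \<in> J" and lim: "s \<longlonglongrightarrow> a"
    have aB: "a \<in> B" using closed_sequentially[OF mem(8) _ lim] s J by blast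
    have "\<pi> a x = \<zero>" if x: "x \<in> hcarrier H" for x
    proof (rule inner_definite[OF rep_closed[OF aB x]])
      have "Re \<langle>\<pi> a x, \<pi> a x\<rangle> \<le> e" if e: "0 < e" for e
      proof -
        define r where "r = sqrt (e / (Re \<langle>x, x\<rangle> + 1))"
        have nn: "0 \<le> Re \<langle>x, x\<rangle>" by (rule inner_nonneg[OF x])
        have r: "0 < r" "r\<^sup>2 * Re \<langle>x, x\<rangle> \<le> e"
          using e nn by (auto simp: r_def field_simps)
        obtain n where n: "norm (s n - a) < r" using LIMSEQ_D[OF lim r(1)] by blast
        define d where "d = a - s n"
        have d: "d \<in> B" using aB s J mem by (auto simp: d_def)
        define c where "c = (1 / r) *\<^sub>C d"
        have c: "c \<in> B" "norm c < 1"
          using n r(1) d mem by (auto simp: c_def d_def norm_scaleC norm_divide norm_minus_commute)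
        have "a = s n + complex_of_real r *\<^sub>C c" using r(1) by (simp add: c_def scaleC_scaleC d_def scaleC_one)
        then have "\<pi> a x = \<zero> \<oplus> complex_of_real r \<odot> \<pi> c x"
          using s J c x mem by (simp add: rep_add rep_scale)
        also have "\<dots> = complex_of_real r \<odot> \<pi> c x"
          using add_commute[OF zero_closed] add_zero scale_closed[OF rep_closed[OF c(1) x]] by simp
        finally have "\<pi> a x = complex_of_real r \<odot> \<pi> c x" .
        then have "Re \<langle>\<pi> a x, \<pi> a x\<rangle> = r\<^sup>2 * Re \<langle>\<pi> c x, \<pi> c x\<rangle>"
          using rep_closed[OF c(1) x] by (simp add: inner_scale_left inner_scale_right scale_closed power2_eq_square)
        also have "\<dots> \<le> r\<^sup>2 * Re \<langle>x, x\<rangle>" by (intro mult_left_mono rep_contractive[OF B c x]) simp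
        finally show ?thesis using r(2) by simp
      qed
      then have "Re \<langle>\<pi> a x, \<pi> a x\<rangle> \<le> 0" by (rule field_le_epsilon[of _ 0, simplified])
      then show "\<langle>\<pi> a x, \<pi> a x\<rangle> = 0"
        using inner_nonneg[OF rep_closed[OF aB x]] inner_self_real[OF rep_closed[OF aB x]] by simp
    qed
    then show "a \<in> J" using aB J by blast
  qed
  moreover have "complex_vector.subspace J"
    by (rule complex_vector.subspaceI)
      (auto simp: J mem rep_zero[OF B] rep_add rep_scale scale_hzero add_zero zero_closed)
  moreover have "a * y \<in> J \<and> y * a \<in> J" if "a \<in> B" "y \<in> J" for a y
    using that by (auto simp: J mem rep_mult rep_closed rep_apply_zero)
  ultimately show ?thesis
    by (auto simp: closed_ideals_def two_sided_ideal_def J_def[symmetric] J)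
qed

text \<open>For \<open>L\<close> not in the kernel, the vectors annihilated by \<open>I\<close> form a non-zero invariant subspace.\<close>

lemma (in irreducible_representation) rep_kernel_prime:
  assumes B: "cstar_subalgebra B" and I: "I \<in> closed_ideals B" and L: "L \<in> closed_ideals B"
    and IL: "I \<inter> L \<subseteq> rep_kernel B H \<pi>"
  shows "I \<subseteq> rep_kernel B H \<pi> \<or> L \<subseteq> rep_kernel B H \<pi>"
proof (rule disjCI)
  assume "\<not> L \<subseteq> rep_kernel B H \<pi>"
  then obtain l v where l: "l \<in> L" and v: "v \<in> hcarrier H" "\<pi> l v \<noteq> \<zero>"
    using closed_idealD(9)[OF L] by (auto simp: rep_kernel_def)
  have lB: "l \<in> B" by (rule closed_idealD(9)[OF L l])
  note IB = closed_idealD(9)[OF I]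
  define S where "S = {\<pi> i u | i u. i \<in> I \<and> u \<in> hcarrier H}"
  define W where "W = {w\<in>hcarrier H. \<forall>z\<in>S. \<langle>w, z\<rangle> = 0}"
  have W: "w \<in> W \<longleftrightarrow> w \<in> hcarrier H \<and> (\<forall>i\<in>I. \<pi> i w = \<zero>)" for w
  proof
    assume w: "w \<in> W"
    have "\<pi> i w = \<zero>" if i: "i \<in> I" for i
    proof (rule inner_definite)
      have wH: "w \<in> hcarrier H" using w by (simp add: W_def)
      have si: "star i \<in> I" by (rule closed_ideal_star[OF B I i])
      show iw: "\<pi> i w \<in> hcarrier H" using rep_closed[OF IB[OF i] wH] .
      have "\<langle>\<pi> i w, \<pi> i w\<rangle> = \<langle>w, \<pi> (star i) (\<pi> i w)\<rangle>" by (rule rep_star[OF IB[OF i] wH iw])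
      also have "\<dots> = 0" using w si iw by (auto simp: W_def S_def)
      finally show "\<langle>\<pi> i w, \<pi> i w\<rangle> = 0" .
    qed
    then show "w \<in> hcarrier H \<and> (\<forall>i\<in>I. \<pi> i w = \<zero>)" using w by (simp add: W_def)
  next
    assume w: "w \<in> hcarrier H \<and> (\<forall>i\<in>I. \<pi> i w = \<zero>)"
    have "\<langle>w, \<pi> i u\<rangle> = 0" if i: "i \<in> I" and u: "u \<in> hcarrier H" for i u
    proof -
      have si: "star i \<in> I" by (rule closed_ideal_star[OF B I i])
      have "\<langle>\<pi> (star i) w, u\<rangle> = \<langle>w, \<pi> i u\<rangle>"
        using rep_star[OF IB[OF si], of w u] w u by (simp add: star_star)
      then show ?thesis using w si u by simp
    qed
    then show "w \<in> W" using w by (auto simp: W_def S_def)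
  qed
  have "S \<subseteq> hcarrier H" using rep_closed IB by (auto simp: S_def)
  then have "closed_hsubspace H W" unfolding W_def by (rule closed_hsubspace_orthogonal)
  moreover have "\<pi> b w \<in> W" if b: "b \<in> B" and w: "w \<in> W" for b w
  proof -
    have "\<pi> i (\<pi> b w) = \<zero>" if i: "i \<in> I" for i
    proof -
      have "i * b \<in> I" using closed_idealD(7)[OF I b i] .
      then show ?thesis using rep_mult[OF IB[OF i] b, of w] w W by simp
    qed
    then show ?thesis using W rep_closed[OF b] w by blast
  qed
  ultimately have "W = {\<zero>} \<or> W = hcarrier H" using irreducible by blast
  moreover have "\<pi> l v \<in> W"
  proof -
    have "\<pi> i (\<pi> l v) = \<zero>" if i: "i \<in> I" for i
    proof -
      have "i * l \<in> I \<inter> L"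
        using closed_idealD(7)[OF I lB i] closed_idealD(6)[OF L IB[OF i] l] by blast
      then have "i * l \<in> rep_kernel B H \<pi>" using IL by blast
      then show ?thesis using rep_mult[OF IB[OF i] lB v(1)] v(1) by (simp add: rep_kernel_def)
    qed
    then show ?thesis using W rep_closed[OF lB v(1)] by blast
  qed
  ultimately have "W = hcarrier H" using v(2) by blast
  then show "I \<subseteq> rep_kernel B H \<pi>" using W IB by (auto simp: rep_kernel_def)
qed

text \<open>\<open>\<langle>x, \<pi> (\<Sum> a\<^sup>* a) x\<rangle>\<close> is the sum of the squared norms of the vectors \<open>\<pi> a x\<close>.\<close>

lemma (in star_representation) sum_star_mult_mem_kernel:
  assumes B: "cstar_subalgebra B" and S: "finite S" "S \<subseteq> B"
    and sum: "(\<Sum>a\<in>S. star a * a) \<in> rep_kernel B H \<pi>"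
  shows "S \<subseteq> rep_kernel B H \<pi>"
proof -
  note mem = cstar_subalgebraD[OF B]
  have key: "(\<Sum>a\<in>T. star a * a) \<in> B \<and> \<langle>x, \<pi> (\<Sum>a\<in>T. star a * a) x\<rangle> = (\<Sum>a\<in>T. \<langle>\<pi> a x, \<pi> a x\<rangle>)"
    if "finite T" "T \<subseteq> B" and x: "x \<in> hcarrier H" for T x
    using that(1,2)
  proof (induction T)
    case empty
    then show ?case using rep_zero[OF B x] x mem by simp
  next
    case (insert a T)
    have a: "a \<in> B" using insert by simp
    have "\<langle>x, \<pi> (star a * a) x\<rangle> = \<langle>\<pi> a x, \<pi> a x\<rangle>"
      using rep_star[OF a x rep_closed[OF a x]] a x by (simp add: rep_mult mem)
    then show ?case
      using insert a x by (simp add: mem rep_add inner_add_right rep_closed)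
  qed
  show ?thesis
  proof
    fix a assume a: "a \<in> S"
    then have aB: "a \<in> B" using S by blast
    have "\<pi> a x = \<zero>" if x: "x \<in> hcarrier H" for x
    proof (rule inner_definite[OF rep_closed[OF aB x]])
      have "(\<Sum>b\<in>S. Re \<langle>\<pi> b x, \<pi> b x\<rangle>) = 0"
        using arg_cong[OF conjunct2[OF key[OF S x]], of Re] sum x by (simp add: rep_kernel_def)
      moreover have "0 \<le> Re \<langle>\<pi> b x, \<pi> b x\<rangle>" if "b \<in> S" for b
        using inner_nonneg rep_closed x S that by blast
      ultimately have "Re \<langle>\<pi> a x, \<pi> a x\<rangle> = 0"
        using sum_nonneg_eq_0_iff[OF S(1), of "\<lambda>b. Re \<langle>\<pi> b x, \<pi> b x\<rangle>"] a by blast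
      then show "\<langle>\<pi> a x, \<pi> a x\<rangle> = 0" using inner_self_real[OF rep_closed[OF aB x]] by simp
    qed
    then show "a \<in> rep_kernel B H \<pi>" using aB by (simp add: rep_kernel_def)
  qed
qed

lemma primitive_idealD:
  assumes B: "cstar_subalgebra B" and J: "J \<in> primitive_ideals B"
  shows primitive_closed_ideal: "J \<in> closed_ideals B"
    and primitive_proper: "J \<noteq> B"
    and primitive_prime: "\<lbrakk>I \<in> closed_ideals B; L \<in> closed_ideals B; I \<inter> L \<subseteq> J\<rbrakk> \<Longrightarrow> I \<subseteq> J \<or> L \<subseteq> J"
    and primitive_sum_mem: "\<lbrakk>finite S; S \<subseteq> B; (\<Sum>a\<in>S. star a * a) \<in> J\<rbrakk> \<Longrightarrow> S \<subseteq> J"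
proof -
  obtain H :: "('a \<Rightarrow> complex) hspace" and \<pi> where irr: "irreducible_representation B H \<pi>"
    and J: "J = rep_kernel B H \<pi>" using J by (auto simp: primitive_ideals_def)
  interpret irreducible_representation B H \<pi> by (rule irr)
  show "J \<in> closed_ideals B" unfolding J by (rule rep_kernel_closed_ideal[OF B])
  show "J \<noteq> B" using nonzero by (auto simp: J rep_kernel_def)
  show "I \<in> closed_ideals B \<Longrightarrow> L \<in> closed_ideals B \<Longrightarrow> I \<inter> L \<subseteq> J \<Longrightarrow> I \<subseteq> J \<or> L \<subseteq> J"
    unfolding J by (rule rep_kernel_prime[OF B])
  show "finite S \<Longrightarrow> S \<subseteq> B \<Longrightarrow> (\<Sum>a\<in>S. star a * a) \<in> J \<Longrightarrow> S \<subseteq> J"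
    unfolding J by (rule sum_star_mult_mem_kernel[OF B])
qed

section \<open>The Jacobson topology\<close>

definition generated_ideal :: "'a::cstar_algebra set \<Rightarrow> 'a set \<Rightarrow> 'a set" where
  "generated_ideal B S = \<Inter> {I \<in> closed_ideals B. S \<subseteq> I}"

lemma closed_ideals_self: "cstar_subalgebra B \<Longrightarrow> B \<in> closed_ideals B"
  by (auto simp: closed_ideals_def two_sided_ideal_def cstar_subalgebra_def)

lemma closed_ideals_Inter:
  assumes "\<I> \<subseteq> closed_ideals B" "\<I> \<noteq> {}" shows "\<Inter>\<I> \<in> closed_ideals B"
proof -
  have I: "two_sided_ideal B I" "closed I" if "I \<in> \<I>" for I
    using assms(1) that by (auto simp: closed_ideals_def)
  have "complex_vector.subspace (\<Inter>\<I>)"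
    by (rule complex_vector.subspace_Inter) (use I in \<open>simp add: two_sided_ideal_def\<close>)
  moreover have "\<Inter>\<I> \<subseteq> B" using assms(2) I by (force simp: two_sided_ideal_def)
  moreover have "a * x \<in> \<Inter>\<I> \<and> x * a \<in> \<Inter>\<I>" if "a \<in> B" "x \<in> \<Inter>\<I>" for a x
    using that I by (simp add: two_sided_ideal_def)
  ultimately show ?thesis
    using closed_Inter[of \<I>] I(2) by (simp add: closed_ideals_def two_sided_ideal_def)
qed

lemma closed_ideals_Int: "I \<in> closed_ideals B \<Longrightarrow> L \<in> closed_ideals B \<Longrightarrow> I \<inter> L \<in> closed_ideals B"
  using closed_ideals_Inter[of "{I, L}" B] by simp

lemma generated_ideal_closed: "cstar_subalgebra B \<Longrightarrow> S \<subseteq> B \<Longrightarrow> generated_ideal B S \<in> closed_ideals B"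
  unfolding generated_ideal_def using closed_ideals_self[of B] by (intro closed_ideals_Inter) auto

lemma generated_ideal_superset: "S \<subseteq> generated_ideal B S"
  by (auto simp: generated_ideal_def)

lemma generated_ideal_least: "I \<in> closed_ideals B \<Longrightarrow> S \<subseteq> I \<Longrightarrow> generated_ideal B S \<subseteq> I"
  by (auto simp: generated_ideal_def)

lemma hull_generated_ideal:
  "cstar_subalgebra B \<Longrightarrow> ideal_hull B (generated_ideal B S) = {J \<in> primitive_ideals B. S \<subseteq> J}"
proof -
  assume B: "cstar_subalgebra B"
  have "generated_ideal B S \<subseteq> J \<longleftrightarrow> S \<subseteq> J" if "J \<in> primitive_ideals B" for J
    using generated_ideal_superset[of S B] generated_ideal_least[OF primitive_closed_ideal[OF B that], of S]
    by blast
  then show ?thesis by (auto simp: ideal_hull_def)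
qed

lemma hull_Int:
  "cstar_subalgebra B \<Longrightarrow> I \<in> closed_ideals B \<Longrightarrow> L \<in> closed_ideals B \<Longrightarrow>
   ideal_hull B (I \<inter> L) = ideal_hull B I \<union> ideal_hull B L"
proof -
  assume *: "cstar_subalgebra B" "I \<in> closed_ideals B" "L \<in> closed_ideals B"
  have "I \<inter> L \<subseteq> J \<longleftrightarrow> I \<subseteq> J \<or> L \<subseteq> J" if "J \<in> primitive_ideals B" for J
    using primitive_prime[OF *(1) that *(2,3)] by blast
  then show ?thesis by (auto simp: ideal_hull_def)
qed

lemma istopology_jacobson:
  assumes B: "cstar_subalgebra B"
  shows "istopology (\<lambda>S. S \<subseteq> primitive_ideals B \<and>
       (\<exists>I\<in>closed_ideals B. primitive_ideals B - S = ideal_hull B I))"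
  unfolding istopology_def
proof (intro conjI allI impI)
  fix S T
  assume "S \<subseteq> primitive_ideals B \<and> (\<exists>I\<in>closed_ideals B. primitive_ideals B - S = ideal_hull B I)"
    and "T \<subseteq> primitive_ideals B \<and> (\<exists>I\<in>closed_ideals B. primitive_ideals B - T = ideal_hull B I)"
  then obtain I L where *: "I \<in> closed_ideals B" "L \<in> closed_ideals B" "S \<subseteq> primitive_ideals B"
    "primitive_ideals B - S = ideal_hull B I" "primitive_ideals B - T = ideal_hull B L" by blast
  have "primitive_ideals B - S \<inter> T = ideal_hull B (I \<inter> L)"
    unfolding hull_Int[OF B *(1,2)] *(4)[symmetric] *(5)[symmetric] by blast
  then show "\<exists>I\<in>closed_ideals B. primitive_ideals B - S \<inter> T = ideal_hull B I"
    using closed_ideals_Int[OF *(1,2)] by blast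
  show "S \<inter> T \<subseteq> primitive_ideals B" using * by blast
next
  fix \<K>
  assume K: "\<forall>K\<in>\<K>. K \<subseteq> primitive_ideals B \<and> (\<exists>I\<in>closed_ideals B. primitive_ideals B - K = ideal_hull B I)"
  then obtain I where I: "\<And>K. K \<in> \<K> \<Longrightarrow> I K \<in> closed_ideals B"
    "\<And>K. K \<in> \<K> \<Longrightarrow> primitive_ideals B - K = ideal_hull B (I K)" by metis
  define S where "S = (\<Union>K\<in>\<K>. I K)"
  have "S \<subseteq> B" using closed_idealD(9)[OF I(1)] by (auto simp: S_def)
  moreover have "primitive_ideals B - \<Union>\<K> = ideal_hull B (generated_ideal B S)"
  proof -
    have "J \<in> \<Union>\<K> \<longleftrightarrow> \<not> S \<subseteq> J" if J: "J \<in> primitive_ideals B" for J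
    proof -
      have "J \<in> K \<longleftrightarrow> \<not> I K \<subseteq> J" if "K \<in> \<K>" for K
        using I(2)[OF that] J by (auto simp: ideal_hull_def)
      then show ?thesis by (auto simp: S_def)
    qed
    then show ?thesis unfolding hull_generated_ideal[OF B] by blast
  qed
  ultimately show "\<exists>I\<in>closed_ideals B. primitive_ideals B - \<Union>\<K> = ideal_hull B I"
    using generated_ideal_closed[OF B] by blast
  show "\<Union>\<K> \<subseteq> primitive_ideals B" using K by blast
qed

lemma openin_jacobson:
  assumes B: "cstar_subalgebra B"
  shows "openin (jacobson_topology B) S \<longleftrightarrow> S \<subseteq> primitive_ideals B \<and>
       (\<exists>I\<in>closed_ideals B. primitive_ideals B - S = ideal_hull B I)"
  unfolding jacobson_topology_def topology_inverse'[OF istopology_jacobson[OF B]] ..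

lemma topspace_jacobson:
  assumes B: "cstar_subalgebra B"
  shows "topspace (jacobson_topology B) = primitive_ideals B"
proof
  show "topspace (jacobson_topology B) \<subseteq> primitive_ideals B"
    using openin_topspace[of "jacobson_topology B"] unfolding openin_jacobson[OF B] by blast
  have "ideal_hull B B = {}"
  proof -
    have "\<not> B \<subseteq> J" if "J \<in> primitive_ideals B" for J
      using primitive_proper[OF B that] closed_idealD(9)[OF primitive_closed_ideal[OF B that]] by blast
    then show ?thesis by (auto simp: ideal_hull_def)
  qed
  then have "openin (jacobson_topology B) (primitive_ideals B)"
    unfolding openin_jacobson[OF B] using closed_ideals_self[OF B] by auto
  then show "primitive_ideals B \<subseteq> topspace (jacobson_topology B)" by (rule openin_subset)
qed

lemma closedin_hull:
  assumes B: "cstar_subalgebra B" and I: "I \<in> closed_ideals B"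
  shows "closedin (jacobson_topology B) (ideal_hull B I)"
proof -
  have "primitive_ideals B - (primitive_ideals B - ideal_hull B I) = ideal_hull B I"
    by (auto simp: ideal_hull_def)
  moreover have "ideal_hull B I \<subseteq> primitive_ideals B" by (auto simp: ideal_hull_def)
  ultimately show ?thesis
    unfolding closedin_def topspace_jacobson[OF B] openin_jacobson[OF B] using I by blast
qed

lemma openin_not_mem:
  assumes B: "cstar_subalgebra B" and x: "x \<in> B"
  shows "openin (jacobson_topology B) {J \<in> primitive_ideals B. x \<notin> J}"
proof -
  have "primitive_ideals B - {J \<in> primitive_ideals B. x \<notin> J} = ideal_hull B (generated_ideal B {x})"
    unfolding hull_generated_ideal[OF B] by auto
  moreover have "generated_ideal B {x} \<in> closed_ideals B" using generated_ideal_closed[OF B] x by simp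
  ultimately show ?thesis unfolding openin_jacobson[OF B] by blast
qed

text \<open>Because of this equivalence, the distances of squares of self-adjoint elements determine a closed
  ideal.\<close>

lemma infdist_square_pos_iff:
  assumes B: "cstar_subalgebra B" and I: "I \<in> closed_ideals B" and y: "y \<in> B" "star y = y"
  shows "0 < infdist (y * y) I \<longleftrightarrow> y \<notin> I"
proof -
  have "I \<noteq> {}" using closed_idealD(1)[OF I] by blast
  then have "y * y \<in> I \<longleftrightarrow> infdist (y * y) I = 0"
    by (rule in_closed_iff_infdist_zero[OF closed_idealD(8)[OF I]])
  moreover have "y * y \<in> I \<longleftrightarrow> y \<in> I"
    using square_mem_ideal[OF B I y] closed_idealD(6)[OF I y(1)] by blast
  ultimately show ?thesis using infdist_nonneg[of "y * y" I] by linarith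
qed

lemma exists_selfadjoint_not_mem:
  assumes B: "cstar_subalgebra B" and L: "L \<in> closed_ideals B" and I: "I \<in> closed_ideals A" and "\<not> L \<subseteq> I"
  obtains y where "y \<in> L" "star y = y" "y \<notin> I"
proof -
  obtain l where l: "l \<in> L" "l \<notin> I" using assms(4) by blast
  have "selfadjoint_part l \<in> L" "imaginary_part l \<in> L"
    using l(1) closed_ideal_star[OF B L l(1)] closed_idealD[OF L]
    by (auto simp: selfadjoint_part_def imaginary_part_def)
  moreover have "selfadjoint_part l \<notin> I \<or> imaginary_part l \<notin> I"
  proof (rule ccontr)
    assume "\<not> ?thesis"
    then have "selfadjoint_part l + \<i> *\<^sub>C imaginary_part l \<in> I"
      by (intro closed_idealD(2)[OF I] closed_idealD(4)[OF I]) auto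
    then show False using l(2) unfolding parts_decomposition[symmetric] by blast
  qed
  ultimately show ?thesis using that star_selfadjoint_part star_imaginary_part by blast
qed

text \<open>If \<open>L\<close> is not contained in \<open>I\<close>, take a self-adjoint \<open>y\<close> in \<open>L\<close> outside \<open>I\<close>. A primitive ideal at which the
  distance of \<open>y\<^sup>2\<close> to \<open>I\<close> is attained contains \<open>I\<close> but not \<open>y\<close>.\<close>

lemma hull_subset_iff:
  assumes B: "cstar_subalgebra B" and I: "I \<in> closed_ideals B" and L: "L \<in> closed_ideals B"
  shows "ideal_hull B I \<subseteq> ideal_hull B L \<longleftrightarrow> L \<subseteq> I"
proof
  assume sub: "ideal_hull B I \<subseteq> ideal_hull B L"
  show "L \<subseteq> I"
  proof (rule ccontr)
    assume "\<not> L \<subseteq> I"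
    then obtain y where y: "y \<in> L" "star y = y" "y \<notin> I"
      by (rule exists_selfadjoint_not_mem[OF B L I])
    have yB: "y \<in> B" by (rule closed_idealD(9)[OF L y(1)])
    have d: "0 < infdist (y * y) I" using infdist_square_pos_iff[OF B I yB y(2)] y(3) by blast
    obtain J where J: "J \<in> primitive_ideals B" "I \<subseteq> J" "infdist (y * y) I \<le> infdist (y * y) J"
      using exists_primitive_ideal_attaining_infdist[OF B I yB y(2) d] .
    then have "y \<notin> J" using infdist_square_pos_iff[OF B primitive_closed_ideal[OF B J(1)] yB y(2)] d by linarith
    then show False using sub J(1,2) y(1) by (auto simp: ideal_hull_def)
  qed
qed (auto simp: ideal_hull_def)

lemma closure_two_sided_ideal:
  fixes J :: "'a::cstar_algebra set"
  assumes J: "two_sided_ideal R J"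
  shows "closure J \<in> closed_ideals (closure R)"
proof -
  have sub: "complex_vector.subspace J" and JR: "J \<subseteq> R" and id: "\<And>a x. a \<in> R \<Longrightarrow> x \<in> J \<Longrightarrow> a * x \<in> J \<and> x * a \<in> J"
    using J by (auto simp: two_sided_ideal_def)
  have sc: "bounded_linear (\<lambda>x::'a. c *\<^sub>C x)" for c
    by (rule bounded_linear_intro[where K="cmod c"])
      (simp_all add: scaleC_add_right scaleR_scaleC scaleC_scaleC norm_scaleC mult.commute)
  have "complex_vector.subspace (closure J)"
  proof (rule complex_vector.subspaceI)
    show "0 \<in> closure J" using complex_vector.subspace_0[OF sub] closure_subset by blast
    fix x y and c :: complex assume "x \<in> closure J"
    then obtain s where s: "\<And>n. s n \<in> J" "s \<longlonglongrightarrow> x" by (auto simp: closure_sequential)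
    show "c *\<^sub>C x \<in> closure J"
      unfolding closure_sequential
      using complex_vector.subspace_scale[OF sub s(1)] bounded_linear.tendsto[OF sc s(2)]
      by (intro exI[of _ "\<lambda>n. c *\<^sub>C s n"]) auto
    assume "y \<in> closure J"
    then obtain t where t: "\<And>n. t n \<in> J" "t \<longlonglongrightarrow> y" by (auto simp: closure_sequential)
    show "x + y \<in> closure J"
      unfolding closure_sequential
      using complex_vector.subspace_add[OF sub s(1) t(1)] tendsto_add[OF s(2) t(2)]
      by (intro exI[of _ "\<lambda>n. s n + t n"]) auto
  qed
  moreover have "a * x \<in> closure J \<and> x * a \<in> closure J" if ax: "a \<in> closure R" "x \<in> closure J" for a x
  proof -
    obtain s where s: "\<And>n. s n \<in> R" "s \<longlonglongrightarrow> a" using ax(1) by (auto simp: closure_sequential)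
    obtain t where t: "\<And>n. t n \<in> J" "t \<longlonglongrightarrow> x" using ax(2) by (auto simp: closure_sequential)
    have "\<forall>n. s n * t n \<in> J" "\<forall>n. t n * s n \<in> J" using id[OF s(1) t(1)] by blast+
    then show ?thesis
      unfolding closure_sequential using tendsto_mult[OF s(2) t(2)] tendsto_mult[OF t(2) s(2)] by meson
  qed
  ultimately show ?thesis
    using closure_mono[OF JR] by (auto simp: closed_ideals_def two_sided_ideal_def)
qed

text \<open>
  Suppose that the complements of the hulls of ideals \<open>I V\<close> cover the set. Then the distance of \<open>y\<^sup>2\<close> to
  the closed ideal generated by all the \<open>I V\<close> is less than \<open>r\<close>, because it is attained at a primitive
  ideal containing them. An approximating element involves only finitely many of the \<open>I V\<close>, and these
  give the finite subcover.
\<close>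

lemma compactin_infdist_ge:
  assumes B: "cstar_subalgebra B" and y: "y \<in> B" "star y = y" and r: "0 < r"
  shows "compactin (jacobson_topology B) {J \<in> primitive_ideals B. r \<le> infdist (y * y) J}" (is "compactin _ ?K")
  unfolding compactin_def
proof (intro conjI allI impI)
  show "?K \<subseteq> topspace (jacobson_topology B)" by (auto simp: topspace_jacobson[OF B])
  fix \<U> assume "(\<forall>V\<in>\<U>. openin (jacobson_topology B) V) \<and> ?K \<subseteq> \<Union>\<U>"
  then have op: "\<forall>V\<in>\<U>. openin (jacobson_topology B) V" and cov: "?K \<subseteq> \<Union>\<U>" by blast+
  from op obtain I where I: "\<And>V. V \<in> \<U> \<Longrightarrow> I V \<in> closed_ideals B"
    "\<And>V. V \<in> \<U> \<Longrightarrow> primitive_ideals B - V = ideal_hull B (I V)"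
    unfolding openin_jacobson[OF B] by metis
  define G where "G \<F> = generated_ideal B (\<Union>V\<in>\<F>. I V)" for \<F>
  have sB: "(\<Union>V\<in>\<F>. I V) \<subseteq> B" if "\<F> \<subseteq> \<U>" for \<F>
    using closed_idealD(9)[OF I(1)] that by blast
  have G: "G \<F> \<in> closed_ideals B" if "\<F> \<subseteq> \<U>" for \<F>
    unfolding G_def by (rule generated_ideal_closed[OF B sB[OF that]])
  have Gmono: "G \<F> \<subseteq> G \<F>'" if "\<F> \<subseteq> \<F>'" "\<F>' \<subseteq> \<U>" for \<F> \<F>'
    unfolding G_def using that generated_ideal_superset[of "\<Union>V\<in>\<F>'. I V" B]
    by (intro generated_ideal_least generated_ideal_closed[OF B sB]) auto
  define W where "W = (\<Union>\<F>\<in>{\<F>. finite \<F> \<and> \<F> \<subseteq> \<U>}. G \<F>)"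
  have two: "\<exists>\<F>. finite \<F> \<and> \<F> \<subseteq> \<U> \<and> a \<in> G \<F> \<and> b \<in> G \<F>" if ab: "a \<in> W" "b \<in> W" for a b
  proof -
    obtain \<F> \<F>' where F: "finite \<F>" "\<F> \<subseteq> \<U>" "a \<in> G \<F>" "finite \<F>'" "\<F>' \<subseteq> \<U>" "b \<in> G \<F>'"
      using ab by (auto simp: W_def)
    then have "a \<in> G (\<F> \<union> \<F>')" "b \<in> G (\<F> \<union> \<F>')"
      using Gmono[of \<F> "\<F> \<union> \<F>'"] Gmono[of \<F>' "\<F> \<union> \<F>'"] by auto
    then show ?thesis using F by (intro exI[of _ "\<F> \<union> \<F>'"]) auto
  qed
  have "two_sided_ideal B W"
    unfolding two_sided_ideal_def
  proof (intro conjI ballI)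
    show "W \<subseteq> B" using closed_idealD(9)[OF G] by (auto simp: W_def)
    show "complex_vector.subspace W"
    proof (rule complex_vector.subspaceI)
      show "0 \<in> W" using closed_idealD(1)[OF G[of "{}"]] by (auto simp: W_def)
      show "a + b \<in> W" if "a \<in> W" "b \<in> W" for a b
        using two[OF that] closed_idealD(2)[OF G] by (auto simp: W_def)
      show "c *\<^sub>C a \<in> W" if "a \<in> W" for c a
        using that closed_idealD(4)[OF G] by (auto simp: W_def)
    qed
    fix a b assume "a \<in> B" "b \<in> W"
    then show "a * b \<in> W" "b * a \<in> W"
      using closed_idealD(6)[OF G] closed_idealD(7)[OF G] by (auto simp: W_def)
  qed
  from closure_two_sided_ideal[OF this]
  have L: "closure W \<in> closed_ideals B" using cstar_subalgebraD(8)[OF B] by simp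
  have lt: "infdist (y * y) (closure W) < r"
  proof (rule ccontr)
    assume "\<not> ?thesis"
    then have rl: "r \<le> infdist (y * y) (closure W)" by simp
    then have pos: "0 < infdist (y * y) (closure W)" using r by linarith
    obtain J where J: "J \<in> primitive_ideals B" "closure W \<subseteq> J"
      "infdist (y * y) (closure W) \<le> infdist (y * y) J"
      using exists_primitive_ideal_attaining_infdist[OF B L y pos] .
    then have "J \<in> ?K" using rl by simp
    then obtain V where V: "V \<in> \<U>" "J \<in> V" using cov by blast
    have "I V \<subseteq> G {V}" unfolding G_def using generated_ideal_superset[of "I V" B] by simp
    also have "\<dots> \<subseteq> W" using V by (auto simp: W_def)
    finally have "I V \<subseteq> J" using J(2) closure_subset[of W] by blast
    then have "J \<in> primitive_ideals B - V" unfolding I(2)[OF V(1)] using J(1) by (simp add: ideal_hull_def)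
    then show False using V by blast
  qed
  have "closure W \<noteq> {}" using closed_idealD(1)[OF L] by (metis empty_iff)
  then obtain l where l: "l \<in> closure W" "norm (y * y - l) < r"
    using infdist_less_obtains[OF lt] by metis
  then obtain w where w: "w \<in> W" "dist w l < r - norm (y * y - l)"
    unfolding closure_approachable by (metis diff_gt_0_iff_gt)
  have "dist (y * y) w \<le> norm (y * y - l) + dist w l"
    using dist_triangle[of "y * y" w l] by (simp add: dist_norm norm_minus_commute)
  then have wr: "dist (y * y) w < r" using w(2) by simp
  obtain \<F> where F: "finite \<F>" "\<F> \<subseteq> \<U>" "w \<in> G \<F>" using w(1) by (auto simp: W_def)
  have "?K \<subseteq> \<Union>\<F>"
  proof
    fix J assume J: "J \<in> ?K"
    show "J \<in> \<Union>\<F>"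
    proof (rule ccontr)
      assume n: "J \<notin> \<Union>\<F>"
      have "I V \<subseteq> J" if V: "V \<in> \<F>" for V
      proof -
        have "J \<in> primitive_ideals B - V" using J n V by auto
        then show ?thesis using I(2)[of V] F(2) V by (auto simp: ideal_hull_def)
      qed
      then have "G \<F> \<subseteq> J"
        unfolding G_def using J by (intro generated_ideal_least primitive_closed_ideal[OF B]) auto
      then have "infdist (y * y) J \<le> dist (y * y) w" using F(3) by (intro infdist_le) auto
      then show False using J wr by simp
    qed
  qed
  then show "\<exists>\<F>. finite \<F> \<and> \<F> \<subseteq> \<U> \<and> ?K \<subseteq> \<Union>\<F>" using F by blast
qed

section \<open>The Fell topology and distances\<close>

lemma topspace_fell_ideal:
  assumes B: "cstar_subalgebra B"
  shows "topspace (fell_ideal_topology B) = closed_ideals B"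
proof -
  have "Y \<in> topspace (fell_topology X)" if "closedin X Y" for X and Y :: "'b set"
  proof -
    have "Y \<in> fell_basic X {} {}" using that by (simp add: fell_basic_def)
    moreover have "fell_basic X {} {} \<in> {fell_basic X K F | K F. compactin X K \<and> finite F \<and> (\<forall>A\<in>F. openin X A \<and> A \<noteq> {})}"
      by (intro CollectI exI[of _ "{}"]) auto
    ultimately show ?thesis unfolding fell_topology_def topology_generated_by_topspace by (rule UnionI[rotated])
  qed
  then show ?thesis
    using closedin_hull[OF B] by (auto simp: fell_ideal_topology_def topspace_pullback_topology)
qed

lemma openin_fell_ideal_basic:
  assumes B: "cstar_subalgebra B" and K: "compactin (jacobson_topology B) K" and F: "finite F"
    and A: "\<And>A. A \<in> F \<Longrightarrow> openin (jacobson_topology B) A \<and> A \<noteq> {}"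
  shows "openin (fell_ideal_topology B)
    {I \<in> closed_ideals B. ideal_hull B I \<inter> K = {} \<and> (\<forall>A\<in>F. ideal_hull B I \<inter> A \<noteq> {})}"
proof -
  have "openin (fell_topology (jacobson_topology B)) (fell_basic (jacobson_topology B) K F)"
    unfolding fell_topology_def by (rule topology_generated_by_Basis) (use K F A in blast)
  moreover have "{I \<in> closed_ideals B. ideal_hull B I \<inter> K = {} \<and> (\<forall>A\<in>F. ideal_hull B I \<inter> A \<noteq> {})} =
      ideal_hull B -` fell_basic (jacobson_topology B) K F \<inter> closed_ideals B"
    using closedin_hull[OF B] by (auto simp: fell_basic_def)
  ultimately show ?thesis unfolding fell_ideal_topology_def openin_pullback_topology by blast
qed

text \<open>
  Upper semicontinuity rests on the compactness of the sets \<open>{J. r \<le> infdist x J}\<close>, lower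
  semicontinuity on the soft thresholds.
\<close>

lemma continuous_map_infdist:
  assumes B: "cstar_subalgebra B" and y: "y \<in> B" "star y = y"
  shows "continuous_map (fell_ideal_topology B) euclideanreal (\<lambda>I. infdist (y * y) I)"
  unfolding continuous_map_upper_lower_semicontinuous_lt topspace_fell_ideal[OF B]
proof (intro conjI allI)
  define x where "x = y * y"
  have x: "star x = x" "x \<in> B" using y cstar_subalgebraD[OF B] by (simp_all add: x_def star_mult)
  fix a :: real
  show "openin (fell_ideal_topology B) {I \<in> closed_ideals B. infdist (y * y) I < a}"
  proof (cases "0 < a")
    case True
    define K where "K = {J \<in> primitive_ideals B. a \<le> infdist (y * y) J}"
    have "infdist (y * y) I < a \<longleftrightarrow> ideal_hull B I \<inter> K = {}" if I: "I \<in> closed_ideals B" for I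
    proof
      assume lt: "infdist (y * y) I < a"
      have "I \<noteq> {}" using closed_idealD(1)[OF I] by blast
      have "infdist (y * y) J < a" if "J \<in> ideal_hull B I" for J
        using infdist_mono[of I J "y * y"] that lt \<open>I \<noteq> {}\<close> by (auto simp: ideal_hull_def)
      then show "ideal_hull B I \<inter> K = {}" by (force simp: K_def)
    next
      assume e: "ideal_hull B I \<inter> K = {}"
      show "infdist (y * y) I < a"
      proof (rule ccontr)
        assume "\<not> infdist (y * y) I < a"
        then have "0 < infdist (y * y) I" "a \<le> infdist (y * y) I" using True by linarith+
        moreover from this obtain J where "J \<in> primitive_ideals B" "I \<subseteq> J" "infdist (y * y) I \<le> infdist (y * y) J"
          using exists_primitive_ideal_attaining_infdist[OF B I y] by metis
        ultimately have "J \<in> ideal_hull B I \<inter> K" by (simp add: ideal_hull_def K_def)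
        then show False using e by blast
      qed
    qed
    then have "{I \<in> closed_ideals B. infdist (y * y) I < a} =
        {I \<in> closed_ideals B. ideal_hull B I \<inter> K = {} \<and> (\<forall>A\<in>{}. ideal_hull B I \<inter> A \<noteq> {})}" by auto
    then show ?thesis
      using openin_fell_ideal_basic[OF B compactin_infdist_ge[OF B y True], of "{}"] by (simp add: K_def)
  next
    case False
    have "\<not> infdist (y * y) I < a" for I :: "'a set" using False infdist_nonneg[of "y * y" I] by linarith
    then show ?thesis by simp
  qed
  show "openin (fell_ideal_topology B) {I \<in> closed_ideals B. infdist (y * y) I > a}"
  proof (cases "0 \<le> a")
    case True
    define Q where "Q r = {J \<in> primitive_ideals B. soft_threshold r x \<notin> J}" for r
    have opQ: "openin (jacobson_topology B) (Q r)" if "r > 0" for r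
      unfolding Q_def by (rule openin_not_mem[OF B soft_threshold_mem[OF x(1) that B x(2)]])
    have mem: "ideal_hull B I \<inter> Q r \<noteq> {} \<longleftrightarrow> soft_threshold r x \<notin> I" if r: "r > 0" and I: "I \<in> closed_ideals B" for r I
    proof -
      define L where "L = generated_ideal B {soft_threshold r x}"
      have L: "L \<in> closed_ideals B"
        unfolding L_def using soft_threshold_mem[OF x(1) r B x(2)] by (intro generated_ideal_closed[OF B]) simp
      have "ideal_hull B L = {J \<in> primitive_ideals B. soft_threshold r x \<in> J}"
        unfolding L_def hull_generated_ideal[OF B] by simp
      then have "ideal_hull B I \<inter> Q r = {} \<longleftrightarrow> ideal_hull B I \<subseteq> ideal_hull B L"
        by (auto simp: Q_def ideal_hull_def)
      also have "\<dots> \<longleftrightarrow> L \<subseteq> I" by (rule hull_subset_iff[OF B I L])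
      also have "\<dots> \<longleftrightarrow> soft_threshold r x \<in> I"
        unfolding L_def using generated_ideal_superset generated_ideal_least[OF I] by blast
      finally show ?thesis by blast
    qed
    have "a < infdist (y * y) I \<longleftrightarrow> (\<exists>r>a. soft_threshold r x \<notin> I)" if I: "I \<in> closed_ideals B" for I
    proof
      assume "a < infdist (y * y) I"
      then obtain r where r: "a < r" "r < infdist (y * y) I" using dense by blast
      then have "soft_threshold r x \<notin> I"
        using infdist_le_of_soft_threshold_mem[OF x(1), of r I] True by (auto simp: x_def)
      then show "\<exists>r>a. soft_threshold r x \<notin> I" using r by blast
    next
      assume "\<exists>r>a. soft_threshold r x \<notin> I"
      then obtain r where r: "a < r" "soft_threshold r x \<notin> I" by blast
      then have "\<not> infdist x I < r"
        using soft_threshold_mem_ideal[OF x(1) _ B x(2) I, of r] True by auto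
      then show "a < infdist (y * y) I" using r by (simp add: x_def)
    qed
    then have "{I \<in> closed_ideals B. infdist (y * y) I > a} =
        \<Union> ((\<lambda>r. {I \<in> closed_ideals B. soft_threshold r x \<notin> I}) ` {a<..})" by auto
    moreover have "openin (fell_ideal_topology B) {I \<in> closed_ideals B. soft_threshold r x \<notin> I}" if "r \<in> {a<..}" for r
    proof -
      have r: "r > 0" using that True by simp
      have eq: "{I \<in> closed_ideals B. soft_threshold r x \<notin> I} =
          {I \<in> closed_ideals B. ideal_hull B I \<inter> {} = {} \<and> (\<forall>A\<in>{Q r}. ideal_hull B I \<inter> A \<noteq> {})}"
        using mem[OF r] by auto
      show ?thesis
      proof (cases "Q r = {}")
        case True
        then have "{I \<in> closed_ideals B. soft_threshold r x \<notin> I} = {}" using mem[OF r] by auto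
        then show ?thesis by (simp only: openin_empty)
      next
        case False
        show ?thesis unfolding eq
          by (rule openin_fell_ideal_basic[OF B]) (use False opQ[OF r] in auto)
      qed
    qed
    ultimately show ?thesis by (metis (no_types, lifting) openin_Union image_iff)
  next
    case False
    have "a < infdist (y * y) I" for I :: "'a set" using False infdist_nonneg[of "y * y" I] by linarith
    then have "{I \<in> closed_ideals B. infdist (y * y) I > a} = topspace (fell_ideal_topology B)"
      by (simp add: topspace_fell_ideal[OF B])
    then show ?thesis by simp
  qed
qed

text \<open>
  The converse, that the Fell topology is the coarsest one with this property, uses the following. If
  the hull of \<open>I\<close> misses a compact set \<open>K\<close>, then finitely many elements of \<open>I\<close> suffice to avoid all
  members of \<open>K\<close>. The sum \<open>y\<close> of the \<open>a\<^sup>* a\<close> over these does so alone, and by compactness the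
  distances of \<open>y\<^sup>2\<close> are bounded below on \<open>K\<close>.
\<close>

lemma hull_disjoint_compact_witness:
  assumes B: "cstar_subalgebra B" and I: "I \<in> closed_ideals B"
    and K: "compactin (jacobson_topology B) K" and disj: "ideal_hull B I \<inter> K = {}"
  obtains y r where "y \<in> I" "star y = y" "0 < r" "\<And>J. J \<in> K \<Longrightarrow> r \<le> infdist (y * y) J"
proof -
  have KP: "K \<subseteq> primitive_ideals B" using compactin_subset_topspace[OF K] by (simp add: topspace_jacobson[OF B])
  note IB = closed_idealD(9)[OF I]
  note mem = cstar_subalgebraD[OF B]
  define M where "M a = {J \<in> primitive_ideals B. a \<notin> J}" for a
  have "K \<subseteq> \<Union> (M ` I)" using KP disj by (auto simp: M_def ideal_hull_def)
  moreover have "\<And>V. V \<in> M ` I \<Longrightarrow> openin (jacobson_topology B) V"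
    using openin_not_mem[OF B] IB by (auto simp: M_def)
  ultimately obtain \<F> where \<F>: "finite \<F>" "\<F> \<subseteq> M ` I" "K \<subseteq> \<Union>\<F>" using compactinD[OF K] by metis
  obtain S where S: "S \<subseteq> I" "finite S" "\<F> = M ` S" using finite_subset_image[OF \<F>(1,2)] by metis
  define y where "y = (\<Sum>a\<in>S. star a * a)"
  have SB: "S \<subseteq> B" using S IB by blast
  have yI: "y \<in> I"
    unfolding y_def using S(2,1)
    by (induction S) (use closed_idealD[OF I] mem IB in auto)
  have ys: "star y = y"
    unfolding y_def using S(2) by (induction S) (simp_all add: star_add star_mult star_star)
  have yB: "y \<in> B" by (rule IB[OF yI])
  have ynot: "y \<notin> J" if J: "J \<in> K" for J
  proof
    assume "y \<in> J"
    then have "S \<subseteq> J" using primitive_sum_mem[OF B subsetD[OF KP J] S(2) SB] by (simp add: y_def)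
    moreover obtain a where "a \<in> S" "a \<notin> J" using \<F>(3) J S(3) by (auto simp: M_def)
    ultimately show False by blast
  qed
  define x where "x = y * y"
  have x: "star x = x" "x \<in> B" using ys yB mem by (simp_all add: x_def star_mult)
  define T where "T n = {J \<in> primitive_ideals B. soft_threshold (inverse (real (Suc n))) x \<notin> J}" for n
  have sB: "soft_threshold (inverse (real (Suc n))) x \<in> B" for n
    by (rule soft_threshold_mem[OF x(1) _ B x(2)]) simp
  have "openin (jacobson_topology B) (T n)" for n
    unfolding T_def by (rule openin_not_mem[OF B sB])
  then have op: "\<And>V. V \<in> range T \<Longrightarrow> openin (jacobson_topology B) V" by blast
  have Tge: "inverse (real (Suc n)) \<le> infdist x J" if J: "J \<in> T n" for n J
  proof (rule ccontr)
    assume "\<not> inverse (real (Suc n)) \<le> infdist x J"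
    then have "soft_threshold (inverse (real (Suc n))) x \<in> J"
      using J by (intro soft_threshold_mem_ideal[OF x(1) _ B x(2) primitive_closed_ideal[OF B]]) (auto simp: T_def)
    then show False using J by (simp add: T_def)
  qed
  have "K \<subseteq> \<Union> (range T)"
  proof
    fix J assume J: "J \<in> K"
    have JP: "J \<in> primitive_ideals B" using J KP by blast
    have "0 < infdist x J"
      using infdist_square_pos_iff[OF B primitive_closed_ideal[OF B JP] yB ys] ynot[OF J] by (simp add: x_def)
    then obtain n where n: "inverse (real (Suc n)) < infdist x J" using reals_Archimedean by blast
    then have "soft_threshold (inverse (real (Suc n))) x \<notin> J"
      using infdist_le_of_soft_threshold_mem[OF x(1), of "inverse (real (Suc n))" J] by auto
    then show "J \<in> \<Union> (range T)" using JP by (auto simp: T_def)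
  qed
  then obtain \<G> where \<G>: "finite \<G>" "\<G> \<subseteq> range T" "K \<subseteq> \<Union>\<G>" using compactinD[OF K op] by metis
  obtain E where E: "finite E" "\<G> = T ` E" using finite_subset_image[OF \<G>(1,2)] by metis
  define N where "N = (\<Sum>n\<in>E. n)"
  define r where "r = inverse (real (Suc N))"
  have "r \<le> infdist (y * y) J" if J: "J \<in> K" for J
  proof -
    obtain n where n: "n \<in> E" "J \<in> T n" using \<G>(3) J E(2) by blast
    have "n \<le> N" using member_le_sum[OF n(1), of "\<lambda>n. n"] E(1) by (simp add: N_def)
    then have "r \<le> inverse (real (Suc n))" unfolding r_def by (intro le_imp_inverse_le) auto
    also have "\<dots> \<le> infdist x J" by (rule Tge[OF n(2)])
    finally show ?thesis by (simp add: x_def)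
  qed
  then show thesis using that[OF yI ys, of r] by (simp add: r_def)
qed

lemma continuous_map_into_fell_ideal:
  assumes B: "cstar_subalgebra B" and g: "\<And>t. t \<in> topspace T \<Longrightarrow> g t \<in> closed_ideals B"
    and cont: "\<And>y. y \<in> B \<Longrightarrow> star y = y \<Longrightarrow> continuous_map T euclideanreal (\<lambda>t. infdist (y * y) (g t))"
  shows "continuous_map T (fell_ideal_topology B) g"
  unfolding fell_ideal_topology_def
proof (rule continuous_map_pullback')
  let ?X = "jacobson_topology B"
  show "topspace T \<subseteq> g -` closed_ideals B" using g by blast
  have lt: "openin T {t \<in> topspace T. infdist (y * y) (g t) < a}" "openin T {t \<in> topspace T. a < infdist (y * y) (g t)}"
    if "y \<in> B" "star y = y" for y a
    using cont[OF that] unfolding continuous_map_upper_lower_semicontinuous_lt by blast+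
  have opK: "openin T {t \<in> topspace T. ideal_hull B (g t) \<inter> K = {}}" (is "openin T ?S")
    if K: "compactin ?X K" for K
  proof (subst openin_subopen, intro ballI)
    fix t assume t: "t \<in> ?S"
    then have gt: "g t \<in> closed_ideals B" using g by blast
    obtain y r where y: "y \<in> g t" "star y = y" and r: "0 < r" "\<And>J. J \<in> K \<Longrightarrow> r \<le> infdist (y * y) J"
      using hull_disjoint_compact_witness[OF B gt K] t by blast
    have yB: "y \<in> B" by (rule closed_idealD(9)[OF gt y(1)])
    define W where "W = {t \<in> topspace T. infdist (y * y) (g t) < r}"
    have "y * y \<in> g t" by (rule closed_idealD(6)[OF gt yB y(1)])
    then have "t \<in> W" using t r by (simp add: W_def)
    moreover have "W \<subseteq> ?S"
    proof
      fix u assume u: "u \<in> W"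
      then have gu: "g u \<in> closed_ideals B" using g by (simp add: W_def)
      have "infdist (y * y) J < r" if "J \<in> ideal_hull B (g u)" for J
      proof -
        have "g u \<noteq> {}" using closed_idealD(1)[OF gu] by blast
        then show ?thesis using infdist_mono[of "g u" J "y * y"] that u by (auto simp: W_def ideal_hull_def)
      qed
      then show "u \<in> ?S" using u r(2) by (force simp: W_def)
    qed
    moreover have "openin T W" unfolding W_def by (rule lt[OF yB y(2)])
    ultimately show "\<exists>W. openin T W \<and> t \<in> W \<and> W \<subseteq> ?S" by blast
  qed
  have opA: "openin T {t \<in> topspace T. ideal_hull B (g t) \<inter> A \<noteq> {}}" (is "openin T ?S")
    if A: "openin ?X A" for A
  proof (subst openin_subopen, intro ballI)
    obtain L where L: "L \<in> closed_ideals B" "primitive_ideals B - A = ideal_hull B L" "A \<subseteq> primitive_ideals B"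
      using A unfolding openin_jacobson[OF B] by blast
    have iff: "ideal_hull B I \<inter> A \<noteq> {} \<longleftrightarrow> \<not> L \<subseteq> I" if "I \<in> closed_ideals B" for I
    proof -
      have "ideal_hull B I \<inter> A = {} \<longleftrightarrow> ideal_hull B I \<subseteq> ideal_hull B L"
        unfolding L(2)[symmetric] by (auto simp: ideal_hull_def)
      then show ?thesis using hull_subset_iff[OF B that L(1)] by simp
    qed
    fix t assume t: "t \<in> ?S"
    then have gt: "g t \<in> closed_ideals B" using g by blast
    then have "\<not> L \<subseteq> g t" using iff t by blast
    then obtain y where y: "y \<in> L" "star y = y" "y \<notin> g t"
      by (rule exists_selfadjoint_not_mem[OF B L(1) gt])
    have yB: "y \<in> B" by (rule closed_idealD(9)[OF L(1) y(1)])
    define W where "W = {t \<in> topspace T. 0 < infdist (y * y) (g t)}"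
    have W: "u \<in> W \<longleftrightarrow> u \<in> topspace T \<and> y \<notin> g u" for u
      using infdist_square_pos_iff[OF B g yB y(2)] by (auto simp: W_def)
    have "t \<in> W" using W t y by blast
    moreover have "W \<subseteq> ?S" using W iff g y(1) by blast
    moreover have "openin T W" unfolding W_def by (rule lt[OF yB y(2)])
    ultimately show "\<exists>W. openin T W \<and> t \<in> W \<and> W \<subseteq> ?S" by blast
  qed
  show "continuous_map T (fell_topology ?X) (ideal_hull B \<circ> g)"
    unfolding fell_topology_def
  proof (rule continuous_on_generated_topo)
    fix V assume "V \<in> {fell_basic ?X K F | K F. compactin ?X K \<and> finite F \<and> (\<forall>A\<in>F. openin ?X A \<and> A \<noteq> {})}"
    then obtain K F where K: "compactin ?X K" and F: "finite F" "\<forall>A\<in>F. openin ?X A" and V: "V = fell_basic ?X K F"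
      by blast
    have "(ideal_hull B \<circ> g) -` V \<inter> topspace T =
        \<Inter> (insert {t \<in> topspace T. ideal_hull B (g t) \<inter> K = {}}
          ((\<lambda>A. {t \<in> topspace T. ideal_hull B (g t) \<inter> A \<noteq> {}}) ` F))"
      using closedin_hull[OF B g] by (auto simp: V fell_basic_def)
    moreover have "openin T \<dots>"
      by (rule openin_Inter) (use F opA opK[OF K] in auto)
    ultimately show "openin T ((ideal_hull B \<circ> g) -` V \<inter> topspace T)" by simp
  next
    show "(ideal_hull B \<circ> g) ` topspace T \<subseteq> \<Union> {fell_basic ?X K F | K F. compactin ?X K \<and> finite F \<and> (\<forall>A\<in>F. openin ?X A \<and> A \<noteq> {})}"
    proof
      fix Y assume "Y \<in> (ideal_hull B \<circ> g) ` topspace T"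
      then have "closedin ?X Y" using closedin_hull[OF B g] by auto
      then have "Y \<in> fell_basic ?X {} {}" by (simp add: fell_basic_def)
      moreover have "fell_basic ?X {} {} \<in> {fell_basic ?X K F | K F. compactin ?X K \<and> finite F \<and> (\<forall>A\<in>F. openin ?X A \<and> A \<noteq> {})}"
        by (intro CollectI exI[of _ "{}"]) auto
      ultimately show "Y \<in> \<Union> {fell_basic ?X K F | K F. compactin ?X K \<and> finite F \<and> (\<forall>A\<in>F. openin ?X A \<and> A \<noteq> {})}"
        by (rule UnionI[rotated])
    qed
  qed
qed

section \<open>Traces on subalgebras\<close>

lemma trace_closed_ideal:
  assumes A: "cstar_subalgebra A" and B: "cstar_subalgebra B" "B \<subseteq> A" and I: "I \<in> closed_ideals A"
  shows "I \<inter> B \<in> closed_ideals B"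
proof -
  have "complex_vector.subspace (I \<inter> B)"
    using I B(1) by (intro complex_vector.subspace_inter) (auto simp: closed_ideals_def two_sided_ideal_def cstar_subalgebra_def)
  then show ?thesis
    using closed_idealD(6,7)[OF I] cstar_subalgebraD(6)[OF B(1)] B(2)
      closed_Int[OF closed_idealD(8)[OF I] cstar_subalgebraD(8)[OF B(1)]]
    by (auto simp: closed_ideals_def two_sided_ideal_def)
qed

text \<open>The soft threshold of \<open>x\<close> lies in both the subalgebra and the ideal.\<close>

lemma infdist_trace:
  assumes A: "cstar_subalgebra A" and B: "cstar_subalgebra B" "B \<subseteq> A" and I: "I \<in> closed_ideals A"
    and x: "x \<in> B" "star x = x"
  shows "infdist x (I \<inter> B) = infdist x I"
proof (rule antisym)
  have IB: "I \<inter> B \<noteq> {}" using closed_idealD(1)[OF I] cstar_subalgebraD(1)[OF B(1)] by blast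
  show "infdist x I \<le> infdist x (I \<inter> B)" by (rule infdist_mono) (use IB in auto)
  show "infdist x (I \<inter> B) \<le> infdist x I"
  proof (rule field_le_epsilon)
    fix e :: real assume e: "0 < e"
    define r where "r = infdist x I + e"
    have r: "0 < r" "infdist x I < r" using e infdist_nonneg[of x I] by (simp_all add: r_def add_nonneg_pos)
    have "soft_threshold r x \<in> I" using x B by (intro soft_threshold_mem_ideal[OF x(2) r(1) A _ I r(2)]) auto
    moreover have "soft_threshold r x \<in> B" by (rule soft_threshold_mem[OF x(2) r(1) B(1) x(1)])
    ultimately show "infdist x (I \<inter> B) \<le> infdist x I + e"
      using infdist_le_of_soft_threshold_mem[OF x(2) r(1), of "I \<inter> B"] by (simp add: r_def)
  qed
qed

lemma cstar_subalgebra_UNIV: "cstar_subalgebra (UNIV :: 'a::cstar_algebra set)"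
  by (simp add: cstar_subalgebra_def complex_vector.subspace_UNIV)

context
  fixes U :: "nat \<Rightarrow> 'a::cstar_algebra set"
  assumes U: "\<And>n. cstar_subalgebra (U n)" and inc: "incseq U" and dense: "closure (\<Union>n. U n) = UNIV"
begin

lemma selfadjoint_approximation:
  fixes y :: 'a
  assumes y: "star y = y"
  obtains s where "\<And>k. s k \<in> (\<Union>n. U n)" "\<And>k. star (s k) = s k" "(\<lambda>k. s k * s k) \<longlonglongrightarrow> y * y"
proof -
  obtain t where t: "\<And>k. t k \<in> (\<Union>n. U n)" "t \<longlonglongrightarrow> y"
    using dense by (metis UNIV_I closure_sequential)
  define s where "s k = selfadjoint_part (t k)" for k
  have "s k \<in> (\<Union>n. U n)" for k
  proof -
    obtain n where "t k \<in> U n" using t(1)[of k] by blast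
    then have "s k \<in> U n" using cstar_subalgebraD[OF U[of n]] by (simp add: s_def selfadjoint_part_def)
    then show ?thesis by blast
  qed
  moreover have "s \<longlonglongrightarrow> (1/2) *\<^sub>R (y + star y)"
    unfolding s_def selfadjoint_part_def by (intro tendsto_intros t tendsto_star)
  then have "s \<longlonglongrightarrow> y" by (simp add: y flip: scaleR_2)
  then have "(\<lambda>k. s k * s k) \<longlonglongrightarrow> y * y" by (intro tendsto_mult)
  ultimately show ?thesis using that[of s] by (simp add: s_def star_selfadjoint_part)
qed

lemma trace_mem:
  "I \<in> closed_ideals UNIV \<Longrightarrow> I \<inter> U n \<in> closed_ideals (U n)"
  by (rule trace_closed_ideal[OF cstar_subalgebra_UNIV U]) auto

lemma ideal_trace_mem: "I \<in> closed_ideals UNIV \<Longrightarrow> ideal_trace U I \<in> ideals_infty U"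
  using trace_mem[of I] incseq_SucD[OF inc] by (auto simp: ideals_infty_def ideal_trace_def)

lemma infdist_square_trace:
  "I \<in> closed_ideals UNIV \<Longrightarrow> y \<in> U n \<Longrightarrow> star y = y \<Longrightarrow> infdist (y * y) (I \<inter> U n) = infdist (y * y) I"
  using cstar_subalgebraD(6)[OF U[of n]]
  by (intro infdist_trace[OF cstar_subalgebra_UNIV U]) (simp_all add: star_mult)

lemma topspace_fell_trace: "topspace (fell_trace_topology U) = closed_ideals UNIV"
proof -
  have "ideals_infty U \<subseteq> topspace (product_topology (\<lambda>n. fell_ideal_topology (U n)) UNIV)"
    by (auto simp: ideals_infty_def topspace_product_topology topspace_fell_ideal[OF U])
  then have "topspace (fell_infty_topology U) = ideals_infty U"
    by (auto simp: fell_infty_topology_def)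
  then show ?thesis
    using ideal_trace_mem by (auto simp: fell_trace_topology_def topspace_pullback_topology)
qed

lemma continuous_map_fell_trace:
  "continuous_map (fell_ideal_topology UNIV) (fell_trace_topology U) (\<lambda>I. I)"
  unfolding fell_trace_topology_def
proof (rule continuous_map_pullback')
  show "topspace (fell_ideal_topology UNIV) \<subseteq> (\<lambda>I. I) -` closed_ideals UNIV"
    by (auto simp: topspace_fell_ideal[OF cstar_subalgebra_UNIV])
  have "continuous_map (fell_ideal_topology UNIV) (fell_ideal_topology (U n)) (\<lambda>I. I \<inter> U n)" for n
  proof (rule continuous_map_into_fell_ideal[OF U])
    fix y assume y: "y \<in> U n" "star y = y"
    show "continuous_map (fell_ideal_topology UNIV) euclideanreal (\<lambda>I. infdist (y * y) (I \<inter> U n))"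
      by (rule continuous_map_eq[OF continuous_map_infdist[OF cstar_subalgebra_UNIV _ y(2)]])
        (use infdist_square_trace y in \<open>auto simp: topspace_fell_ideal[OF cstar_subalgebra_UNIV]\<close>)
  qed (use trace_mem in \<open>auto simp: topspace_fell_ideal[OF cstar_subalgebra_UNIV]\<close>)
  then have "continuous_map (fell_ideal_topology UNIV)
      (product_topology (\<lambda>n. fell_ideal_topology (U n)) UNIV) (ideal_trace U)"
    by (simp add: continuous_map_componentwise_UNIV ideal_trace_def)
  then show "continuous_map (fell_ideal_topology UNIV) (fell_infty_topology U) (ideal_trace U \<circ> (\<lambda>I. I))"
    unfolding fell_infty_topology_def
    using ideal_trace_mem by (auto simp: continuous_map_in_subtopology topspace_fell_ideal[OF cstar_subalgebra_UNIV] o_def)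
qed

lemma continuous_map_trace_component:
  "continuous_map (fell_trace_topology U) (fell_ideal_topology (U n)) (\<lambda>I. I \<inter> U n)"
proof -
  have "continuous_map (fell_infty_topology U) (fell_ideal_topology (U n)) (\<lambda>J. J n)"
    unfolding fell_infty_topology_def
    by (intro continuous_map_from_subtopology continuous_map_product_projection) simp
  then have "continuous_map (fell_trace_topology U) (fell_ideal_topology (U n)) ((\<lambda>J. J n) \<circ> ideal_trace U)"
    unfolding fell_trace_topology_def by (rule continuous_map_pullback)
  then show ?thesis by (simp add: o_def ideal_trace_def)
qed

text \<open>On the union of the subalgebras the distances are already determined by the traces; elsewhere
  they are uniform limits of such distances.\<close>

lemma continuous_map_fell:
  "continuous_map (fell_trace_topology U) (fell_ideal_topology UNIV) (\<lambda>I. I)"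
proof (rule continuous_map_into_fell_ideal[OF cstar_subalgebra_UNIV])
  show "I \<in> topspace (fell_trace_topology U) \<Longrightarrow> I \<in> closed_ideals UNIV" for I
    by (simp add: topspace_fell_trace)
  fix y :: 'a assume "star y = y"
  then obtain s where s: "\<And>k. s k \<in> (\<Union>n. U n)" "\<And>k. star (s k) = s k" "(\<lambda>k. s k * s k) \<longlonglongrightarrow> y * y"
    using selfadjoint_approximation by blast
  have c: "continuous_map (fell_trace_topology U) euclideanreal (\<lambda>I. infdist (s k * s k) I)" for k
  proof -
    obtain n where n: "s k \<in> U n" using s(1)[of k] by blast
    have "continuous_map (fell_trace_topology U) euclideanreal ((\<lambda>I. infdist (s k * s k) I) \<circ> (\<lambda>I. I \<inter> U n))"
      by (rule continuous_map_compose[OF continuous_map_trace_component continuous_map_infdist[OF U n s(2)]])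
    then show ?thesis
      by (rule continuous_map_eq) (use infdist_square_trace[OF _ n s(2)] in \<open>simp add: topspace_fell_trace\<close>)
  qed
  have "continuous_map (fell_trace_topology U) Met_TC.mtopology (\<lambda>I. infdist (y * y) I)"
  proof (rule Met_TC.continuous_map_uniform_limit[where F=sequentially and f="\<lambda>k I. infdist (s k * s k) I"])
    show "\<forall>\<^sub>F k in sequentially. continuous_map (fell_trace_topology U) Met_TC.mtopology (\<lambda>I. infdist (s k * s k) I)"
      using c by simp
    fix e :: real assume e: "0 < e"
    show "\<forall>\<^sub>F k in sequentially. \<forall>I\<in>topspace (fell_trace_topology U).
        infdist (y * y) I \<in> UNIV \<and> dist (infdist (s k * s k) I) (infdist (y * y) I) < e"
      using tendstoD[OF s(3) e]
    proof eventually_elim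
      case (elim k)
      then show ?case
        using infdist_triangle_abs[of "s k * s k" _ "y * y"] by (auto simp: dist_real_def intro: le_less_trans)
    qed
  qed simp
  then show "continuous_map (fell_trace_topology U) euclideanreal (\<lambda>I. infdist (y * y) I)" by simp
qed

text \<open>The identity is continuous in both directions.\<close>

theorem fell_trace_eq_fell: "fell_trace_topology U = fell_ideal_topology UNIV"
proof -
  have "openin (fell_trace_topology U) S \<longleftrightarrow> openin (fell_ideal_topology UNIV) S" for S
  proof
    assume S: "openin (fell_trace_topology U) S"
    have "{I \<in> topspace (fell_ideal_topology UNIV). I \<in> S} = S"
      using openin_subset[OF S] by (auto simp: topspace_fell_trace topspace_fell_ideal[OF cstar_subalgebra_UNIV])
    then show "openin (fell_ideal_topology UNIV) S"
      using openin_continuous_map_preimage[OF continuous_map_fell_trace S] by simp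
  next
    assume S: "openin (fell_ideal_topology UNIV) S"
    have "{I \<in> topspace (fell_trace_topology U). I \<in> S} = S"
      using openin_subset[OF S] by (auto simp: topspace_fell_trace topspace_fell_ideal[OF cstar_subalgebra_UNIV])
    then show "openin (fell_trace_topology U) S"
      using openin_continuous_map_preimage[OF continuous_map_fell S] by simp
  qed
  then show ?thesis by (simp add: topology_eq)
qed

lemma closure_alg_ideal: "J \<in> alg_ideals_prod U \<Longrightarrow> closure J \<in> closed_ideals UNIV"
  using closure_two_sided_ideal[of "\<Union>n. U n" J] dense by (simp add: alg_ideals_prod_def)

lemma trace_union_mem:
  assumes I: "I \<in> closed_ideals UNIV"
  shows "I \<inter> (\<Union>n. U n) \<in> alg_ideals_prod U"
proof -
  have two: "\<exists>n. a \<in> U n \<and> b \<in> U n" if ab: "a \<in> (\<Union>n. U n)" "b \<in> (\<Union>n. U n)" for a b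
  proof -
    obtain m n where "a \<in> U m" "b \<in> U n" using ab by blast
    then have "a \<in> U (max m n)" "b \<in> U (max m n)"
      using incseqD[OF inc, of m "max m n"] incseqD[OF inc, of n "max m n"] by auto
    then show ?thesis by blast
  qed
  have mul: "a * b \<in> (\<Union>n. U n)" and add: "a + b \<in> (\<Union>n. U n)" if ab: "a \<in> (\<Union>n. U n)" "b \<in> (\<Union>n. U n)" for a b
  proof -
    obtain n where n: "a \<in> U n" "b \<in> U n" using two[OF ab] by metis
    show "a * b \<in> (\<Union>n. U n)" using cstar_subalgebraD(6)[OF U n] by blast
    show "a + b \<in> (\<Union>n. U n)" using cstar_subalgebraD(2)[OF U n] by blast
  qed
  have "complex_vector.subspace (I \<inter> (\<Union>n. U n))"
  proof (rule complex_vector.subspaceI)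
    show "0 \<in> I \<inter> (\<Union>n. U n)" using closed_idealD(1)[OF I] cstar_subalgebraD(1)[OF U] by blast
    show "a + b \<in> I \<inter> (\<Union>n. U n)" if "a \<in> I \<inter> (\<Union>n. U n)" "b \<in> I \<inter> (\<Union>n. U n)" for a b
      using that add closed_idealD(2)[OF I] by blast
    show "c *\<^sub>C a \<in> I \<inter> (\<Union>n. U n)" if "a \<in> I \<inter> (\<Union>n. U n)" for c a
      using that closed_idealD(4)[OF I] cstar_subalgebraD(4)[OF U] by blast
  qed
  moreover have "a * x \<in> I \<inter> (\<Union>n. U n) \<and> x * a \<in> I \<inter> (\<Union>n. U n)"
    if "a \<in> (\<Union>n. U n)" "x \<in> I \<inter> (\<Union>n. U n)" for a x
    using that mul closed_idealD(6,7)[OF I] by auto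
  moreover have "I \<inter> (\<Union>n. U n) \<inter> U n \<in> closed_ideals (U n)" for n
  proof -
    have "I \<inter> (\<Union>n. U n) \<inter> U n = I \<inter> U n" by blast
    then show ?thesis using trace_mem[OF I] by simp
  qed
  ultimately show ?thesis unfolding alg_ideals_prod_def two_sided_ideal_def by blast
qed

text \<open>By density, the ideal and the closure of its trace have the same distances from all squares of
  self-adjoint elements.\<close>

lemma closure_trace_union:
  assumes I: "I \<in> closed_ideals UNIV"
  shows "closure (I \<inter> (\<Union>n. U n)) = I"
proof
  show "closure (I \<inter> (\<Union>n. U n)) \<subseteq> I" by (rule closure_minimal) (use closed_idealD(8)[OF I] in auto)
  define L where "L = closure (I \<inter> (\<Union>n. U n))"
  have L: "L \<in> closed_ideals UNIV" unfolding L_def by (rule closure_alg_ideal[OF trace_union_mem[OF I]])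
  have le: "infdist (y * y) L \<le> infdist (y * y) I" if y: "star y = y" for y
  proof -
    obtain s where s: "\<And>k. s k \<in> (\<Union>n. U n)" "\<And>k. star (s k) = s k" "(\<lambda>k. s k * s k) \<longlonglongrightarrow> y * y"
      using selfadjoint_approximation[OF y] by blast
    have "infdist (s k * s k) L \<le> infdist (s k * s k) I" for k
    proof -
      obtain n where n: "s k \<in> U n" using s(1)[of k] by blast
      have "I \<inter> U n \<subseteq> L" using closure_subset[of "I \<inter> (\<Union>n. U n)"] by (auto simp: L_def)
      moreover have "I \<inter> U n \<noteq> {}" using closed_idealD(1)[OF I] cstar_subalgebraD(1)[OF U] by blast
      ultimately show ?thesis
        using infdist_mono[of "I \<inter> U n" L "s k * s k"] infdist_square_trace[OF I n s(2)] by simp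
    qed
    then show ?thesis
      by (intro LIMSEQ_le[OF tendsto_infdist[OF s(3)] tendsto_infdist[OF s(3)]]) auto
  qed
  show "I \<subseteq> closure (I \<inter> (\<Union>n. U n))"
  proof (rule ccontr)
    assume "\<not> I \<subseteq> closure (I \<inter> (\<Union>n. U n))"
    then have "\<not> I \<subseteq> L" by (simp add: L_def)
    then obtain y where y: "y \<in> I" "star y = y" "y \<notin> L"
      by (rule exists_selfadjoint_not_mem[OF cstar_subalgebra_UNIV I L])
    have "0 < infdist (y * y) L"
      using infdist_square_pos_iff[OF cstar_subalgebra_UNIV L _ y(2)] y(3) by simp
    moreover have "y * y \<in> I" using closed_idealD(6)[OF I _ y(1)] by simp
    ultimately show False using le[OF y(2)] by simp
  qed
qed

theorem bij_betw_closure: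
  assumes "inj_on closure (alg_ideals_prod U)"
  shows "bij_betw closure (alg_ideals_prod U) (closed_ideals UNIV)"
proof -
  have "I \<in> closure ` alg_ideals_prod U" if "I \<in> closed_ideals UNIV" for I
    using closure_trace_union[OF that] trace_union_mem[OF that] by (metis imageI)
  then show ?thesis using assms closure_alg_ideal by (auto simp: bij_betw_def)
qed

end

theorem theorem3p18:
  fixes U :: "nat \<Rightarrow> 'a::cstar_algebra set"
  assumes "\<And>n. cstar_subalgebra (U n)"
    and "incseq U"
    and "closure (\<Union>n. U n) = UNIV"
  shows "(inj_on closure (alg_ideals_prod U) \<longrightarrow>
            bij_betw closure (alg_ideals_prod U) (closed_ideals UNIV) \<and>
            fell_trace_topology U = fell_ideal_topology UNIV) \<and>
         (AF_algebra (UNIV :: 'a set) \<and> (\<forall>n. finite_dimensional (U n)) \<longrightarrow>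
            fell_trace_topology U = fell_ideal_topology UNIV)"
  using bij_betw_closure[OF assms] fell_trace_eq_fell[OF assms] by blast

end
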